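(* Let $M$ be an oriented closed connected $n$-manifold with fundamental group $\Gamma:=\pi_1(M)$ and universal covering $\widetilde M$. Let $C_*$ be a countable $\mathbb Z\Gamma$-subcomplex of the singular chain complex $C_*(\widetilde M;\mathbb Z)$ such that the inclusion $C_*\hookrightarrow C_*(\widetilde M;\mathbb Z)$ is a $\mathbb Z\Gamma$-chain homotopy equivalence admitting a $\mathbb Z\Gamma$-chain homotopy inverse of norm at most $1$. Let $\alpha\colon\Gamma\curvearrowright X$ be a standard action, let $\Sigma$ be a $\Gamma$-invariant countable subalgebra of the Borel $\sigma$-algebra on $X$ that is dense with respect to every probability measure on $X$, and let $\mathrm B_\Sigma(\alpha,\mathbb Z):=\mathrm{Span}_{\mathbb Z}\{\chi_A\mid A\in\Sigma\}\subset\mathrm B(\alpha,\mathbb Z)$. Then the chain complex $$\Sigma_*(M,\alpha;\mathbb Z):=\mathrm B_\Sigma(\alpha,\mathbb Z)\otimes_{\mathbb Z\Gamma}C_*$$ has the following property: for every $\alpha$-invariant probability measure $\nu$ on $X$, $$|M|^{(\alpha,\nu)}=\inf\bigl\{|c|^{(\alpha,\nu)}\bigm|c\in\Sigma_*(M,\alpha;\mathbb Z)\text{ is a strict fundamental cycle}\bigr\}.$$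
   Context: A standard Borel space is a measurable space isomorphic to a Polish space with its Borel $\sigma$-algebra. A standard action is a measurable action $\alpha\colon\Gamma\curvearrowright X$ of a countable group $\Gamma$ on a standard Borel space $X$. A subalgebra $\Sigma$ (an algebra of sets) is $\Gamma$-invariant if $\gamma\cdot A\in\Sigma$ for all $A\in\Sigma,\gamma\in\Gamma$, and dense with respect to a probability measure $\mu$ if for every measurable $A\subset X$ and $\varepsilon>0$ there is $A'\in\Sigma$ with $\mu(A\mathbin{\triangle}A')<\varepsilon$. $\chi_A$ is the characteristic function of $A$. Let $\pi\colon\widetilde M\to M$ be the universal covering; $\Gamma$ acts on singular simplices of $\widetilde M$ by deck transformations. Norms of chain maps are with respect to the $\ell^1$-norm on $C_k(\widetilde M;\mathbb Z)$ for the basis of singular simplices and its restriction to $C_k$; norm at most $1$ means that the norm is not increased in any degree. For a right $\mathbb Z\Gamma$-module $A$ put $C_*(M;A):=A\otimes_{\mathbb Z\Gamma}C_*(\widetilde M;\mathbb Z)$ and $H_*(M;A):=H_*(C_*(M;A))$; for $A=\mathbb Z$ (trivial action) this is identified via $\pi$ with the usual singular chain complex of $M$. For an $\alpha$-invariant probability measure $\nu$, let $L^\infty(\alpha,\nu,\mathbb Z)$ be the right $\mathbb Z\Gamma$-module of $\nu$-a.e. equivalence classes of measurable $\nu$-essentially bounded functions $X\to\mathbb Z$, and let $\mathrm B(\alpha,\mathbb Z)$ be the right $\mathbb Z\Gamma$-module of measurable bounded functions $X\to\mathbb Z$, both with $(f\cdot\gamma)(x)=f(\gamma\cdot x)$.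 For $A$ either of these modules, the inclusion of $\mathbb Z$ as constant functions induces a chain map $C_*(M;\mathbb Z)\to C_*(M;A)$. Cycles in $C_n(M;A)$ representing the image of the integral fundamental class $[M]_{\mathbb Z}$ are called $(\alpha,\nu)$-parametrised fundamental cycles if $A=L^\infty(\alpha,\nu,\mathbb Z)$, and (strict) fundamental cycles if $A=\mathrm B(\alpha,\mathbb Z)$. A chain $c=\sum_{j=1}^m f_j\otimes\sigma_j$ (with $\sigma_j$ singular simplices of $\widetilde M$) in $C_*(M;A)$ is in reduced form if $\pi\circ\sigma_j\neq\pi\circ\sigma_k$ for all $j\ne k$; for such $c$ set $|c|^{(\alpha,\nu)}:=\sum_{j=1}^m\int_X|f_j|\,d\nu$ (every chain has an essentially unique reduced form). The $(\alpha,\nu)$-parametrised simplicial volume $|M|^{(\alpha,\nu)}$ is the infimum of $|c|^{(\alpha,\nu)}$ over all $(\alpha,\nu)$-parametrised fundamental cycles $c$. Elements of $\Sigma_*(M,\alpha;\mathbb Z)$ are regarded as strict chains in $C_*(M;\mathrm B(\alpha,\mathbb Z))$ via the map induced by the inclusions $\mathrm B_\Sigma(\alpha,\mathbb Z)\subset\mathrm B(\alpha,\mathbb Z)$ and $C_*\subset C_*(\widetilde M;\mathbb Z)$; "strict fundamental cycle" and $|c|^{(\alpha,\nu)}$ are understood via this map. *)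

theory Defs
  imports "HOL-Homology.Homology" "HOL-Algebra.Group_Action" "HOL-Probability.Probability"
begin

section \<open>Oriented closed manifolds and their fundamental class\<close>

definition closed_manifold :: "nat \<Rightarrow> 'a::topological_space set \<Rightarrow> bool" where
  "closed_manifold n M \<longleftrightarrow>
     compact M \<and> Hausdorff_space (top_of_set M) \<and> second_countable (top_of_set M) \<and>
     (\<forall>x\<in>M. \<exists>U V. openin (top_of_set M) U \<and> x \<in> U \<and> openin (Euclidean_space n) V \<and>
        top_of_set U homeomorphic_space subtopology (Euclidean_space n) V)"

abbreviation local_homology :: "nat \<Rightarrow> 'a::topological_space set \<Rightarrow> 'a set \<Rightarrow> 'a chain set monoid" where
  "local_homology n M U \<equiv> relative_homology_group (int n) (top_of_set M) (M - U)"

text \<open>An orientation is a locally consistent choice of generators of the local homology groups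
  \<open>H\<^sub>n(M, M - {x}) \<cong> \<int>\<close>.\<close>

definition orientation ::
    "nat \<Rightarrow> 'a::topological_space set \<Rightarrow> ('a \<Rightarrow> 'a chain set) \<Rightarrow> bool" where
  "orientation n M ort \<longleftrightarrow>
     (\<forall>x\<in>M. ort x \<in> carrier (local_homology n M {x}) \<and>
        generate (local_homology n M {x}) {ort x} = carrier (local_homology n M {x})) \<and>
     (\<forall>x\<in>M. \<exists>U. openin (top_of_set M) U \<and> x \<in> U \<and>
        (\<exists>m \<in> carrier (local_homology n M U). \<forall>y\<in>U.
           hom_induced (int n) (top_of_set M) (M - U) (top_of_set M) (M - {y}) id m = ort y))"

definition fundamental_class ::
    "nat \<Rightarrow> 'a::topological_space set \<Rightarrow> ('a \<Rightarrow> 'a chain set) \<Rightarrow> 'a chain set" where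
  "fundamental_class n M ort =
     (THE m. m \<in> carrier (homology_group (int n) (top_of_set M)) \<and>
        (\<forall>x\<in>M. hom_induced (int n) (top_of_set M) {} (top_of_set M) (M - {x}) id m = ort x))"


section \<open>Fundamental group and deck transformations\<close>

definition loops_at :: "'a::topological_space set \<Rightarrow> 'a \<Rightarrow> (real \<Rightarrow> 'a) set" where
  "loops_at M x = {c. path c \<and> path_image c \<subseteq> M \<and> pathstart c = x \<and> pathfinish c = x}"

definition fundamental_group ::
    "'a::topological_space set \<Rightarrow> 'a \<Rightarrow> (real \<Rightarrow> 'a) set monoid" where
  "fundamental_group M x =
     \<lparr>carrier = (\<lambda>c. Collect (homotopic_paths M c)) ` loops_at M x,
      monoid.mult = (\<lambda>g h. {d. \<exists>b\<in>g. \<exists>c\<in>h. homotopic_paths M (b +++ c) d}),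
      one = Collect (homotopic_paths M (\<lambda>_. x))\<rparr>"

definition deck_transformations ::
    "'b::topological_space set \<Rightarrow> ('b \<Rightarrow> 'a::topological_space) \<Rightarrow> ('b \<Rightarrow> 'b) set" where
  "deck_transformations Mt p =
     {h \<in> extensional Mt. homeomorphic_map (top_of_set Mt) (top_of_set Mt) h \<and>
        (\<forall>y\<in>Mt. p (h y) = p y)}"

text \<open>For the universal covering \<open>p\<close> of \<open>M\<close> and a point \<open>y\<close> over the base point of \<open>M\<close>, a class \<open>g\<close>
  of loops acts by the deck transformation that carries \<open>y\<close> to the endpoint of the lift starting
  at \<open>y\<close> of a loop in \<open>g\<close>.  As \<open>b +++ c\<close> runs through \<open>b\<close> first, this is a left action.\<close>

definition deck ::
    "'b::topological_space set \<Rightarrow> ('b \<Rightarrow> 'a::topological_space) \<Rightarrow> 'b \<Rightarrow> (real \<Rightarrow> 'a) set \<Rightarrow> 'b \<Rightarrow> 'b"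
  where
  "deck Mt p y g =
     (THE h. h \<in> deck_transformations Mt p \<and>
        (\<exists>b\<in>g. \<exists>c. path c \<and> path_image c \<subseteq> Mt \<and> pathstart c = y \<and>
           (\<forall>t\<in>{0..1}. p (c t) = b t) \<and> h y = pathfinish c))"


section \<open>Modules over an integral group ring and their tensor product\<close>

text \<open>A module over the integral group ring of a group \<open>\<Gamma>\<close> is an abelian group together with an
  action of \<open>\<Gamma>\<close>. The same record serves left modules, where \<open>act A g a\<close> is \<open>g \<cdot> a\<close>, and
  right modules, where it is \<open>a \<cdot> g\<close>.\<close>

record ('a, 'g) gmodule = "'a monoid" +
  act :: "'g \<Rightarrow> 'a \<Rightarrow> 'a"

definition with_act :: "'a monoid \<Rightarrow> ('g \<Rightarrow> 'a \<Rightarrow> 'a) \<Rightarrow> ('a, 'g) gmodule" where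
  "with_act A r = \<lparr>carrier = carrier A, monoid.mult = monoid.mult A, one = one A, act = r\<rparr>"

definition equivariant_hom ::
    "'g monoid \<Rightarrow> ('a, 'g) gmodule \<Rightarrow> ('b, 'g) gmodule \<Rightarrow> ('a \<Rightarrow> 'b) set" where
  "equivariant_hom \<Gamma> A B =
     {f \<in> hom A B. \<forall>g\<in>carrier \<Gamma>. \<forall>a\<in>carrier A. f (act A g a) = act B g (f a)}"

definition tensor_relations ::
    "'g monoid \<Rightarrow> ('a, 'g) gmodule \<Rightarrow> ('c, 'g) gmodule \<Rightarrow> ('a \<times> 'c \<Rightarrow>\<^sub>0 int) set" where
  "tensor_relations \<Gamma> A D =
     generate (free_Abelian_group (carrier A \<times> carrier D))
       ({frag_of (a \<otimes>\<^bsub>A\<^esub> b, c) - frag_of (a, c) - frag_of (b, c) | a b c.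
           a \<in> carrier A \<and> b \<in> carrier A \<and> c \<in> carrier D} \<union>
        {frag_of (a, c \<otimes>\<^bsub>D\<^esub> d) - frag_of (a, c) - frag_of (a, d) | a c d.
           a \<in> carrier A \<and> c \<in> carrier D \<and> d \<in> carrier D} \<union>
        {frag_of (act A g a, c) - frag_of (a, act D g c) | g a c.
           g \<in> carrier \<Gamma> \<and> a \<in> carrier A \<and> c \<in> carrier D})"

definition tensor ::
    "'g monoid \<Rightarrow> ('a, 'g) gmodule \<Rightarrow> ('c, 'g) gmodule \<Rightarrow> ('a \<times> 'c \<Rightarrow>\<^sub>0 int) set monoid" where
  "tensor \<Gamma> A D = free_Abelian_group (carrier A \<times> carrier D) Mod tensor_relations \<Gamma> A D"

definition tensor_class ::
    "'g monoid \<Rightarrow> ('a, 'g) gmodule \<Rightarrow> ('c, 'g) gmodule \<Rightarrow>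
       ('a \<times> 'c \<Rightarrow>\<^sub>0 int) \<Rightarrow> ('a \<times> 'c \<Rightarrow>\<^sub>0 int) set" where
  "tensor_class \<Gamma> A D u =
     tensor_relations \<Gamma> A D #>\<^bsub>free_Abelian_group (carrier A \<times> carrier D)\<^esub> u"

text \<open>The map \<open>\<phi> \<otimes> \<psi>\<close> into the tensor product of \<open>A\<close> and \<open>D\<close>. Equivariant homomorphisms \<open>\<phi>\<close> and
  \<open>\<psi>\<close> send all representatives of \<open>\<xi>\<close> to the same class, so that the union is a single coset.\<close>

definition tensor_map ::
    "'g monoid \<Rightarrow> ('a, 'g) gmodule \<Rightarrow> ('c, 'g) gmodule \<Rightarrow> ('b \<Rightarrow> 'a) \<Rightarrow> ('d \<Rightarrow> 'c) \<Rightarrow>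
       ('b \<times> 'd \<Rightarrow>\<^sub>0 int) set \<Rightarrow> ('a \<times> 'c \<Rightarrow>\<^sub>0 int) set" where
  "tensor_map \<Gamma> A D \<phi> \<psi> \<xi> =
     (\<Union>u\<in>\<xi>. tensor_class \<Gamma> A D (frag_extend (\<lambda>(b, d). frag_of (\<phi> b, \<psi> d)) u))"


section \<open>Equivariant complexes of singular chains\<close>

definition singular_complex ::
    "'b::topological_space set \<Rightarrow> ('b \<Rightarrow> 'a::topological_space) \<Rightarrow> 'b \<Rightarrow>
       nat \<Rightarrow> ('b chain, (real \<Rightarrow> 'a) set) gmodule" where
  "singular_complex Mt p y k =
     with_act (chain_group k (top_of_set Mt)) (\<lambda>g. chain_map k (deck Mt p y g))"

definition gsubcomplex :: "'g monoid \<Rightarrow> (nat \<Rightarrow> ('b chain, 'g) gmodule) \<Rightarrow> (nat \<Rightarrow> 'b chain set) \<Rightarrow> bool"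
  where
  "gsubcomplex \<Gamma> D C \<longleftrightarrow>
     (\<forall>k. subgroup (C k) (D k) \<and> (\<forall>g\<in>carrier \<Gamma>. \<forall>c\<in>C k. act (D k) g c \<in> C k) \<and>
        (\<forall>c\<in>C k. chain_boundary k c \<in> C (k - 1)))"

definition restrict_complex ::
    "(nat \<Rightarrow> ('b chain, 'g) gmodule) \<Rightarrow> (nat \<Rightarrow> 'b chain set) \<Rightarrow> nat \<Rightarrow> ('b chain, 'g) gmodule" where
  "restrict_complex D C k = (D k)\<lparr>carrier := C k\<rparr>"

text \<open>In degree 0, compatibility with the boundary is void because \<^const>\<open>chain_boundary\<close> is zero there.\<close>

definition gchain_map ::
    "'g monoid \<Rightarrow> (nat \<Rightarrow> ('b chain, 'g) gmodule) \<Rightarrow> (nat \<Rightarrow> ('b chain, 'g) gmodule) \<Rightarrow>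
       (nat \<Rightarrow> 'b chain \<Rightarrow> 'b chain) \<Rightarrow> bool" where
  "gchain_map \<Gamma> D E f \<longleftrightarrow>
     (\<forall>k. f k \<in> equivariant_hom \<Gamma> (D k) (E k) \<and>
        (\<forall>c\<in>carrier (D k). chain_boundary k (f k c) = f (k - 1) (chain_boundary k c)))"

definition gchain_homotopic ::
    "'g monoid \<Rightarrow> (nat \<Rightarrow> ('b chain, 'g) gmodule) \<Rightarrow> (nat \<Rightarrow> ('b chain, 'g) gmodule) \<Rightarrow>
       (nat \<Rightarrow> 'b chain \<Rightarrow> 'b chain) \<Rightarrow> (nat \<Rightarrow> 'b chain \<Rightarrow> 'b chain) \<Rightarrow> bool" where
  "gchain_homotopic \<Gamma> D E f f' \<longleftrightarrow>
     (\<exists>h. \<forall>k. h k \<in> equivariant_hom \<Gamma> (D k) (E (Suc k)) \<and>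
        (\<forall>c\<in>carrier (D k). f k c - f' k c =
           chain_boundary (Suc k) (h k c) + (if k = 0 then 0 else h (k - 1) (chain_boundary k c))))"

definition gchain_homotopy_inverse ::
    "'g monoid \<Rightarrow> (nat \<Rightarrow> ('b chain, 'g) gmodule) \<Rightarrow> (nat \<Rightarrow> ('b chain, 'g) gmodule) \<Rightarrow>
       (nat \<Rightarrow> 'b chain \<Rightarrow> 'b chain) \<Rightarrow> (nat \<Rightarrow> 'b chain \<Rightarrow> 'b chain) \<Rightarrow> bool" where
  "gchain_homotopy_inverse \<Gamma> D E i f \<longleftrightarrow>
     gchain_map \<Gamma> D E i \<and> gchain_map \<Gamma> E D f \<and>
     gchain_homotopic \<Gamma> D D (\<lambda>k. f k \<circ> i k) (\<lambda>k. id) \<and>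
     gchain_homotopic \<Gamma> E E (\<lambda>k. i k \<circ> f k) (\<lambda>k. id)"

definition l1_norm :: "'b chain \<Rightarrow> int" where
  "l1_norm c = (\<Sum>\<sigma>\<in>Poly_Mapping.keys c. \<bar>Poly_Mapping.lookup c \<sigma>\<bar>)"

definition norm_at_most_1 ::
    "(nat \<Rightarrow> ('b chain, 'g) gmodule) \<Rightarrow> (nat \<Rightarrow> 'b chain \<Rightarrow> 'b chain) \<Rightarrow> bool" where
  "norm_at_most_1 D f \<longleftrightarrow> (\<forall>k. \<forall>c\<in>carrier (D k). l1_norm (f k c) \<le> l1_norm c)"


section \<open>Chains with twisted coefficients\<close>

definition twisted_boundary ::
    "'g monoid \<Rightarrow> ('a, 'g) gmodule \<Rightarrow> (nat \<Rightarrow> ('b chain, 'g) gmodule) \<Rightarrow> nat \<Rightarrow>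
       ('a \<times> 'b chain \<Rightarrow>\<^sub>0 int) set \<Rightarrow> ('a \<times> 'b chain \<Rightarrow>\<^sub>0 int) set" where
  "twisted_boundary \<Gamma> A D k = tensor_map \<Gamma> A (D (k - 1)) id (chain_boundary k)"

definition twisted_cycles ::
    "'g monoid \<Rightarrow> ('a, 'g) gmodule \<Rightarrow> (nat \<Rightarrow> ('b chain, 'g) gmodule) \<Rightarrow> nat \<Rightarrow>
       ('a \<times> 'b chain \<Rightarrow>\<^sub>0 int) set set" where
  "twisted_cycles \<Gamma> A D k =
     {\<xi> \<in> carrier (tensor \<Gamma> A (D k)). twisted_boundary \<Gamma> A D k \<xi> = \<one>\<^bsub>tensor \<Gamma> A (D (k - 1))\<^esub>}"

definition twisted_boundaries ::
    "'g monoid \<Rightarrow> ('a, 'g) gmodule \<Rightarrow> (nat \<Rightarrow> ('b chain, 'g) gmodule) \<Rightarrow> nat \<Rightarrow>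
       ('a \<times> 'b chain \<Rightarrow>\<^sub>0 int) set set" where
  "twisted_boundaries \<Gamma> A D k =
     twisted_boundary \<Gamma> A D (Suc k) ` carrier (tensor \<Gamma> A (D (Suc k)))"

definition trivial_module :: "(int, 'g) gmodule" where
  "trivial_module = with_act integer_group (\<lambda>_. id)"

text \<open>The identification of integral twisted chains with the singular chains of the base:
  \<open>z \<otimes> \<sigma>\<close> corresponds to \<open>z \<cdot> (p \<circ> \<sigma>)\<close>. This is constant on the representatives of a class.\<close>

definition push_down ::
    "('b \<Rightarrow> 'a) \<Rightarrow> nat \<Rightarrow> (int \<times> 'b chain \<Rightarrow>\<^sub>0 int) set \<Rightarrow> 'a chain" where
  "push_down p k \<zeta> = the_elem (frag_extend (\<lambda>(z, c). frag_cmul z (chain_map k p c)) ` \<zeta>)"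

text \<open>Cycles with coefficients in \<open>A\<close> representing the image of the integral homology class \<open>m\<close> of
  the base under the inclusion \<open>\<iota>\<close> of the constants into \<open>A\<close>.\<close>

definition cycles_representing ::
    "'g monoid \<Rightarrow> (nat \<Rightarrow> ('b chain, 'g) gmodule) \<Rightarrow> ('b \<Rightarrow> 'a) \<Rightarrow> nat \<Rightarrow> 'a chain set \<Rightarrow>
       ('m, 'g) gmodule \<Rightarrow> (int \<Rightarrow> 'm) \<Rightarrow> ('m \<times> 'b chain \<Rightarrow>\<^sub>0 int) set set" where
  "cycles_representing \<Gamma> D p n m A \<iota> =
     {\<xi> \<in> twisted_cycles \<Gamma> A D n.
        \<exists>\<zeta> \<in> twisted_cycles \<Gamma> trivial_module D n. push_down p n \<zeta> \<in> m \<and>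
          \<xi> \<in> twisted_boundaries \<Gamma> A D n #>\<^bsub>tensor \<Gamma> A (D n)\<^esub> tensor_map \<Gamma> A (D n) \<iota> id \<zeta>}"

definition reduced_form ::
    "'g monoid \<Rightarrow> 'b::topological_space set \<Rightarrow> ('b \<Rightarrow> 'a) \<Rightarrow> nat \<Rightarrow> ('m, 'g) gmodule \<Rightarrow>
       ('b chain, 'g) gmodule \<Rightarrow> nat \<Rightarrow> (nat \<Rightarrow> 'm) \<Rightarrow> (nat \<Rightarrow> (nat \<Rightarrow> real) \<Rightarrow> 'b) \<Rightarrow>
       ('m \<times> 'b chain \<Rightarrow>\<^sub>0 int) set \<Rightarrow> bool" where
  "reduced_form \<Gamma> Mt p k A D m f \<sigma> \<xi> \<longleftrightarrow>
     (\<forall>j<m. f j \<in> carrier A \<and> singular_simplex k (top_of_set Mt) (\<sigma> j)) \<and>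
     inj_on (\<lambda>j. simplex_map k p (\<sigma> j)) {..<m} \<and>
     \<xi> = tensor_class \<Gamma> A D (\<Sum>j<m. frag_of (f j, frag_of (\<sigma> j)))"

text \<open>Here \<open>I f\<close> stands for the integral of \<open>\<bar>f\<bar>\<close>. All reduced forms of a chain give the same value.\<close>

definition reduced_norm ::
    "'g monoid \<Rightarrow> 'b::topological_space set \<Rightarrow> ('b \<Rightarrow> 'a) \<Rightarrow> nat \<Rightarrow> ('m, 'g) gmodule \<Rightarrow>
       ('b chain, 'g) gmodule \<Rightarrow> ('m \<Rightarrow> real) \<Rightarrow> ('m \<times> 'b chain \<Rightarrow>\<^sub>0 int) set \<Rightarrow> real" where
  "reduced_norm \<Gamma> Mt p k A D I \<xi> =
     (THE r. \<exists>m f \<sigma>. reduced_form \<Gamma> Mt p k A D m f \<sigma> \<xi> \<and> r = (\<Sum>j<m. I (f j)))"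


section \<open>Standard actions and their coefficient modules\<close>

text \<open>The Polish topology may be taken on the type of \<open>X\<close>, since it can be transported along the
  isomorphism.\<close>

definition standard_borel :: "'x measure \<Rightarrow> bool" where
  "standard_borel X \<longleftrightarrow>
     (\<exists>(T :: 'x topology) \<phi> \<psi>. completely_metrizable_space T \<and> second_countable T \<and>
        \<phi> \<in> measurable X (sigma (topspace T) {U. openin T U}) \<and>
        \<psi> \<in> measurable (sigma (topspace T) {U. openin T U}) X \<and>
        (\<forall>x\<in>space X. \<psi> (\<phi> x) = x) \<and> (\<forall>y\<in>topspace T. \<phi> (\<psi> y) = y))"

definition standard_action :: "'g monoid \<Rightarrow> 'x measure \<Rightarrow> ('g \<Rightarrow> 'x \<Rightarrow> 'x) \<Rightarrow> bool" where
  "standard_action \<Gamma> X \<alpha> \<longleftrightarrow>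
     standard_borel X \<and> countable (carrier \<Gamma>) \<and> group_action \<Gamma> (space X) \<alpha> \<and>
     (\<forall>g\<in>carrier \<Gamma>. \<alpha> g \<in> measurable X X)"

definition invariant_prob ::
    "'g monoid \<Rightarrow> 'x measure \<Rightarrow> ('g \<Rightarrow> 'x \<Rightarrow> 'x) \<Rightarrow> 'x measure \<Rightarrow> bool" where
  "invariant_prob \<Gamma> X \<alpha> \<nu> \<longleftrightarrow>
     prob_space \<nu> \<and> sets \<nu> = sets X \<and> (\<forall>g\<in>carrier \<Gamma>. distr \<nu> \<nu> (\<alpha> g) = \<nu>)"

definition dense_subalgebra :: "'x set set \<Rightarrow> 'x measure \<Rightarrow> bool" where
  "dense_subalgebra \<A> \<mu> \<longleftrightarrow>
     (\<forall>A\<in>sets \<mu>. \<forall>\<epsilon>>0. \<exists>A'\<in>\<A>. measure \<mu> (sym_diff A A') < \<epsilon>)"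

text \<open>Functions on \<open>X\<close> are represented by functions vanishing outside \<open>space X\<close>.\<close>

definition function_module ::
    "'x measure \<Rightarrow> ('g \<Rightarrow> 'x \<Rightarrow> 'x) \<Rightarrow> ('x \<Rightarrow> int) set \<Rightarrow> ('x \<Rightarrow> int, 'g) gmodule" where
  "function_module X \<alpha> F =
     \<lparr>carrier = F, monoid.mult = (\<lambda>f f' x. f x + f' x), one = (\<lambda>_. 0),
      act = (\<lambda>g f x. if x \<in> space X then f (\<alpha> g x) else 0)\<rparr>"

definition const_function :: "'x measure \<Rightarrow> int \<Rightarrow> 'x \<Rightarrow> int" where
  "const_function X z = (\<lambda>x. if x \<in> space X then z else 0)"

definition bounded_module :: "'x measure \<Rightarrow> ('g \<Rightarrow> 'x \<Rightarrow> 'x) \<Rightarrow> ('x \<Rightarrow> int, 'g) gmodule" where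
  "bounded_module X \<alpha> = function_module X \<alpha>
     {f \<in> measurable X (count_space UNIV).
        (\<forall>x. x \<notin> space X \<longrightarrow> f x = 0) \<and> (\<exists>b. \<forall>x\<in>space X. \<bar>f x\<bar> \<le> b)}"

definition span_module ::
    "'x measure \<Rightarrow> ('g \<Rightarrow> 'x \<Rightarrow> 'x) \<Rightarrow> 'x set set \<Rightarrow> ('x \<Rightarrow> int, 'g) gmodule" where
  "span_module X \<alpha> \<A> =
     (bounded_module X \<alpha>)\<lparr>carrier := generate (bounded_module X \<alpha>) {indicator A | A. A \<in> \<A>}\<rparr>"

definition ess_bounded_module :: "'x measure \<Rightarrow> ('g \<Rightarrow> 'x \<Rightarrow> 'x) \<Rightarrow> ('x \<Rightarrow> int, 'g) gmodule" where
  "ess_bounded_module \<nu> \<alpha> = function_module \<nu> \<alpha>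
     {f \<in> measurable \<nu> (count_space UNIV).
        (\<forall>x. x \<notin> space \<nu> \<longrightarrow> f x = 0) \<and> (\<exists>b. AE x in \<nu>. \<bar>f x\<bar> \<le> b)}"

definition null_functions :: "'x measure \<Rightarrow> ('x \<Rightarrow> int) set" where
  "null_functions \<nu> =
     {f \<in> measurable \<nu> (count_space UNIV). (\<forall>x. x \<notin> space \<nu> \<longrightarrow> f x = 0) \<and> (AE x in \<nu>. f x = 0)}"

definition Linf_module :: "'x measure \<Rightarrow> ('g \<Rightarrow> 'x \<Rightarrow> 'x) \<Rightarrow> (('x \<Rightarrow> int) set, 'g) gmodule" where
  "Linf_module \<nu> \<alpha> =
     with_act (ess_bounded_module \<nu> \<alpha> Mod null_functions \<nu>)
       (\<lambda>g F. act (ess_bounded_module \<nu> \<alpha>) g ` F)"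

definition Linf_constant :: "'x measure \<Rightarrow> ('g \<Rightarrow> 'x \<Rightarrow> 'x) \<Rightarrow> int \<Rightarrow> ('x \<Rightarrow> int) set" where
  "Linf_constant \<nu> \<alpha> z = null_functions \<nu> #>\<^bsub>ess_bounded_module \<nu> \<alpha>\<^esub> const_function \<nu> z"

definition abs_integral :: "'x measure \<Rightarrow> ('x \<Rightarrow> int) \<Rightarrow> real" where
  "abs_integral \<nu> f = (\<integral>x. real_of_int \<bar>f x\<bar> \<partial>\<nu>)"

definition Linf_abs_integral :: "'x measure \<Rightarrow> ('x \<Rightarrow> int) set \<Rightarrow> real" where
  "Linf_abs_integral \<nu> F = abs_integral \<nu> (SOME f. f \<in> F)"


section \<open>Parametrised and strict fundamental cycles\<close>

text \<open>Throughout, \<open>\<Gamma>\<close> is the fundamental group of the base, \<open>D\<close> the equivariant singular chain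
  complex of the universal covering \<open>p\<close> with total space \<open>Mt\<close>, and \<open>m\<close> the fundamental class.\<close>

definition parametrised_simplicial_volume ::
    "'g monoid \<Rightarrow> 'b::topological_space set \<Rightarrow> (nat \<Rightarrow> ('b chain, 'g) gmodule) \<Rightarrow> ('b \<Rightarrow> 'a) \<Rightarrow>
       nat \<Rightarrow> 'a chain set \<Rightarrow> ('g \<Rightarrow> 'x \<Rightarrow> 'x) \<Rightarrow> 'x measure \<Rightarrow> real" where
  "parametrised_simplicial_volume \<Gamma> Mt D p n m \<alpha> \<nu> =
     (INF c \<in> cycles_representing \<Gamma> D p n m (Linf_module \<nu> \<alpha>) (Linf_constant \<nu> \<alpha>).
        reduced_norm \<Gamma> Mt p n (Linf_module \<nu> \<alpha>) (D n) (Linf_abs_integral \<nu>) c)"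

definition strict_fundamental_cycles ::
    "'g monoid \<Rightarrow> (nat \<Rightarrow> ('b chain, 'g) gmodule) \<Rightarrow> ('b \<Rightarrow> 'a) \<Rightarrow> nat \<Rightarrow> 'a chain set \<Rightarrow>
       'x measure \<Rightarrow> ('g \<Rightarrow> 'x \<Rightarrow> 'x) \<Rightarrow> (('x \<Rightarrow> int) \<times> 'b chain \<Rightarrow>\<^sub>0 int) set set" where
  "strict_fundamental_cycles \<Gamma> D p n m X \<alpha> =
     cycles_representing \<Gamma> D p n m (bounded_module X \<alpha>) (const_function X)"

definition strict_norm ::
    "'g monoid \<Rightarrow> 'b::topological_space set \<Rightarrow> (nat \<Rightarrow> ('b chain, 'g) gmodule) \<Rightarrow> ('b \<Rightarrow> 'a) \<Rightarrow>
       nat \<Rightarrow> 'x measure \<Rightarrow> ('g \<Rightarrow> 'x \<Rightarrow> 'x) \<Rightarrow> 'x measure \<Rightarrow>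
       (('x \<Rightarrow> int) \<times> 'b chain \<Rightarrow>\<^sub>0 int) set \<Rightarrow> real" where
  "strict_norm \<Gamma> Mt D p k X \<alpha> \<nu> =
     reduced_norm \<Gamma> Mt p k (bounded_module X \<alpha>) (D k) (abs_integral \<nu>)"

text \<open>The differential of this complex is that of \<^const>\<open>twisted_boundary\<close> for the same module and
  complex. Being a cycle is only ever asked of the image under \<open>Sigma_to_strict\<close> below.\<close>

definition Sigma_chains ::
    "'g monoid \<Rightarrow> (nat \<Rightarrow> ('b chain, 'g) gmodule) \<Rightarrow> (nat \<Rightarrow> 'b chain set) \<Rightarrow>
       'x measure \<Rightarrow> ('g \<Rightarrow> 'x \<Rightarrow> 'x) \<Rightarrow> 'x set set \<Rightarrow> nat \<Rightarrow>
       (('x \<Rightarrow> int) \<times> 'b chain \<Rightarrow>\<^sub>0 int) set monoid" where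
  "Sigma_chains \<Gamma> D C X \<alpha> \<A> k = tensor \<Gamma> (span_module X \<alpha> \<A>) (restrict_complex D C k)"

text \<open>The map to strict chains induced by the two inclusions; it need not be injective a priori.\<close>

definition Sigma_to_strict ::
    "'g monoid \<Rightarrow> (nat \<Rightarrow> ('b chain, 'g) gmodule) \<Rightarrow> 'x measure \<Rightarrow> ('g \<Rightarrow> 'x \<Rightarrow> 'x) \<Rightarrow> nat \<Rightarrow>
       (('x \<Rightarrow> int) \<times> 'b chain \<Rightarrow>\<^sub>0 int) set \<Rightarrow> (('x \<Rightarrow> int) \<times> 'b chain \<Rightarrow>\<^sub>0 int) set" where
  "Sigma_to_strict \<Gamma> D X \<alpha> k = tensor_map \<Gamma> (bounded_module X \<alpha>) (D k) id id"

end

theory Submission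
  imports Defs
begin

text \<open>A strict cycle becomes a parametrised one of the same norm under the quotient map
  \<open>B(\<alpha>, \<int>) \<rightarrow> L\<^sup>\<infinity>(\<alpha>, \<nu>, \<int>)\<close>, which gives one inequality. Conversely, write a parametrised fundamental
  cycle as \<open>u = \<iota> w + \<partial> d\<close> with an integral cycle \<open>w\<close>, and let \<open>f\<close> be the homotopy inverse of norm at
  most \<open>1\<close>. Then \<open>f u = \<iota> (f w) + \<partial> (f d)\<close> is not longer than \<open>u\<close>. Replacing the coefficients of \<open>f d\<close> by
  \<open>L\<^sup>1\<close>-close elements of \<open>B\<^sub>\<Sigma>(\<alpha>, \<int>)\<close> yields a chain over \<open>B\<^sub>\<Sigma>(\<alpha>, \<int>)\<close> whose norm changes little, and it is a
  strict fundamental cycle because \<open>f w\<close> is homologous to \<open>w\<close>.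

  That the norm can be read off any reduced form rests on the fact that the fundamental group acts
  freely on the singular simplices of the universal covering, with the lifts of a given simplex of
  the base as orbits.\<close>

section \<open>Lifting along coverings of topological spaces\<close>

text \<open>Chains are cosets of formal sums, and their norm is a definite description over reduced
  forms; neither lends itself to estimates. All estimates are therefore made on formal sums, with a
  functional \<open>fnorm\<close> that is constant on cosets. Fix one simplex in each deck orbit.
  The rule a \<otimes> g s = (a . g) \<otimes> s moves every term to such a simplex, so a formal sum
  determines one integrable function for each simplex of the base, and \<open>fnorm\<close> adds up
  the L1-norms of these functions. The tensor relations change the functions on null sets only.

  Two points make the approximation work. The error is measured after taking the boundary: a
  coefficient error over a fixed chain c of degree n+1 costs at most its L1-size times the l1-norm
  of the boundary of c, a finite constant. And the integral part has constant coefficients, which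
  already lie in the span of the algebra, so only a boundary is ever altered and the homology class
  is safe.

  Freeness of the deck action comes from lifting paths and homotopies; for subsets of arbitrary
  topological spaces these lifts are obtained by bisecting rectangles.\<close>

lemma covering_space_evenly_covered:
  assumes "covering_space C p S" "x \<in> S"
  obtains T where "x \<in> T" "openin (top_of_set S) T"
    "\<And>z. \<lbrakk>z \<in> C; p z \<in> T\<rbrakk> \<Longrightarrow> \<exists>u q. z \<in> u \<and> openin (top_of_set C) u \<and> homeomorphism u T p q"
    "\<And>z w. \<lbrakk>z \<in> C; w \<in> C; p z \<in> T; p w = p z; w \<noteq> z\<rbrakk> \<Longrightarrow>
       \<exists>u v. z \<in> u \<and> w \<in> v \<and> openin (top_of_set C) u \<and> openin (top_of_set C) v \<and> disjnt u v"
proof -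
  obtain T V where T: "x \<in> T" "openin (top_of_set S) T" and V: "\<Union>V = C \<inter> p -` T"
    "\<And>u. u \<in> V \<Longrightarrow> openin (top_of_set C) u" "pairwise disjnt V"
    "\<And>u. u \<in> V \<Longrightarrow> \<exists>q. homeomorphism u T p q"
    using assms unfolding covering_space_def by metis
  show ?thesis
  proof (rule that[OF T])
    show "\<exists>u q. z \<in> u \<and> openin (top_of_set C) u \<and> homeomorphism u T p q" if "z \<in> C" "p z \<in> T" for z
      using that V by (metis IntI UnionE vimageI)
    show "\<exists>u v. z \<in> u \<and> w \<in> v \<and> openin (top_of_set C) u \<and> openin (top_of_set C) v \<and> disjnt u v"
      if zw: "z \<in> C" "w \<in> C" "p z \<in> T" "p w = p z" "w \<noteq> z" for z w
    proof -
      obtain u v where uv: "u \<in> V" "z \<in> u" "v \<in> V" "w \<in> v"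
        using zw V(1) by (metis IntI UnionE vimageI)
      \<comment> \<open>\<open>p\<close> is injective on a sheet, so two points of one fibre cannot
        share it.\<close>
      have "u \<noteq> v"
        using V(4)[OF uv(1)] uv zw by (metis homeomorphism_def)
      then show ?thesis
        using uv V by (meson pairwiseD)
    qed
  qed
qed

text \<open>The set where the two maps agree is open and closed in the connected set
  \<open>T\<close>: around a common value \<open>p\<close> is injective on a sheet, and two
  different values over one point lie in disjoint open sets.\<close>

lemma covering_space_unique_lift:
  fixes T :: "'c::topological_space set"
  assumes cov: "covering_space C p S" and T: "connected T"
    and g: "continuous_on T g" "g ` T \<subseteq> C" and h: "continuous_on T h" "h ` T \<subseteq> C"
    and eq: "\<And>t. t \<in> T \<Longrightarrow> p (g t) = p (h t)" and a: "a \<in> T" "g a = h a" and t: "t \<in> T"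
  shows "g t = h t"
proof -
  define E where "E = {t \<in> T. g t = h t}"
  have pre: "openin (top_of_set T) (T \<inter> f -` u)"
    if "openin (top_of_set C) u" "continuous_on T f" "f ` T \<subseteq> C" for f u
    using that by (simp add: continuous_openin_preimage image_subset_iff_funcset)
  have "openin (top_of_set T) E"
  proof (subst openin_subopen, intro ballI)
    fix s assume s: "s \<in> E"
    then have sC: "g s \<in> C" "s \<in> T" "g s = h s" using g by (auto simp: E_def)
    then have "p (g s) \<in> S" using cov by (auto simp: covering_space_def)
    then obtain W where W: "p (g s) \<in> W"
      "\<And>z. \<lbrakk>z \<in> C; p z \<in> W\<rbrakk> \<Longrightarrow> \<exists>u q. z \<in> u \<and> openin (top_of_set C) u \<and> homeomorphism u W p q"
      using covering_space_evenly_covered[OF cov] by metis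
    then obtain u q where u: "g s \<in> u" "openin (top_of_set C) u" "homeomorphism u W p q"
      using sC by metis
    let ?O = "(T \<inter> g -` u) \<inter> (T \<inter> h -` u)"
    have "openin (top_of_set T) ?O" using pre[OF u(2)] g h by blast
    moreover have "s \<in> ?O" using u sC by auto
    moreover have "?O \<subseteq> E"
      using u(3) eq unfolding E_def homeomorphism_def by (auto) metis
    ultimately show "\<exists>O'. openin (top_of_set T) O' \<and> s \<in> O' \<and> O' \<subseteq> E" by blast
  qed
  moreover have "openin (top_of_set T) (T - E)"
  proof (subst openin_subopen, intro ballI)
    fix s assume s: "s \<in> T - E"
    then have sC: "g s \<in> C" "h s \<in> C" "s \<in> T" "g s \<noteq> h s" "p (g s) = p (h s)"
      using g h eq by (auto simp: E_def)
    then have "p (g s) \<in> S" using cov by (auto simp: covering_space_def)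
    then obtain u v where uv: "g s \<in> u" "h s \<in> v" "openin (top_of_set C) u" "openin (top_of_set C) v" "disjnt u v"
      using covering_space_evenly_covered[OF cov] sC by metis
    let ?O = "(T \<inter> g -` u) \<inter> (T \<inter> h -` v)"
    have "openin (top_of_set T) ?O" using pre uv g h by blast
    moreover have "s \<in> ?O" using uv sC by auto
    moreover have "?O \<subseteq> T - E"
      using uv(5) unfolding E_def disjnt_iff by auto
    ultimately show "\<exists>O'. openin (top_of_set T) O' \<and> s \<in> O' \<and> O' \<subseteq> T - E" by blast
  qed
  ultimately have "E = {} \<or> E = T"
    using T by (metis (no_types, lifting) connected_clopen E_def closedin_def double_diff
        mem_Collect_eq subsetI topspace_euclidean_subtopology)
  then show ?thesis using a t by (auto simp: E_def)
qed

text \<open>Bolzano's bisection in two directions: the property survives gluing along vertical and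
  horizontal cuts and holds for all small rectangles containing a given point. This plays the part
  of a Lebesgue number.\<close>

lemma rectangle_bisection:
  fixes P :: "real \<Rightarrow> real \<Rightarrow> real \<Rightarrow> real \<Rightarrow> bool"
  assumes "a \<le> b" "c \<le> d"
    and fst: "\<And>a b e c d. \<lbrakk>P a b c d; P b e c d; a \<le> b; b \<le> e; c \<le> d\<rbrakk> \<Longrightarrow> P a e c d"
    and snd: "\<And>a b c d e. \<lbrakk>P a b c d; P a b d e; a \<le> b; c \<le> d; d \<le> e\<rbrakk> \<Longrightarrow> P a b c e"
    and loc: "\<And>x y. \<lbrakk>x \<in> {a..b}; y \<in> {c..d}\<rbrakk> \<Longrightarrow> \<exists>\<delta>>0. \<forall>a' b' c' d'.
        a \<le> a' \<and> a' \<le> x \<and> x \<le> b' \<and> b' \<le> b \<and> b' - a' < \<delta> \<and>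
        c \<le> c' \<and> c' \<le> y \<and> y \<le> d' \<and> d' \<le> d \<and> d' - c' < \<delta> \<longrightarrow> P a' b' c' d'"
  shows "P a b c d"
proof -
  \<comment> \<open>The trivial guard is an instance of the restriction to subintervals: the small
    intervals in \<open>Bolzano\<close> may stick out of the given one.\<close>
  have "a \<le> a \<and> b \<le> b \<longrightarrow> P a b c d"
  proof (rule Bolzano[of a b "\<lambda>s t. a \<le> s \<and> t \<le> b \<longrightarrow> P s t c d", OF \<open>a \<le> b\<close>])
    show "a \<le> s \<and> u \<le> b \<longrightarrow> P s u c d"
      if "a \<le> s \<and> t \<le> b \<longrightarrow> P s t c d" "a \<le> t \<and> u \<le> b \<longrightarrow> P t u c d" "s \<le> t" "t \<le> u" for s t u
      using that fst[of s t c d u] \<open>c \<le> d\<close> by auto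
    fix x assume x: "a \<le> x" "x \<le> b"
    \<comment> \<open>Inner bisection, for a width that suits the whole vertical strip through
      \<open>x\<close>. The width is quantified inside the predicate, so that glued pieces can use
      the smaller of their widths.\<close>
    have "c \<le> c \<and> d \<le> d \<longrightarrow> (\<exists>\<delta>>0. \<forall>s t. a \<le> s \<and> s \<le> x \<and> x \<le> t \<and> t \<le> b \<and> t - s < \<delta> \<longrightarrow> P s t c d)"
    proof (rule Bolzano[of c d "\<lambda>c' d'. c \<le> c' \<and> d' \<le> d \<longrightarrow>
          (\<exists>\<delta>>0. \<forall>s t. a \<le> s \<and> s \<le> x \<and> x \<le> t \<and> t \<le> b \<and> t - s < \<delta> \<longrightarrow> P s t c' d')", OF \<open>c \<le> d\<close>], goal_cases)
      case (1 u v w)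
      show ?case
      proof
        assume "c \<le> u \<and> w \<le> d"
        then obtain \<delta> \<epsilon> where "\<delta> > 0" "\<epsilon> > 0"
          and d: "\<forall>s t. a \<le> s \<and> s \<le> x \<and> x \<le> t \<and> t \<le> b \<and> t - s < \<delta> \<longrightarrow> P s t u v"
          and e: "\<forall>s t. a \<le> s \<and> s \<le> x \<and> x \<le> t \<and> t \<le> b \<and> t - s < \<epsilon> \<longrightarrow> P s t v w"
          using 1 by fastforce
        then show "\<exists>\<delta>>0. \<forall>s t. a \<le> s \<and> s \<le> x \<and> x \<le> t \<and> t \<le> b \<and> t - s < \<delta> \<longrightarrow> P s t u w"
          using 1(3,4) by (intro exI[of _ "min \<delta> \<epsilon>"]) (auto intro!: snd[of _ _ u v w])
      qed
    next
      case (2 y)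
      then obtain \<delta> where "\<delta> > 0" and d: "\<forall>a' b' c' d'.
        a \<le> a' \<and> a' \<le> x \<and> x \<le> b' \<and> b' \<le> b \<and> b' - a' < \<delta> \<and>
        c \<le> c' \<and> c' \<le> y \<and> y \<le> d' \<and> d' \<le> d \<and> d' - c' < \<delta> \<longrightarrow> P a' b' c' d'"
        using loc[of x y] x by auto
      then show ?case by (intro exI[of _ \<delta>]) auto
    qed
    then show "\<exists>\<delta>>0. \<forall>s t. s \<le> x \<and> x \<le> t \<and> t - s < \<delta> \<longrightarrow> a \<le> s \<and> t \<le> b \<longrightarrow> P s t c d"
      by auto
  qed
  then show ?thesis by simp
qed

text \<open>Bisection for the statement that a lift exists from every point over the lower left
  corner; the quantifier over starting points lets the second half continue where the first one
  ends.\<close>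

lemma covering_space_lift_rectangle:
  fixes H :: "real \<times> real \<Rightarrow> 'a::topological_space"
  assumes cov: "covering_space C p S"
    and H: "continuous_on ({a..b} \<times> {c..d}) H" "H ` ({a..b} \<times> {c..d}) \<subseteq> S"
    and ab: "a \<le> b" "c \<le> d" and z: "z \<in> C" "p z = H (a, c)"
  obtains G where "continuous_on ({a..b} \<times> {c..d}) G" "G ` ({a..b} \<times> {c..d}) \<subseteq> C"
    "G (a, c) = z" "\<And>s. s \<in> {a..b} \<times> {c..d} \<Longrightarrow> p (G s) = H s"
proof -
  define L where "L = (\<lambda>a b c d G z. continuous_on ({a..b} \<times> {c..d}) G \<and> G ` ({a..b} \<times> {c..d}) \<subseteq> C \<and>
    G (a, c) = z \<and> (\<forall>s \<in> {a..b} \<times> {c..d}. p (G s) = H s))"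
  have uniq: "G s = G' s" if "connected T" "continuous_on T G" "continuous_on T G'" "G ` T \<subseteq> C" "G' ` T \<subseteq> C"
      "\<forall>t\<in>T. p (G t) = H t" "\<forall>t\<in>T. p (G' t) = H t" "r \<in> T" "G r = G' r" "s \<in> T" for G G' r s and T :: "(real \<times> real) set"
    using covering_space_unique_lift[OF cov, of T G G' r s] that by simp
  \<comment> \<open>Two lifts fit together: the common edge is connected and they agree at
    \<open>r\<close>, so uniqueness makes them agree on all of it.\<close>
  have glue: "\<exists>G. L a b c d G z"
    if R: "{a..b} \<times> {c..d} = R1 \<union> R2" "closed R1" "closed R2" "(a,c) \<in> R1"
      and G1: "continuous_on R1 G1" "G1 ` R1 \<subseteq> C" "G1 (a,c) = z" "\<forall>s \<in> R1. p (G1 s) = H s"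
      and G2: "continuous_on R2 G2" "G2 ` R2 \<subseteq> C" "\<forall>s \<in> R2. p (G2 s) = H s"
      and con: "connected (R1 \<inter> R2)" "r \<in> R1 \<inter> R2" "G1 r = G2 r"
    for a b c d z R1 R2 r G1 G2
  proof -
    have eq: "G1 s = G2 s" if "s \<in> R1 \<inter> R2" for s
      by (rule uniq[of "R1 \<inter> R2" G1 G2 r s])
        (use con that G1 G2 in \<open>auto elim!: continuous_on_subset\<close>)
    let ?G = "\<lambda>s. if s \<in> R1 then G1 s else G2 s"
    have "continuous_on (R1 \<union> R2) ?G"
      by (rule continuous_on_cases[OF R(2,3) G1(1) G2(1)]) (use eq in auto)
    then have "L a b c d ?G z"
      unfolding L_def R(1) using R(4) G1 G2 by (auto split: if_splits)
    then show ?thesis by blast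
  qed
  have "\<forall>z\<in>C. p z = H (a, c) \<longrightarrow> (\<exists>G. L a b c d G z)"
  proof (rule rectangle_bisection[where P = "\<lambda>a b c d. \<forall>z\<in>C. p z = H (a, c) \<longrightarrow> (\<exists>G. L a b c d G z)", OF ab],
      goal_cases)
    case (1 a b e c d)
    show ?case
    proof (intro ballI impI)
      fix z assume z: "z \<in> C" "p z = H (a,c)"
      obtain G1 where G1: "L a b c d G1 z" using 1 z by blast
      then have "G1 (b,c) \<in> C" "p (G1 (b,c)) = H (b,c)" using 1(3-5) unfolding L_def by auto
      then obtain G2 where G2: "L b e c d G2 (G1 (b,c))" using 1 by blast
      show "\<exists>G. L a e c d G z"
      proof (rule glue[of a e c d "{a..b} \<times> {c..d}" "{b..e} \<times> {c..d}" G1 z G2 "(b,c)"])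
        have "({a..b} \<times> {c..d}) \<inter> ({b..e} \<times> {c..d}) = {b} \<times> {c..d}" using 1(3,4) by auto
        then show "connected (({a..b} \<times> {c..d}) \<inter> ({b..e} \<times> {c..d}))"
          by (simp add: connected_Times_eq)
      qed (use 1(3-5) G1 G2 in \<open>auto simp: L_def intro!: closed_Times\<close>)
    qed
  next
    case (2 a b c d e)
    show ?case
    proof (intro ballI impI)
      fix z assume z: "z \<in> C" "p z = H (a,c)"
      obtain G1 where G1: "L a b c d G1 z" using 2 z by blast
      then have "G1 (a,d) \<in> C" "p (G1 (a,d)) = H (a,d)" using 2(3-5) unfolding L_def by auto
      then obtain G2 where G2: "L a b d e G2 (G1 (a,d))" using 2 by blast
      show "\<exists>G. L a b c e G z"
      proof (rule glue[of a b c e "{a..b} \<times> {c..d}" "{a..b} \<times> {d..e}" G1 z G2 "(a,d)"])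
        have "({a..b} \<times> {c..d}) \<inter> ({a..b} \<times> {d..e}) = {a..b} \<times> {d}" using 2(4,5) by auto
        then show "connected (({a..b} \<times> {c..d}) \<inter> ({a..b} \<times> {d..e}))"
          by (simp add: connected_Times_eq)
      qed (use 2(3-5) G1 G2 in \<open>auto simp: L_def intro!: closed_Times\<close>)
    qed
  next
    case (3 x y)
    let ?R = "{a..b} \<times> {c..d}"
    \<comment> \<open>Near \<open>(x,y)\<close> the map \<open>H\<close> stays in an evenly covered
      set, where a local section composed with \<open>H\<close> is a lift.\<close>
    have "H (x,y) \<in> S" using H 3 by blast
    then obtain W where W: "H (x,y) \<in> W" "openin (top_of_set S) W"
      "\<And>z. \<lbrakk>z \<in> C; p z \<in> W\<rbrakk> \<Longrightarrow> \<exists>u q. z \<in> u \<and> openin (top_of_set C) u \<and> homeomorphism u W p q"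
      using covering_space_evenly_covered[OF cov] by metis
    have "openin (top_of_set ?R) (?R \<inter> H -` W)"
      using continuous_openin_preimage H W by (metis image_subset_iff_funcset)
    moreover have "(x,y) \<in> ?R \<inter> H -` W" using 3 W by auto
    ultimately obtain \<epsilon> where e: "\<epsilon> > 0" "ball (x,y) \<epsilon> \<inter> ?R \<subseteq> ?R \<inter> H -` W"
      unfolding openin_contains_ball by blast
    show ?case
    proof (intro exI[of _ "\<epsilon>/2"] conjI allI impI ballI)
      show "\<epsilon>/2 > 0" using e by simp
      fix a' b' c' d' z
      assume r: "a \<le> a' \<and> a' \<le> x \<and> x \<le> b' \<and> b' \<le> b \<and> b' - a' < \<epsilon>/2 \<and>
        c \<le> c' \<and> c' \<le> y \<and> y \<le> d' \<and> d' \<le> d \<and> d' - c' < \<epsilon>/2" and z: "z \<in> C" "p z = H (a',c')"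
      have sub: "{a'..b'} \<times> {c'..d'} \<subseteq> ?R \<inter> H -` W"
      proof (rule subset_trans[OF _ e(2)], clarify, intro IntI)
        fix s t assume st: "s \<in> {a'..b'}" "t \<in> {c'..d'}"
        \<comment> \<open>The distance is at most the sum of the coordinate distances, whence
          \<open>\<epsilon>/2\<close> as the bound for both sides of the rectangle.\<close>
        have "dist (x,y) (s,t) \<le> dist x s + dist y t"
          using sqrt_sum_squares_le_sum by (simp add: dist_prod_def)
        also have "\<dots> < \<epsilon>/2 + \<epsilon>/2"
          by (rule add_strict_mono) (use r st in \<open>auto simp: dist_real_def abs_if\<close>)
        finally show "(s,t) \<in> ball (x,y) \<epsilon>" by simp
      qed (use r in auto)
      have HW: "H s \<in> W" if "s \<in> {a'..b'} \<times> {c'..d'}" for s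
        using sub that by blast
      have "p z \<in> W" using HW[of "(a',c')"] r z by auto
      then obtain u q where u: "z \<in> u" "openin (top_of_set C) u" "homeomorphism u W p q"
        using W z by blast
      have "L a' b' c' d' (q \<circ> H) z"
        unfolding L_def
      proof (intro conjI ballI)
        have "continuous_on W q" using u by (simp add: homeomorphism_def)
        then show "continuous_on ({a'..b'} \<times> {c'..d'}) (q \<circ> H)"
          using sub by (intro continuous_on_compose continuous_on_subset[OF H(1)])
            (auto elim!: continuous_on_subset)
        have "q ` W = u" "u \<subseteq> C" using u by (auto simp: homeomorphism_def dest: openin_imp_subset)
        then show "(q \<circ> H) ` ({a'..b'} \<times> {c'..d'}) \<subseteq> C" using HW by fastforce
        show "(q \<circ> H) (a',c') = z" using u z by (metis comp_apply homeomorphism_apply1)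
        show "p ((q \<circ> H) s) = H s" if "s \<in> {a'..b'} \<times> {c'..d'}" for s
          using u(3) HW[OF that] by (metis comp_apply homeomorphism_apply2)
      qed
      then show "\<exists>G. L a' b' c' d' G z" by blast
    qed
  qed
  then obtain G where "L a b c d G z" using z by blast
  then show ?thesis using that[of G] by (auto simp: L_def)
qed

section \<open>Path lifting and monodromy\<close>

definition path_lift :: "'b::topological_space set \<Rightarrow> ('b \<Rightarrow> 'a) \<Rightarrow> (real \<Rightarrow> 'a) \<Rightarrow> (real \<Rightarrow> 'b) \<Rightarrow> bool" where
  "path_lift C p b c \<longleftrightarrow> path c \<and> path_image c \<subseteq> C \<and> (\<forall>t\<in>{0..1}. p (c t) = b t)"

text \<open>A path is a square that is constant in its second coordinate; its lift is read off on
  the edge where that coordinate is 0.\<close>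

lemma path_lift_exists:
  fixes b :: "real \<Rightarrow> 'a::topological_space"
  assumes cov: "covering_space C p S" and b: "path b" "path_image b \<subseteq> S" and z: "z \<in> C" "p z = b 0"
  obtains c where "path_lift C p b c" "c 0 = z"
proof -
  have "continuous_on ({0..1} \<times> {0..1::real}) (b \<circ> fst)" "(b \<circ> fst) ` ({0..1} \<times> {0..1::real}) \<subseteq> S"
    using b by (auto simp: path_def path_image_def o_def intro!: continuous_on_compose2[of "{0..1}" b] continuous_intros)
  then obtain G where G: "continuous_on ({0..1} \<times> {0..1::real}) G" "G ` ({0..1} \<times> {0..1}) \<subseteq> C"
    "G (0, 0) = z" "\<And>s. s \<in> {0..1} \<times> {0..1} \<Longrightarrow> p (G s) = (b \<circ> fst) s"
    using covering_space_lift_rectangle[OF cov, of 0 1 0 1 "b \<circ> fst" z] z by auto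
  show ?thesis
  proof (rule that[of "\<lambda>t. G (t, 0)"])
    have "continuous_on {0..1} (G \<circ> (\<lambda>t. (t, 0)))"
      by (intro continuous_on_compose continuous_intros continuous_on_subset[OF G(1)]) auto
    then show "path_lift C p b (\<lambda>t. G (t, 0))"
      using G unfolding path_lift_def path_def path_image_def by (auto simp: o_def)
  qed (use G in auto)
qed

lemma path_lift_unique:
  fixes b :: "real \<Rightarrow> 'a::topological_space"
  assumes "covering_space C p S" "path_lift C p b c" "path_lift C p b c'" "c 0 = c' 0" "t \<in> {0..1}"
  shows "c t = c' t"
  by (rule covering_space_unique_lift[OF assms(1), of "{0..1}" c c' 0])
    (use assms in \<open>auto simp: path_lift_def path_def path_image_def\<close>)

text \<open>Lift the homotopy to a square. Along the two edges over the fixed endpoints the homotopy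
  is constant, hence so is the lift; by uniqueness the other two edges are \<open>c\<close> and
  \<open>c'\<close>.\<close>

lemma path_lift_monodromy:
  fixes b :: "real \<Rightarrow> 'a::topological_space"
  assumes cov: "covering_space C p S" and hom: "homotopic_paths S b b'"
    and c: "path_lift C p b c" "path_lift C p b' c'" "c 0 = c' 0"
  shows "c 1 = c' 1"
proof -
  obtain H where H: "continuous_on ({0..1} \<times> {0..1::real}) H" "H ` ({0..1} \<times> {0..1::real}) \<subseteq> S"
    "\<And>x. x \<in> {0..1} \<Longrightarrow> H (0::real, x) = b x" "\<And>x. x \<in> {0..1} \<Longrightarrow> H (1, x) = b' x"
    "\<And>t. t \<in> {0..1} \<Longrightarrow> H (t, 0) = b 0 \<and> H (t, 1) = b 1"
    using hom unfolding homotopic_paths pathstart_def pathfinish_def comp_def image_subset_iff_funcset by metis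
  have c0: "c 0 \<in> C" "p (c 0) = H (0,0)"
    using c(1) H(3)[of 0] by (auto simp: path_lift_def path_image_def)
  obtain G where G: "continuous_on ({0..1} \<times> {0..1::real}) G" "G ` ({0..1} \<times> {0..1}) \<subseteq> C"
    "G (0, 0) = c 0" "\<And>s. s \<in> {0..1} \<times> {0..1} \<Longrightarrow> p (G s) = H s"
    using covering_space_lift_rectangle[OF cov H(1,2), of "c 0"] c0 by auto
  have side: "path_lift C p d (\<lambda>t. G (f t))"
    if "continuous_on {0..1} f" "f ` {0..1} \<subseteq> {0..1} \<times> {0..1}" "\<And>t. t \<in> {0..1} \<Longrightarrow> H (f t) = d t"
    for f :: "real \<Rightarrow> real \<times> real" and d
  proof -
    have "(\<lambda>t. G (f t)) ` {0..1} \<subseteq> C" using that(2) G(2) by blast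
    moreover have "p (G (f t)) = d t" if "t \<in> {0..1}" for t
      using G(4)[OF subsetD[OF \<open>f ` _ \<subseteq> _\<close> imageI[OF that]]] \<open>\<And>t. t \<in> {0..1} \<Longrightarrow> H (f t) = d t\<close>[OF that] by simp
    ultimately show ?thesis
      using continuous_on_compose2[OF G(1) that(1,2)] by (simp add: path_lift_def path_def path_image_def)
  qed
  have const: "path_lift C p (\<lambda>t. x) (\<lambda>t. z)" if "z \<in> C" "p z = x" for z x
    using that by (auto simp: path_lift_def path_def path_image_def)
  have "path_lift C p b (\<lambda>t. G (0, t))" "path_lift C p b' (\<lambda>t. G (1, t))"
    by (rule side; use H(3,4) in \<open>force intro!: continuous_intros\<close>)+
  moreover have "path_lift C p (\<lambda>t. b 0) (\<lambda>t. G (t, 0))" "path_lift C p (\<lambda>t. b 1) (\<lambda>t. G (t, 1))"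
    by (rule side; use H(5) in \<open>force intro!: continuous_intros\<close>)+
  moreover have G01: "G (0,1) \<in> C" "p (G (0,1)) = b 1"
    using G(2) G(4)[of "(0,1)"] H(3)[of 1] by auto
  ultimately have 1: "c 1 = G (0,1)" and 2: "G (1,0) = c 0" and 3: "G (1,1) = G (0,1)"
    and "G (1,0) = c' 0 \<longrightarrow> c' 1 = G (1,1)"
    using path_lift_unique[OF cov c(1), of "\<lambda>t. G (0, t)" 1]
      path_lift_unique[OF cov, of "\<lambda>t. b 0" "\<lambda>t. G (t, 0)" "\<lambda>t. c 0" 1]
      path_lift_unique[OF cov, of "\<lambda>t. b 1" "\<lambda>t. G (t, 1)" "\<lambda>t. G (0,1)" 1]
      path_lift_unique[OF cov c(2), of "\<lambda>t. G (1, t)" 1] const[of "c 0" "b 0"] const[of "G (0,1)" "b 1"]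
      c0 H(3)[of 0] G(3)
    by (auto)
  then show ?thesis using c(3) by simp
qed

text \<open>At the constant end of the homotopy the lifted loop is constant. Its two ends are joined
  to those of \<open>c\<close> by lifts of one path, the track of the base point; run backwards,
  these start together and hence end together.\<close>

lemma path_lift_closed:
  fixes b :: "real \<Rightarrow> 'a::topological_space"
  assumes cov: "covering_space C p S" and hom: "homotopic_loops S b (\<lambda>_. x)"
    and c: "path_lift C p b c"
  shows "c 1 = c 0"
proof -
  obtain H where H: "continuous_on ({0..1} \<times> {0..1::real}) H" "H ` ({0..1} \<times> {0..1::real}) \<subseteq> S"
    "\<And>x. x \<in> {0..1} \<Longrightarrow> H (0::real, x) = b x" "\<And>y. y \<in> {0..1} \<Longrightarrow> H (1, y) = x"
    "\<And>t. t \<in> {0..1} \<Longrightarrow> H (t, 1) = H (t, 0)"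
    using hom unfolding homotopic_loops pathstart_def pathfinish_def comp_def image_subset_iff_funcset by metis
  have c0: "c 0 \<in> C" "p (c 0) = H (0,0)"
    using c H by (auto simp: path_lift_def path_image_def)
  obtain G where G: "continuous_on ({0..1} \<times> {0..1::real}) G" "G ` ({0..1} \<times> {0..1}) \<subseteq> C"
    "G (0, 0) = c 0" "\<And>s. s \<in> {0..1} \<times> {0..1} \<Longrightarrow> p (G s) = H s"
    using covering_space_lift_rectangle[OF cov H(1,2), of "c 0"] c0 by auto
  have side: "path_lift C p d (\<lambda>t. G (f t))"
    if "continuous_on {0..1} f" "f ` {0..1} \<subseteq> {0..1} \<times> {0..1}" "\<And>t. t \<in> {0..1} \<Longrightarrow> H (f t) = d t"
    for f :: "real \<Rightarrow> real \<times> real" and d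
  proof -
    have "(\<lambda>t. G (f t)) ` {0..1} \<subseteq> C" using that(2) G(2) by blast
    moreover have "p (G (f t)) = d t" if "t \<in> {0..1}" for t
      using G(4)[OF subsetD[OF \<open>f ` _ \<subseteq> _\<close> imageI[OF that]]] \<open>\<And>t. t \<in> {0..1} \<Longrightarrow> H (f t) = d t\<close>[OF that] by simp
    ultimately show ?thesis
      using continuous_on_compose2[OF G(1) that(1,2)] by (simp add: path_lift_def path_def path_image_def)
  qed
  have "path_lift C p b (\<lambda>t. G (0, t))" "path_lift C p (\<lambda>t. x) (\<lambda>t. G (1, t))"
    by (rule side; use H(3,4) in \<open>force intro!: continuous_intros\<close>)+
  moreover have G10: "G (1,0) \<in> C" "p (G (1,0)) = x"
    using G(2) G(4)[of "(1,0)"] H(4)[of 0] by auto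
  then have "path_lift C p (\<lambda>t. x) (\<lambda>t. G (1, 0))"
    by (auto simp: path_lift_def path_def path_image_def)
  ultimately have 1: "c 1 = G (0,1)" "G (1,1) = G (1,0)"
    using path_lift_unique[OF cov c, of "\<lambda>t. G (0, t)" 1] G(3)
      path_lift_unique[OF cov, of "\<lambda>t. x" "\<lambda>t. G (1, t)" "\<lambda>t. G (1,0)" 1]
    by auto
  have "path_lift C p (\<lambda>t. H (1 - t, 0)) (\<lambda>t. G (1 - t, 0))" "path_lift C p (\<lambda>t. H (1 - t, 0)) (\<lambda>t. G (1 - t, 1))"
    by (rule side; use H(5) in \<open>force intro!: continuous_intros\<close>)+
  then have "G (0,0) = G (0,1)"
    using path_lift_unique[OF cov, of "\<lambda>t. H (1 - t, 0)" "\<lambda>t. G (1 - t, 0)" "\<lambda>t. G (1 - t, 1)" 1] 1 by auto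
  then show ?thesis using 1 G by simp
qed

text \<open>A free contraction becomes one with fixed ends: in the square, the edge that carries
  \<open>c\<close> is deformed into the other three edges, along which the homotopy follows the
  track of the base point, rests at \<open>a\<close> and returns on the same track.\<close>

lemma homotopic_loops_const_imp_homotopic_paths:
  fixes c :: "real \<Rightarrow> 'a::topological_space"
  assumes "homotopic_loops S c (\<lambda>_. a)"
  shows "homotopic_paths S c (\<lambda>_. c 0)"
proof -
  obtain H where H: "continuous_on ({0..1} \<times> {0..1::real}) H" "H ` ({0..1} \<times> {0..1::real}) \<subseteq> S"
    "\<And>x. x \<in> {0..1} \<Longrightarrow> H (0::real, x) = c x" "\<And>y. y \<in> {0..1} \<Longrightarrow> H (1, y) = a"
    "\<And>t. t \<in> {0..1} \<Longrightarrow> H (t, 1) = H (t, 0)"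
    using assms unfolding homotopic_loops pathstart_def pathfinish_def comp_def image_subset_iff_funcset by metis
  \<comment> \<open>The path \<open>(m x, k x)\<close> spends a third of the time on each of three
    edges: out at \<open>k = 0\<close>, up at \<open>m = 1\<close>, back at
    \<open>k = 1\<close>.\<close>
  define m :: "real \<Rightarrow> real" where "m = (\<lambda>x. min 1 (3 * min x (1 - x)))"
  define k :: "real \<Rightarrow> real" where "k = (\<lambda>x. max 0 (min 1 (3 * x - 1)))"
  have m: "m x \<in> {0..1}" "k x \<in> {0..1}" if "x \<in> {0..1}" for x
    using that by (auto simp: m_def k_def)
  have mk: "m x = 1 \<or> k x = 0 \<or> k x = 1" if "x \<in> {0..1}" for x
    using that by (auto simp: m_def k_def min_def max_def split: if_splits)
  have cm: "continuous_on {0..1} m" "continuous_on {0..1} k"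
    unfolding m_def k_def by (intro continuous_intros)+
  have "homotopic_paths ({0..1} \<times> {0..1}) (\<lambda>x. (0, x)) (\<lambda>x. (m x, k x))"
  proof (rule homotopic_paths_linear)
    show "closed_segment (0, t) (m t, k t) \<subseteq> {0..1} \<times> {0..1}" if "t \<in> {0..1}" for t
      by (rule closed_segment_subset) (use m[OF that] that in \<open>auto intro!: convex_Times\<close>)
  qed (use cm in \<open>auto simp: path_def pathstart_def pathfinish_def m_def k_def intro!: continuous_intros\<close>)
  then have "homotopic_paths S (H \<circ> (\<lambda>x. (0, x))) (H \<circ> (\<lambda>x. (m x, k x)))"
    using H(1) by (rule homotopic_paths_continuous_image) (use H(2) in auto)
  then have 1: "homotopic_paths S c (H \<circ> (\<lambda>x. (m x, k x)))"
    using H(3) by (metis (no_types, lifting) comp_apply homotopic_paths_eq homotopic_paths_imp_path homotopic_paths_imp_subset homotopic_paths_sym homotopic_paths_trans)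
  \<comment> \<open>The edges \<open>k = 0\<close> and \<open>k = 1\<close> carry the same values
    and the edge \<open>m = 1\<close> is constant, so \<open>k\<close> may be replaced by 0. What is
    left is the track along \<open>m\<close>, which contracts because \<open>m\<close> starts and
    ends at 0.\<close>
  have Hm: "H (m x, 0) = H (m x, k x)" if "x \<in> {0..1}" for x
    using mk[OF that] H(4)[of 0] H(4)[of "k x"] H(5)[of "m x"] m[OF that] by auto
  have "homotopic_paths {0..1} m (\<lambda>x. 0)"
  proof (rule homotopic_paths_linear)
    show "closed_segment (m t) 0 \<subseteq> {0..1}" if "t \<in> {0..1}" for t
      by (rule closed_segment_subset) (use m[OF that] in auto)
  qed (use cm in \<open>auto simp: path_def pathstart_def pathfinish_def m_def\<close>)
  moreover have "continuous_on {0..1} (\<lambda>s. H (s, 0))"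
    by (rule continuous_on_compose2[OF H(1)]) (auto intro!: continuous_intros)
  ultimately have "homotopic_paths S ((\<lambda>s. H (s, 0)) \<circ> m) ((\<lambda>s. H (s, 0)) \<circ> (\<lambda>x. 0))"
    by (rule homotopic_paths_continuous_image) (use H(2) in auto)
  moreover have "homotopic_paths S (H \<circ> (\<lambda>x. (m x, k x))) ((\<lambda>s. H (s, 0)) \<circ> m)"
    using 1 Hm by (intro homotopic_paths_eq) (auto dest: homotopic_paths_imp_path homotopic_paths_imp_subset)
  ultimately show ?thesis
    using 1 H(3)[of 0] by (auto simp: o_def intro: homotopic_paths_trans)
qed

section \<open>The lifting criterion for the covering itself\<close>

lemma simply_connected_imp_null_homotopic:
  fixes S :: "'a::topological_space set"
  assumes "simply_connected S" "path c" "path_image c \<subseteq> S" "c 1 = c 0"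
  shows "homotopic_loops S c (\<lambda>_. c 0)"
proof -
  have "c 0 \<in> S" using assms by (auto simp: path_image_def)
  then show ?thesis
    using assms(1)[unfolded simply_connected_def, rule_format, of c "\<lambda>_. c 0"] assms(2-)
    by (auto simp: path_def path_image_def pathstart_def pathfinish_def)
qed

text \<open>In this notion of simple connectedness any two loops are freely homotopic; between two
  constant loops the homotopy traces a path.\<close>

lemma simply_connected_imp_path_connected_space:
  fixes S :: "'a::topological_space set"
  assumes "simply_connected S"
  shows "path_connected S"
proof -
  have "path_component S a b" if "a \<in> S" "b \<in> S" for a b
  proof -
    have "homotopic_loops S (\<lambda>_. a) (\<lambda>_. b)"
      using assms(1)[unfolded simply_connected_def, rule_format, of "\<lambda>_. a" "\<lambda>_. b"] that
      by (auto simp: path_def path_image_def pathstart_def pathfinish_def)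
    then show ?thesis
      using homotopic_loops_imp_path_component_value[of S "\<lambda>_. a" "\<lambda>_. b" 0] by simp
  qed
  then show ?thesis by (simp add: path_connected_component)
qed

text \<open>\<open>h z\<close> is the end of the lift, starting at \<open>y'\<close>, of the
  projection of a path from \<open>y\<close> to \<open>z\<close>. Simple connectedness makes the end
  independent of the path, and path-connected small open sets in the base make \<open>h\<close>
  continuous.\<close>

lemma deck_lift_exists:
  fixes p :: "'b::topological_space \<Rightarrow> 'a::topological_space"
  assumes cov: "covering_space C p S" and sc: "simply_connected C"
    and lpc: "\<And>x T. \<lbrakk>x \<in> T; openin (top_of_set S) T\<rbrakk> \<Longrightarrow>
       \<exists>V. x \<in> V \<and> openin (top_of_set S) V \<and> V \<subseteq> T \<and> path_connected V"
    and y: "y \<in> C" "y' \<in> C" "p y = p y'"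
  obtains h where "continuous_on C h" "h ` C \<subseteq> C" "\<And>z. z \<in> C \<Longrightarrow> p (h z) = p z" "h y = y'"
proof -
  \<comment> \<open>The graph of \<open>h\<close>, as a relation until the choice of the path is
    known to be immaterial.\<close>
  define E where "E = (\<lambda>z z'. \<exists>c c'. path c \<and> path_image c \<subseteq> C \<and> c 0 = y \<and> c 1 = z \<and>
    path_lift C p (p \<circ> c) c' \<and> c' 0 = y' \<and> c' 1 = z')"
  have pS: "path (p \<circ> c)" "path_image (p \<circ> c) \<subseteq> S" if "path c" "path_image c \<subseteq> C" for c
    using path_continuous_image[OF that(1) continuous_on_subset[OF covering_space_imp_continuous[OF cov] that(2)]]
      that(2) covering_space_imp_surjective[OF cov] by (auto simp: path_image_compose)
  have ex: "\<exists>z'. E z z'" if z: "z \<in> C" for z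
  proof -
    obtain c where c: "path c" "path_image c \<subseteq> C" "c 0 = y" "c 1 = z"
      using simply_connected_imp_path_connected_space[OF sc] z y(1)
      unfolding path_connected_def pathstart_def pathfinish_def by metis
    then obtain c' where "path_lift C p (p \<circ> c) c'" "c' 0 = y'"
      using path_lift_exists[OF cov pS, of c y'] y by auto
    then show ?thesis using c unfolding E_def by blast
  qed
  have un: "z1 = z2" if "E z z1" "E z z2" for z z1 z2
  proof -
    obtain c1 d1 where 1: "path c1" "path_image c1 \<subseteq> C" "c1 0 = y" "c1 1 = z"
      "path_lift C p (p \<circ> c1) d1" "d1 0 = y'" "d1 1 = z1"
      using \<open>E z z1\<close> unfolding E_def by blast
    obtain c2 d2 where 2: "path c2" "path_image c2 \<subseteq> C" "c2 0 = y" "c2 1 = z"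
      "path_lift C p (p \<circ> c2) d2" "d2 0 = y'" "d2 1 = z2"
      using \<open>E z z2\<close> unfolding E_def by blast
    \<comment> \<open>Out along \<open>c1\<close> and back along \<open>c2\<close>: contractible
      upstairs, so every lift of its projection is closed.\<close>
    define e where "e = c1 +++ reversepath c2"
    have ends: "pathfinish c1 = pathfinish c2"
      using 1 2 by (simp add: pathfinish_def)
    have "path e" "path_image e \<subseteq> C"
      using 1 2 ends by (auto simp: e_def path_image_join path_join_eq)
    moreover have "e 0 = y" "e 1 = e 0"
      using 1 2 by (auto simp: e_def reversepath_def joinpaths_def)
    ultimately have e: "path e" "path_image e \<subseteq> C" "e 0 = y" "e 1 = e 0" by auto
    have el: "e (t/2) = c1 t" "e (1 - t/2) = c2 t" if "t \<in> {0..1}" for t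
      using that 1 2 by (auto simp: e_def joinpaths_def reversepath_def)
    have "homotopic_loops C e (\<lambda>_. e 0)"
      by (rule simply_connected_imp_null_homotopic[OF sc e(1,2,4)])
    then have "homotopic_loops S (p \<circ> e) (p \<circ> (\<lambda>_. e 0))"
      by (rule homotopic_loops_continuous_image) (use cov in \<open>auto simp: covering_space_def\<close>)
    then have nul: "homotopic_loops S (p \<circ> e) (\<lambda>_. p (e 0))" by (simp add: o_def)
    obtain e' where e': "path_lift C p (p \<circ> e) e'" "e' 0 = y'"
      using path_lift_exists[OF cov pS[OF e(1,2)], of y'] y e by auto
    have e'1: "e' 1 = y'" using path_lift_closed[OF cov nul e'(1)] e' by simp
    have sub: "path_lift C p (p \<circ> d) (e' \<circ> f)"
      if "continuous_on {0..1} f" "f ` {0..1} \<subseteq> {0..1}" "\<And>t. t \<in> {0..1} \<Longrightarrow> e (f t) = d t" for f d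
    proof -
      have "continuous_on {0..1} (e' \<circ> f)"
        using e'(1) continuous_on_compose[OF that(1)] continuous_on_subset[OF _ that(2)]
        by (auto simp: path_lift_def path_def)
      moreover have "p ((e' \<circ> f) t) = (p \<circ> d) t" if t: "t \<in> {0..1}" for t
        using e'(1) \<open>f ` _ \<subseteq> _\<close> t \<open>\<And>t. t \<in> {0..1} \<Longrightarrow> e (f t) = d t\<close>[OF t]
        unfolding path_lift_def by (metis comp_apply image_subset_iff)
      moreover have "(e' \<circ> f) ` {0..1} \<subseteq> C"
        using e'(1) that(2) unfolding path_lift_def path_image_def by auto
      ultimately show ?thesis
        unfolding path_lift_def path_def path_image_def by blast
    qed
    \<comment> \<open>The two halves of \<open>e'\<close>, the second one read backwards, both start
      at \<open>y'\<close> and both end at the value of \<open>e'\<close> at 1/2. As lifts of the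
      projected paths they coincide with \<open>d1\<close> and \<open>d2\<close>.\<close>
    have "path_lift C p (p \<circ> c1) (e' \<circ> (\<lambda>t. t/2))" "path_lift C p (p \<circ> c2) (e' \<circ> (\<lambda>t. 1 - t/2))"
      by (rule sub; use el in \<open>force intro!: continuous_intros\<close>)+
    then have "(e' \<circ> (\<lambda>t. t/2)) 1 = d1 1" "(e' \<circ> (\<lambda>t. 1 - t/2)) 1 = d2 1"
      using path_lift_unique[OF cov] 1 2 e'(2) e'1
      by (metis (no_types, lifting) atLeastAtMost_iff comp_apply diff_zero div_0 order_refl zero_le_one)+
    then show ?thesis using 1 2 by simp
  qed
  define h where "h = (\<lambda>z. THE z'. E z z')"
  have hE: "h z = z'" if "E z z'" for z z'
    unfolding h_def using that un by blast
  have Eh: "E z (h z)" if "z \<in> C" for z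
    using ex[OF that] hE by metis
  have hC: "h z \<in> C" "p (h z) = p z" if z: "z \<in> C" for z
  proof -
    obtain c c' where c: "path c" "path_image c \<subseteq> C" "c 0 = y" "c 1 = z"
      "path_lift C p (p \<circ> c) c'" "c' 0 = y'" "c' 1 = h z"
      using Eh[OF z] unfolding E_def by blast
    show "h z \<in> C" using c(5,7) unfolding path_lift_def path_image_def
      by (metis atLeastAtMost_iff image_subset_iff order_refl zero_le_one)
    have "p (c' 1) = (p \<circ> c) 1" using c(5) unfolding path_lift_def by (metis atLeastAtMost_iff order_refl zero_le_one)
    then show "p (h z) = p z" using c by simp
  qed
  \<comment> \<open>Near \<open>z\<close> the map is \<open>q' \<circ> p\<close>, where
    \<open>q'\<close> is the section of \<open>p\<close> whose sheet contains
    \<open>h z\<close>.\<close>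
  have loc: "\<exists>U. openin (top_of_set C) U \<and> z \<in> U \<and> continuous_on U h" if z: "z \<in> C" for z
  proof -
    have "p z \<in> S" using z cov by (auto simp: covering_space_def)
    then obtain T where T: "p z \<in> T" "openin (top_of_set S) T"
      "\<And>z. \<lbrakk>z \<in> C; p z \<in> T\<rbrakk> \<Longrightarrow> \<exists>u q. z \<in> u \<and> openin (top_of_set C) u \<and> homeomorphism u T p q"
      using covering_space_evenly_covered[OF cov] by metis
    obtain u q where u: "z \<in> u" "openin (top_of_set C) u" "homeomorphism u T p q"
      using T z by blast
    obtain u' q' where u': "h z \<in> u'" "openin (top_of_set C) u'" "homeomorphism u' T p q'"
      using T z hC by metis
    obtain V where V: "p z \<in> V" "openin (top_of_set S) V" "V \<subseteq> T" "path_connected V"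
      using lpc[OF T(1,2)] by blast
    let ?U = "u \<inter> (C \<inter> p -` V)"
    have "openin (top_of_set C) (C \<inter> p -` V)"
      by (rule continuous_openin_preimage[OF _ _ V(2)])
        (use cov in \<open>auto simp: covering_space_def\<close>)
    then have "openin (top_of_set C) ?U" using u by blast
    moreover have "z \<in> ?U" using z u V by auto
    moreover have "continuous_on ?U h"
    proof (rule continuous_on_eq)
      have "continuous_on V q'" using u' V by (auto simp: homeomorphism_def intro: continuous_on_subset)
      then show "continuous_on ?U (q' \<circ> p)"
        using cov by (intro continuous_on_compose) (auto simp: covering_space_def intro: continuous_on_subset)
      fix w assume w: "w \<in> ?U"
      obtain r where r: "path r" "path_image r \<subseteq> V" "r 0 = p z" "r 1 = p w"
        using V(1,4) w unfolding path_connected_def pathstart_def pathfinish_def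
        by (metis IntD2 vimageD)
      have rT: "r t \<in> T" if "t \<in> {0..1}" for t using r(2) V(3) that unfolding path_image_def by blast
      have qr: "path_lift C p r (q1 \<circ> r)" if "homeomorphism u1 T p q1" "openin (top_of_set C) u1" for u1 q1
      proof -
        have "q1 ` T \<subseteq> C" "continuous_on T q1"
          using that openin_imp_subset[OF that(2)] by (auto simp: homeomorphism_def)
        moreover have "path_image r \<subseteq> T" using r V by blast
        ultimately show ?thesis
          using path_continuous_image[OF r(1) continuous_on_subset] that(1) rT unfolding path_lift_def
          by (fastforce simp: path_image_compose homeomorphism_apply2)
      qed
      obtain c c' where c: "path c" "path_image c \<subseteq> C" "c 0 = y" "c 1 = z"
        "path_lift C p (p \<circ> c) c'" "c' 0 = y'" "c' 1 = h z"
        using Eh[OF z] unfolding E_def by blast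
      have q0: "q (p z) = z" "q' (p z) = h z" "q (p w) = w"
        using u u' w z hC(2)[OF z] unfolding homeomorphism_def by auto
      \<comment> \<open>To reach \<open>w\<close>, go to \<open>z\<close> along \<open>c\<close> and
        then along the section \<open>q\<close> over a path \<open>r\<close> in the base. The
        projection of this path lifts to \<open>c'\<close> followed by the section \<open>q'\<close>
        over \<open>r\<close>.\<close>
      have "E w (q' (p w))"
        unfolding E_def
      proof (intro exI conjI)
        show "path (c +++ (q \<circ> r))" "path_image (c +++ (q \<circ> r)) \<subseteq> C"
          using c qr[OF u(3,2)] q0 r(3)
          by (auto simp: path_lift_def path_image_join path_join_eq pathstart_def pathfinish_def)
        show "path_lift C p (p \<circ> (c +++ (q \<circ> r))) (c' +++ (q' \<circ> r))"
          unfolding path_lift_def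
        proof (intro conjI ballI)
          show "path (c' +++ (q' \<circ> r))" "path_image (c' +++ (q' \<circ> r)) \<subseteq> C"
            using c qr[OF u'(3,2)] q0 r(3)
            by (auto simp: path_lift_def path_image_join path_join_eq pathstart_def pathfinish_def)
          fix t :: real assume t: "t \<in> {0..1}"
          have "p (q' (r s)) = p (q (r s))" if "s \<in> {0..1}" for s
            using rT[OF that] u u' by (metis homeomorphism_apply2)
          then show "p ((c' +++ (q' \<circ> r)) t) = (p \<circ> (c +++ (q \<circ> r))) t"
            using t c(5) by (auto simp: joinpaths_def path_lift_def)
        qed
      qed (use c r q0 in \<open>auto simp: joinpaths_def\<close>)
      then show "(q' \<circ> p) w = h w" using hE by simp
    qed
    ultimately show ?thesis by blast
  qed
  show ?thesis
  proof (rule that)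
    show "continuous_on C h"
      unfolding continuous_on_def
    proof
      fix z assume "z \<in> C"
      then obtain U where U: "openin (top_of_set C) U" "z \<in> U" "continuous_on U h"
        using loc by blast
      then obtain O' where O': "open O'" "U = C \<inter> O'" by (auto simp: openin_open)
      have "at z within C = at z within U"
        by (rule at_within_nhd[of z O']) (use O' U in auto)
      then show "(h \<longlongrightarrow> h z) (at z within C)"
        using U(2,3) unfolding continuous_on_def by simp
    qed
    show "h y = y'"
    proof (rule hE)
      show "E y y'"
        unfolding E_def by (rule exI[of _ "\<lambda>_. y"], rule exI[of _ "\<lambda>_. y'"])
          (use y in \<open>auto simp: path_lift_def path_def path_image_def\<close>)
    qed
  qed (use hC in auto)
qed

section \<open>The deck action on singular simplices\<close>

text \<open>Lift in both directions between \<open>y\<close> and \<open>y'\<close>. Either composite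
  is a lift of \<open>p\<close> with a fixed point, as is the identity, so the two lifts are inverse
  to each other.\<close>

lemma covering_deck_transformation_exists:
  fixes p :: "'b::topological_space \<Rightarrow> 'a::topological_space"
  assumes cov: "covering_space C p S" and sc: "simply_connected C"
    and lpc: "\<And>x T. \<lbrakk>x \<in> T; openin (top_of_set S) T\<rbrakk> \<Longrightarrow>
       \<exists>V. x \<in> V \<and> openin (top_of_set S) V \<and> V \<subseteq> T \<and> path_connected V"
    and y: "y \<in> C" "y' \<in> C" "p y = p y'"
  obtains h where "h \<in> deck_transformations C p" "h y = y'"
proof -
  have con: "connected C"
    using simply_connected_imp_path_connected_space[OF sc] by (rule path_connected_imp_connected)
  obtain h where h: "continuous_on C h" "h ` C \<subseteq> C" "\<And>z. z \<in> C \<Longrightarrow> p (h z) = p z" "h y = y'"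
    using deck_lift_exists[OF cov sc lpc y] by blast
  obtain k where k: "continuous_on C k" "k ` C \<subseteq> C" "\<And>z. z \<in> C \<Longrightarrow> p (k z) = p z" "k y' = y"
    using deck_lift_exists[OF cov sc lpc y(2,1) y(3)[symmetric]] by blast
  have id: "g (f z) = z" if fg: "continuous_on C f" "f ` C \<subseteq> C" "\<And>z. z \<in> C \<Longrightarrow> p (f z) = p z"
      "continuous_on C g" "g ` C \<subseteq> C" "\<And>z. z \<in> C \<Longrightarrow> p (g z) = p z" "a \<in> C" "g (f a) = a" "z \<in> C" for f g a z
  proof -
    have "continuous_on C (g \<circ> f)"
      using continuous_on_compose[OF fg(1)] continuous_on_subset[OF fg(4,2)] by blast
    moreover have "(g \<circ> f) ` C \<subseteq> C" using fg(2,5) by auto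
    moreover have "p ((g \<circ> f) t) = p (id t)" if "t \<in> C" for t
    proof -
      have "f t \<in> C" using fg(2) that by blast
      then show ?thesis using fg(3)[OF that] fg(6)[of "f t"] by simp
    qed
    ultimately have "(g \<circ> f) z = id z"
      using covering_space_unique_lift[OF cov con, of "g \<circ> f" id a z] fg(7-9)
      by (simp add: continuous_on_id)
    then show ?thesis by simp
  qed
  have kh: "k (h z) = z" "h (k z) = z" if "z \<in> C" for z
    using id[OF h(1-3) k(1-3) y(1)] id[OF k(1-3) h(1-3) y(2)] h(4) k(4) that by auto
  \<comment> \<open>Members of \<open>deck_transformations\<close> are extensional, hence the
    restriction of \<open>h\<close>.\<close>
  have maps: "homeomorphic_maps (top_of_set C) (top_of_set C) (restrict h C) k"
    using h(1,2) k(1,2) kh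
    unfolding homeomorphic_maps_def
    by (auto simp: continuous_map_in_subtopology image_subset_iff intro: continuous_on_eq)
  show ?thesis
  proof (rule that[of "restrict h C"])
    show "restrict h C \<in> deck_transformations C p"
      using maps h(3) homeomorphic_map_maps unfolding deck_transformations_def by fastforce
  qed (use y h in simp)
qed

text \<open>Local path-connectedness of Euclidean space is carried back through a chart; the chart
  domain is open, so open sets in it are open in \<open>M\<close>.\<close>

lemma closed_manifold_locally_path_connected:
  fixes M :: "'a::topological_space set"
  assumes M: "closed_manifold n M" and T: "x \<in> T" "openin (top_of_set M) T"
  shows "\<exists>V. x \<in> V \<and> openin (top_of_set M) V \<and> V \<subseteq> T \<and> path_connected V"
proof -
  have "x \<in> M" using T openin_imp_subset by blast
  then obtain U W where U: "openin (top_of_set M) U" "x \<in> U" "openin (Euclidean_space n) W"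
    "top_of_set U homeomorphic_space subtopology (Euclidean_space n) W"
    using M unfolding closed_manifold_def by metis
  have "locally_path_connected_space (subtopology (Euclidean_space n) W)"
    by (rule locally_path_connected_space_open_subset[OF locally_path_connected_Euclidean_space U(3)])
  then have "locally_path_connected_space (top_of_set U)"
    using homeomorphic_locally_path_connected_space[OF U(4)] by simp
  then have nb: "neighbourhood_base_of (\<lambda>V. openin (top_of_set U) V \<and> path_connectedin (top_of_set U) V) (top_of_set U)"
    by (simp add: locally_path_connected_space_alt)
  have UT: "openin (top_of_set U) (U \<inter> T)"
    using U(1) T(2) by (metis Int_commute openin_imp_subset openin_subtopology_Int openin_subset_trans inf_le1 openin_Int)
  obtain O' V where V: "openin (top_of_set U) O'" "openin (top_of_set U) V" "path_connectedin (top_of_set U) V"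
    "x \<in> O'" "O' \<subseteq> V" "V \<subseteq> U \<inter> T"
    using nb[unfolded neighbourhood_base_of, rule_format, of "U \<inter> T" x] UT U(2) T(1) by auto
  have "openin (top_of_set M) V" using V(2) U(1) by (rule openin_trans)
  moreover have "path_connected V"
    using V(3) by (simp add: path_connectedin_subtopology path_connectedin_euclidean)
  ultimately show ?thesis using V by blast
qed

section \<open>The fundamental group as the group of deck transformations\<close>

context
  fixes M :: "'a::topological_space set" and Mt :: "'b::topological_space set" and p :: "'b \<Rightarrow> 'a" and y :: 'b
    and n :: nat and \<Gamma>
  assumes M: "closed_manifold n M" and cov: "covering_space Mt p M" and sc: "simply_connected Mt" and y: "y \<in> Mt"
    and \<Gamma>: "\<Gamma> = fundamental_group M (p y)" "group \<Gamma>"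
begin

text \<open>Both maps are lifts of \<open>p\<close> along itself on a connected space, and
  extensionality fixes their values outside it.\<close>

lemma deck_transformation_eqI:
  assumes h: "h \<in> deck_transformations Mt p" and k: "k \<in> deck_transformations Mt p" and "a \<in> Mt" "h a = k a"
  shows "h = k"
proof -
  have con: "connected Mt"
    using simply_connected_imp_path_connected_space[OF sc] by (rule path_connected_imp_connected)
  have "continuous_on Mt h" "h ` Mt \<subseteq> Mt" "continuous_on Mt k" "k ` Mt \<subseteq> Mt"
    using h k homeomorphic_imp_continuous_map
    unfolding deck_transformations_def by (fastforce simp: continuous_map_in_subtopology)+
  then have "h t = k t" if "t \<in> Mt" for t
    using covering_space_unique_lift[OF cov con, of h k a t] assms that by (simp add: deck_transformations_def)
  then show ?thesis
    using h k by (intro extensionalityI[of _ Mt]) (auto simp: deck_transformations_def)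
qed

lemma deck_transformationD:
  assumes "h \<in> deck_transformations Mt p"
  shows "continuous_map (top_of_set Mt) (top_of_set Mt) h" "continuous_on Mt h" "h ` Mt \<subseteq> Mt"
    "\<And>z. z \<in> Mt \<Longrightarrow> h z \<in> Mt" "\<And>z. z \<in> Mt \<Longrightarrow> p (h z) = p z"
proof -
  show 1: "continuous_map (top_of_set Mt) (top_of_set Mt) h"
    using assms homeomorphic_imp_continuous_map unfolding deck_transformations_def by blast
  then show "continuous_on Mt h" "h ` Mt \<subseteq> Mt" "\<And>z. z \<in> Mt \<Longrightarrow> h z \<in> Mt"
    by (auto simp: continuous_map_in_subtopology)
  show "\<And>z. z \<in> Mt \<Longrightarrow> p (h z) = p z" using assms unfolding deck_transformations_def by blast
qed

lemma loop_class:
  assumes "g \<in> carrier \<Gamma>"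
  obtains b where "path b" "path_image b \<subseteq> M" "b 0 = p y" "b 1 = p y" "g = Collect (homotopic_paths M b)" "b \<in> g"
  using assms unfolding \<Gamma>(1) fundamental_group_def loops_at_def pathstart_def pathfinish_def by auto

text \<open>Pins down the definite description in \<open>deck\<close>: the loops of one class have
  lifts with the same end by monodromy, and a deck transformation is determined by its value at
  \<open>y\<close>.\<close>

lemma deck_eqI:
  assumes g: "g \<in> carrier \<Gamma>" and h: "h \<in> deck_transformations Mt p"
    and b: "b \<in> g" "path_lift Mt p b c" "c 0 = y" "h y = c 1"
  shows "deck Mt p y g = h"
  unfolding deck_def
proof (rule the_equality)
  show "h \<in> deck_transformations Mt p \<and>
        (\<exists>b\<in>g. \<exists>c. path c \<and> path_image c \<subseteq> Mt \<and> pathstart c = y \<and>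
           (\<forall>t\<in>{0..1}. p (c t) = b t) \<and> h y = pathfinish c)"
    using h b unfolding path_lift_def pathstart_def pathfinish_def by blast
  fix k assume "k \<in> deck_transformations Mt p \<and>
        (\<exists>b\<in>g. \<exists>c. path c \<and> path_image c \<subseteq> Mt \<and> pathstart c = y \<and>
           (\<forall>t\<in>{0..1}. p (c t) = b t) \<and> k y = pathfinish c)"
  then obtain b' c' where k: "k \<in> deck_transformations Mt p" "b' \<in> g" "path_lift Mt p b' c'" "c' 0 = y" "k y = c' 1"
    unfolding path_lift_def pathstart_def pathfinish_def by blast
  have "homotopic_paths M b b'"
    using loop_class[OF g] b(1) k(2) by (metis homotopic_paths_sym homotopic_paths_trans mem_Collect_eq)
  then have "c 1 = c' 1"
    using path_lift_monodromy[OF cov _ b(2) k(3)] b(3) k(4) by simp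
  then show "k = h"
    using deck_transformation_eqI[OF k(1) h y] b k by simp
qed

text \<open>Existence for that description: the end of the lifted loop lies over the base point, so
  some deck transformation carries \<open>y\<close> to it.\<close>

lemma deck_lift:
  assumes g: "g \<in> carrier \<Gamma>"
  obtains b c where "b \<in> g" "path_lift Mt p b c" "c 0 = y" "deck Mt p y g y = c 1"
    "deck Mt p y g \<in> deck_transformations Mt p"
proof -
  obtain b where b: "path b" "path_image b \<subseteq> M" "b 0 = p y" "b 1 = p y" "b \<in> g"
    using loop_class[OF g] by metis
  obtain c where c: "path_lift Mt p b c" "c 0 = y"
    using path_lift_exists[OF cov b(1,2) y] b(3) by auto
  have "c 1 \<in> Mt" "p y = p (c 1)"
    using c b(4) unfolding path_lift_def path_image_def by auto
  then obtain h where h: "h \<in> deck_transformations Mt p" "h y = c 1"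
    using covering_deck_transformation_exists[OF cov sc closed_manifold_locally_path_connected[OF M] y] by metis
  have "deck Mt p y g = h" by (rule deck_eqI[OF g h(1) b(5) c h(2)])
  then show ?thesis using that b c h by blast
qed

text \<open>If \<open>c1\<close> and \<open>c2\<close> lift the two loops, then \<open>c1\<close>
  followed by the translate of \<open>c2\<close> under \<open>g\<close> lifts their product, because
  the translate starts at the image of \<open>y\<close> under \<open>g\<close>, which is the end of
  \<open>c1\<close>.\<close>

lemma deck_mult:
  assumes g: "g \<in> carrier \<Gamma>" and h: "h \<in> carrier \<Gamma>" and z: "z \<in> Mt"
  shows "deck Mt p y (g \<otimes>\<^bsub>\<Gamma>\<^esub> h) z = deck Mt p y g (deck Mt p y h z)"
proof -
  obtain b1 c1 where 1: "b1 \<in> g" "path_lift Mt p b1 c1" "c1 0 = y" "deck Mt p y g y = c1 1"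
    "deck Mt p y g \<in> deck_transformations Mt p" by (rule deck_lift[OF g])
  obtain b2 c2 where 2: "b2 \<in> h" "path_lift Mt p b2 c2" "c2 0 = y" "deck Mt p y h y = c2 1"
    "deck Mt p y h \<in> deck_transformations Mt p" by (rule deck_lift[OF h])
  have b: "path b1" "path b2" "path_image b1 \<subseteq> M" "path_image b2 \<subseteq> M" "b1 1 = p y" "b2 0 = p y"
    using loop_class[OF g] loop_class[OF h] 1(1) 2(1)
    by (metis (no_types, lifting) homotopic_paths_imp_path homotopic_paths_imp_subset mem_Collect_eq
        homotopic_paths_imp_pathfinish homotopic_paths_imp_pathstart pathstart_def pathfinish_def)+
  let ?k = "restrict (deck Mt p y g \<circ> deck Mt p y h) Mt"
  note D1 = deck_transformationD[OF 1(5)] and D2 = deck_transformationD[OF 2(5)]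
  have "deck Mt p y (g \<otimes>\<^bsub>\<Gamma>\<^esub> h) = ?k"
  proof (rule deck_eqI)
    show "g \<otimes>\<^bsub>\<Gamma>\<^esub> h \<in> carrier \<Gamma>" using g h \<Gamma>(2) by (simp add: group.is_monoid monoid.m_closed)
    have "homeomorphic_map (top_of_set Mt) (top_of_set Mt) (deck Mt p y g \<circ> deck Mt p y h)"
      using 1(5) 2(5) unfolding deck_transformations_def by (blast intro: homeomorphic_map_compose)
    then have "homeomorphic_map (top_of_set Mt) (top_of_set Mt) ?k"
      by (rule homeomorphic_map_eq) auto
    then show "?k \<in> deck_transformations Mt p"
      using D1 D2 unfolding deck_transformations_def by auto
    have "homotopic_paths M (b1 +++ b2) (b1 +++ b2)"
      using b by (simp add: path_image_join path_join_eq pathstart_def pathfinish_def)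
    then show "b1 +++ b2 \<in> g \<otimes>\<^bsub>\<Gamma>\<^esub> h"
      unfolding \<Gamma>(1) fundamental_group_def monoid.simps
      using 1(1) 2(1) by (intro CollectI bexI[of _ b1] bexI[of _ b2])
    show "path_lift Mt p (b1 +++ b2) (c1 +++ (deck Mt p y g \<circ> c2))"
      unfolding path_lift_def
    proof (intro conjI ballI)
      have "path (deck Mt p y g \<circ> c2)"
        using 2(2) unfolding path_lift_def by (intro path_continuous_image continuous_on_subset[OF D1(2)]) auto
      moreover have "path_image (deck Mt p y g \<circ> c2) \<subseteq> Mt"
        using 2(2) D1(3) unfolding path_lift_def path_image_compose by blast
      ultimately show "path (c1 +++ (deck Mt p y g \<circ> c2))" "path_image (c1 +++ (deck Mt p y g \<circ> c2)) \<subseteq> Mt"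
        using 1 2 by (auto simp: path_lift_def path_image_join path_join_eq pathstart_def pathfinish_def)
      fix t :: real assume t: "t \<in> {0..1}"
      have "p (deck Mt p y g (c2 s)) = b2 s" if "s \<in> {0..1}" for s
      proof -
        have "c2 s \<in> Mt" "p (c2 s) = b2 s"
          using that 2(2) unfolding path_lift_def path_image_def by blast+
        then show ?thesis using D1(5) by simp
      qed
      then show "p ((c1 +++ (deck Mt p y g \<circ> c2)) t) = (b1 +++ b2) t"
        using t 1(2) by (auto simp: joinpaths_def path_lift_def)
    qed
  qed (use y 1 2 in \<open>auto simp: joinpaths_def\<close>)
  then show ?thesis using z by simp
qed

text \<open>Some deck transformation \<open>h\<close> carries \<open>z\<close> to \<open>z'\<close>;
  a path from \<open>y\<close> to \<open>h y\<close> projects to a loop whose class acts as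
  \<open>h\<close>.\<close>

lemma deck_transitive:
  assumes z: "z \<in> Mt" "z' \<in> Mt" "p z = p z'"
  obtains g where "g \<in> carrier \<Gamma>" "deck Mt p y g z = z'"
proof -
  obtain h where h: "h \<in> deck_transformations Mt p" "h z = z'"
    using covering_deck_transformation_exists[OF cov sc closed_manifold_locally_path_connected[OF M] z] by metis
  have hy: "h y \<in> Mt" "p (h y) = p y" using deck_transformationD[OF h(1)] y by auto
  obtain c where c: "path c" "path_image c \<subseteq> Mt" "c 0 = y" "c 1 = h y"
    using simply_connected_imp_path_connected_space[OF sc] y hy(1)
    unfolding path_connected_def pathstart_def pathfinish_def by metis
  have pc: "path (p \<circ> c)" "path_image (p \<circ> c) \<subseteq> M"
    using path_continuous_image[OF c(1) continuous_on_subset[OF covering_space_imp_continuous[OF cov] c(2)]]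
      c(2) covering_space_imp_surjective[OF cov] by (auto simp: path_image_compose)
  let ?g = "Collect (homotopic_paths M (p \<circ> c))"
  have g: "?g \<in> carrier \<Gamma>"
    using pc c hy unfolding \<Gamma>(1) fundamental_group_def loops_at_def
    by (auto simp: pathstart_def pathfinish_def)
  have "deck Mt p y ?g = h"
    by (rule deck_eqI[OF g h(1), of "p \<circ> c" c]) (use pc c in \<open>auto simp: path_lift_def\<close>)
  then show ?thesis using that[OF g] h by simp
qed

text \<open>A fixed point forces the identity, so the lift of a loop in \<open>g\<close> is closed.
  It contracts upstairs with fixed ends, and the projection of this contraction contracts the
  loop.\<close>

lemma deck_free:
  assumes g: "g \<in> carrier \<Gamma>" and z: "z \<in> Mt" "deck Mt p y g z = z"
  shows "g = \<one>\<^bsub>\<Gamma>\<^esub>"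
proof -
  obtain b c where b: "b \<in> g" "path_lift Mt p b c" "c 0 = y" "deck Mt p y g y = c 1"
    "deck Mt p y g \<in> deck_transformations Mt p" by (rule deck_lift[OF g])
  have "homeomorphic_map (top_of_set Mt) (top_of_set Mt) (restrict id Mt)"
    by (rule homeomorphic_map_eq[of _ _ id]) auto
  then have "restrict id Mt \<in> deck_transformations Mt p"
    unfolding deck_transformations_def by auto
  then have "deck Mt p y g = restrict id Mt"
    using deck_transformation_eqI[OF b(5) _ z(1)] z by simp
  then have c1: "c 1 = c 0" using b y by simp
  have c: "path c" "path_image c \<subseteq> Mt" using b(2) by (auto simp: path_lift_def)
  have "homotopic_paths Mt c (\<lambda>_. c 0)"
    by (rule homotopic_loops_const_imp_homotopic_paths[OF simply_connected_imp_null_homotopic[OF sc c c1]])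
  then have "homotopic_paths M (p \<circ> c) (p \<circ> (\<lambda>_. c 0))"
    by (rule homotopic_paths_continuous_image) (use cov in \<open>auto simp: covering_space_def\<close>)
  then have 1: "homotopic_paths M (p \<circ> c) (\<lambda>_. p y)" using b(3) by (simp add: o_def)
  obtain b0 where b0: "g = Collect (homotopic_paths M b0)" using loop_class[OF g] by metis
  have "homotopic_paths M b0 b" using b0 b(1) by simp
  then have "path b" "path_image b \<subseteq> M"
    by (blast dest: homotopic_paths_imp_path homotopic_paths_imp_subset)+
  then have "homotopic_paths M b (p \<circ> c)"
    using b(2) by (intro homotopic_paths_eq) (auto simp: path_lift_def)
  then have "homotopic_paths M b0 (\<lambda>_. p y)"
    using 1 b0 b(1) homotopic_paths_trans by blast
  then have "g = Collect (homotopic_paths M (\<lambda>_. p y))"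
    using b0 homotopic_paths_sym homotopic_paths_trans by blast
  then show ?thesis unfolding \<Gamma>(1) fundamental_group_def by simp
qed

section \<open>The action on singular simplices: orbits and freeness\<close>

lemma singular_simplex_deck:
  assumes g: "g \<in> carrier \<Gamma>" and \<sigma>: "singular_simplex k (top_of_set Mt) \<sigma>"
  shows "singular_simplex k (top_of_set Mt) (simplex_map k (deck Mt p y g) \<sigma>)"
    "simplex_map k p (simplex_map k (deck Mt p y g) \<sigma>) = simplex_map k p \<sigma>"
proof -
  obtain b c where "deck Mt p y g \<in> deck_transformations Mt p" by (rule deck_lift[OF g])
  note D = deck_transformationD[OF this]
  show "singular_simplex k (top_of_set Mt) (simplex_map k (deck Mt p y g) \<sigma>)"
    using singular_simplex_simplex_map[OF \<sigma> D(1)] .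
  have "simplex_map k (p \<circ> deck Mt p y g) \<sigma> = simplex_map k p \<sigma>"
    by (rule simplex_map_eq[OF \<sigma>]) (use D in auto)
  then show "simplex_map k p (simplex_map k (deck Mt p y g) \<sigma>) = simplex_map k p \<sigma>"
    by (simp add: simplex_map_compose)
qed

lemma simplex_map_deck_mult:
  assumes "g \<in> carrier \<Gamma>" "h \<in> carrier \<Gamma>" "singular_simplex k (top_of_set Mt) \<sigma>"
  shows "simplex_map k (deck Mt p y (g \<otimes>\<^bsub>\<Gamma>\<^esub> h)) \<sigma> =
    simplex_map k (deck Mt p y g) (simplex_map k (deck Mt p y h) \<sigma>)"
proof -
  have "simplex_map k (deck Mt p y (g \<otimes>\<^bsub>\<Gamma>\<^esub> h)) \<sigma> = simplex_map k (deck Mt p y g \<circ> deck Mt p y h) \<sigma>"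
    by (rule simplex_map_eq[OF assms(3)]) (use assms deck_mult in auto)
  then show ?thesis by (simp add: simplex_map_compose)
qed

lemma singular_simplex_points:
  assumes "singular_simplex k (top_of_set Mt) \<sigma>"
  shows "continuous_on (standard_simplex k) \<sigma>" "\<sigma> ` standard_simplex k \<subseteq> Mt"
    "\<sigma> \<in> extensional (standard_simplex k)"
  using assms by (auto simp: singular_simplex_def continuous_map_in_subtopology euclidean_product_topology)

text \<open>Match the simplices at one point by a deck transformation; they are then lifts of one
  map on the connected standard simplex and agree at a point.\<close>

lemma simplex_deck_transitive:
  assumes \<sigma>: "singular_simplex k (top_of_set Mt) \<sigma>" and \<tau>: "singular_simplex k (top_of_set Mt) \<tau>"
    and eq: "simplex_map k p \<sigma> = simplex_map k p \<tau>"
  obtains g where "g \<in> carrier \<Gamma>" "simplex_map k (deck Mt p y g) \<sigma> = \<tau>"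
proof -
  obtain v where v: "v \<in> standard_simplex k" using nonempty_standard_simplex by blast
  have pe: "p (\<sigma> w) = p (\<tau> w)" if "w \<in> standard_simplex k" for w
    using fun_cong[OF eq, of w] that by (simp add: simplex_map_def)
  have "\<sigma> v \<in> Mt" "\<tau> v \<in> Mt"
    using v singular_simplex_points[OF \<sigma>] singular_simplex_points[OF \<tau>] by auto
  then obtain g where g: "g \<in> carrier \<Gamma>" "deck Mt p y g (\<sigma> v) = \<tau> v"
    using deck_transitive[of "\<sigma> v" "\<tau> v"] pe[OF v] by blast
  note g\<sigma> = singular_simplex_deck[OF g(1) \<sigma>]
  have pg: "p (simplex_map k (deck Mt p y g) \<sigma> w) = p (\<tau> w)" if "w \<in> standard_simplex k" for w
    using fun_cong[OF g\<sigma>(2), of w] pe[OF that] that by (simp add: simplex_map_def)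
  have gv: "simplex_map k (deck Mt p y g) \<sigma> v = \<tau> v"
    using g(2) v by (simp add: simplex_map_def)
  have "connected (standard_simplex k)"
    using connectedin_standard_simplex[of k]
    by (simp add: euclidean_product_topology)
  then have "simplex_map k (deck Mt p y g) \<sigma> w = \<tau> w" if "w \<in> standard_simplex k" for w
    by (rule covering_space_unique_lift[OF cov])
      (use singular_simplex_points[OF g\<sigma>(1)] singular_simplex_points[OF \<tau>] pg gv v that in auto)
  then have "simplex_map k (deck Mt p y g) \<sigma> = \<tau>"
    using singular_simplex_points(3)[OF g\<sigma>(1)] singular_simplex_points(3)[OF \<tau>]
    by (intro extensionalityI[of _ "standard_simplex k"]) auto
  then show ?thesis using that g by blast
qed

lemma simplex_deck_free:
  assumes g: "g \<in> carrier \<Gamma>" and \<sigma>: "singular_simplex k (top_of_set Mt) \<sigma>"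
    and eq: "simplex_map k (deck Mt p y g) \<sigma> = \<sigma>"
  shows "g = \<one>\<^bsub>\<Gamma>\<^esub>"
proof -
  obtain v where v: "v \<in> standard_simplex k" using nonempty_standard_simplex by blast
  have "deck Mt p y g (\<sigma> v) = \<sigma> v"
    using fun_cong[OF eq, of v] v by (simp add: simplex_map_def)
  then show ?thesis
    using deck_free[OF g] singular_simplex_points(2)[OF \<sigma>] v by blast
qed

end

section \<open>Tensor products over group rings\<close>

abbreviation keys :: "('a \<Rightarrow>\<^sub>0 int) \<Rightarrow> 'a set" where
  "keys \<equiv> Poly_Mapping.keys"

text \<open>Serves left and right modules alike, since only additivity of each single operator is
  recorded; how operators compose enters later, through the actions on simplices and on
  points.\<close>

definition is_gmodule :: "'g monoid \<Rightarrow> ('a, 'g) gmodule \<Rightarrow> bool" where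
  "is_gmodule \<Gamma> A \<longleftrightarrow> comm_group A \<and> (\<forall>g\<in>carrier \<Gamma>. act A g \<in> hom A A)"

text \<open>The counterpart of \<open>tensor_map\<close> on formal sums, before the relations are
  divided out.\<close>

definition tensor_lift :: "('b \<Rightarrow> 'a) \<Rightarrow> ('d \<Rightarrow> 'c) \<Rightarrow> ('b \<times> 'd \<Rightarrow>\<^sub>0 int) \<Rightarrow> ('a \<times> 'c \<Rightarrow>\<^sub>0 int)" where
  "tensor_lift \<phi> \<psi> = frag_extend (\<lambda>(b, d). frag_of (\<phi> b, \<psi> d))"

lemma tensor_lift_of [simp]: "tensor_lift \<phi> \<psi> (frag_of (b, d)) = frag_of (\<phi> b, \<psi> d)"
  and tensor_lift_0 [simp]: "tensor_lift \<phi> \<psi> 0 = 0"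
  and tensor_lift_diff: "tensor_lift \<phi> \<psi> (u - v) = tensor_lift \<phi> \<psi> u - tensor_lift \<phi> \<psi> v"
  and tensor_lift_add: "tensor_lift \<phi> \<psi> (u + v) = tensor_lift \<phi> \<psi> u + tensor_lift \<phi> \<psi> v"
  by (simp_all add: tensor_lift_def frag_extend_diff frag_extend_add)

lemma tensor_lift_compose:
  "tensor_lift \<phi> \<psi> (tensor_lift \<phi>' \<psi>' u) = tensor_lift (\<phi> \<circ> \<phi>') (\<psi> \<circ> \<psi>') u"
  using subset_UNIV
  by (induction u rule: frag_induction) (auto simp: tensor_lift_diff)

lemma tensor_lift_cong:
  assumes "keys u \<subseteq> B \<times> D" "\<And>b. b \<in> B \<Longrightarrow> \<phi> b = \<phi>' b" "\<And>d. d \<in> D \<Longrightarrow> \<psi> d = \<psi>' d"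
  shows "tensor_lift \<phi> \<psi> u = tensor_lift \<phi>' \<psi>' u"
  unfolding tensor_lift_def by (rule frag_extend_eq) (use assms in auto)

lemma tensor_lift_id:
  "keys u \<subseteq> B \<times> D \<Longrightarrow> tensor_lift id id u = u"
  by (induction u rule: frag_induction) (auto simp: tensor_lift_diff)

lemma keys_tensor_lift:
  assumes "keys u \<subseteq> B \<times> D" "\<phi> ` B \<subseteq> A" "\<psi> ` D \<subseteq> C"
  shows "keys (tensor_lift \<phi> \<psi> u) \<subseteq> A \<times> C"
proof -
  have "keys (case x of (b, d) \<Rightarrow> frag_of (\<phi> b, \<psi> d)) \<subseteq> A \<times> C"
    if "x \<in> keys u" for x
    using subsetD[OF assms(1) that] assms(2,3) by (cases x) auto
  then show ?thesis
    unfolding tensor_lift_def by (intro subset_trans[OF keys_frag_extend]) blast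
qed

lemma keys_diff_subset: "\<lbrakk>keys u \<subseteq> S; keys v \<subseteq> S\<rbrakk> \<Longrightarrow> keys (u - v) \<subseteq> S"
  for u v :: "'a \<Rightarrow>\<^sub>0 int"
  using keys_diff[of u v] by blast

lemma keys_add_subset: "\<lbrakk>keys u \<subseteq> S; keys v \<subseteq> S\<rbrakk> \<Longrightarrow> keys (u + v) \<subseteq> S"
  for u v :: "'a \<Rightarrow>\<^sub>0 int"
  using keys_add[of u v] by blast

lemma is_gmoduleD:
  assumes "is_gmodule \<Gamma> A"
  shows "comm_group A" "group A" "\<And>a b. \<lbrakk>a \<in> carrier A; b \<in> carrier A\<rbrakk> \<Longrightarrow> a \<otimes>\<^bsub>A\<^esub> b \<in> carrier A"
    "\<one>\<^bsub>A\<^esub> \<in> carrier A" "\<And>g a. \<lbrakk>g \<in> carrier \<Gamma>; a \<in> carrier A\<rbrakk> \<Longrightarrow> act A g a \<in> carrier A"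
    "\<And>g a b. \<lbrakk>g \<in> carrier \<Gamma>; a \<in> carrier A; b \<in> carrier A\<rbrakk> \<Longrightarrow> act A g (a \<otimes>\<^bsub>A\<^esub> b) = act A g a \<otimes>\<^bsub>A\<^esub> act A g b"
proof -
  show "comm_group A" using assms by (simp add: is_gmodule_def)
  then interpret comm_group A .
  show "group A" ..
  show "\<And>a b. \<lbrakk>a \<in> carrier A; b \<in> carrier A\<rbrakk> \<Longrightarrow> a \<otimes>\<^bsub>A\<^esub> b \<in> carrier A" "\<one>\<^bsub>A\<^esub> \<in> carrier A" by auto
  show "\<And>g a. \<lbrakk>g \<in> carrier \<Gamma>; a \<in> carrier A\<rbrakk> \<Longrightarrow> act A g a \<in> carrier A"
    "\<And>g a b. \<lbrakk>g \<in> carrier \<Gamma>; a \<in> carrier A; b \<in> carrier A\<rbrakk> \<Longrightarrow> act A g (a \<otimes>\<^bsub>A\<^esub> b) = act A g a \<otimes>\<^bsub>A\<^esub> act A g b"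
    using assms by (auto simp: is_gmodule_def hom_def)
qed

lemma equivariant_homD:
  assumes "f \<in> equivariant_hom \<Gamma> A B"
  shows "\<And>a. a \<in> carrier A \<Longrightarrow> f a \<in> carrier B" "f ` carrier A \<subseteq> carrier B"
    "\<And>a b. \<lbrakk>a \<in> carrier A; b \<in> carrier A\<rbrakk> \<Longrightarrow> f (a \<otimes>\<^bsub>A\<^esub> b) = f a \<otimes>\<^bsub>B\<^esub> f b"
    "\<And>g a. \<lbrakk>g \<in> carrier \<Gamma>; a \<in> carrier A\<rbrakk> \<Longrightarrow> f (act A g a) = act B g (f a)"
  using assms by (auto simp: equivariant_hom_def hom_def)

lemma equivariant_hom_id: "id \<in> equivariant_hom \<Gamma> A A"
  by (simp add: equivariant_hom_def hom_def)

lemma equivariant_hom_compose: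
  assumes "f \<in> equivariant_hom \<Gamma> A B" "h \<in> equivariant_hom \<Gamma> B C"
  shows "h \<circ> f \<in> equivariant_hom \<Gamma> A C"
  using equivariant_homD[OF assms(1)] equivariant_homD[OF assms(2)]
  by (auto simp: equivariant_hom_def hom_def)

section \<open>Calculus of the tensor relations\<close>

lemma tensor_class_mem: "w \<in> tensor_class \<Gamma> A D u \<longleftrightarrow> w - u \<in> tensor_relations \<Gamma> A D"
  unfolding tensor_class_def r_coset_def by (auto simp: algebra_simps intro: bexI[of _ "w - u"])

locale gmodule_pair =
  fixes \<Gamma> :: "'g monoid" and A :: "('a, 'g) gmodule" and D :: "('c, 'g) gmodule"
  assumes A: "is_gmodule \<Gamma> A" and D: "is_gmodule \<Gamma> D"
begin

abbreviation "R \<equiv> tensor_relations \<Gamma> A D"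
abbreviation "cls \<equiv> tensor_class \<Gamma> A D"

lemma relations_in_carrier:
  "{frag_of (a \<otimes>\<^bsub>A\<^esub> b, c) - frag_of (a, c) - frag_of (b, c) | a b c.
           a \<in> carrier A \<and> b \<in> carrier A \<and> c \<in> carrier D} \<union>
        {frag_of (a, c \<otimes>\<^bsub>D\<^esub> d) - frag_of (a, c) - frag_of (a, d) | a c d.
           a \<in> carrier A \<and> c \<in> carrier D \<and> d \<in> carrier D} \<union>
        {frag_of (act A g a, c) - frag_of (a, act D g c) | g a c.
           g \<in> carrier \<Gamma> \<and> a \<in> carrier A \<and> c \<in> carrier D}
   \<subseteq> carrier (free_Abelian_group (carrier A \<times> carrier D))"
  (is "?G \<subseteq> _")
proof
  fix r assume "r \<in> ?G"
  then have "keys r \<subseteq> carrier A \<times> carrier D"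
    using is_gmoduleD(3,5)[OF A] is_gmoduleD(3,5)[OF D]
    by (elim UnE CollectE exE conjE; simp; intro keys_diff_subset; simp)
  then show "r \<in> carrier (free_Abelian_group (carrier A \<times> carrier D))" by simp
qed

lemma subgroup_relations: "subgroup R (free_Abelian_group (carrier A \<times> carrier D))"
  unfolding tensor_relations_def
  by (rule group.generate_is_subgroup[OF group_free_Abelian_group relations_in_carrier])

lemma relations_carrier: "r \<in> R \<Longrightarrow> keys r \<subseteq> carrier A \<times> carrier D"
  using subsetD[OF subgroup.subset[OF subgroup_relations]] by (simp only: carrier_free_Abelian_group_iff)

lemma relations_0 [simp]: "0 \<in> R"
  using subgroup.one_closed[OF subgroup_relations] by simp

lemma relations_add: "\<lbrakk>r \<in> R; s \<in> R\<rbrakk> \<Longrightarrow> r + s \<in> R"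
  using subgroup.m_closed[OF subgroup_relations] by simp

lemma relations_minus: "r \<in> R \<Longrightarrow> - r \<in> R"
  using subgroup.m_inv_closed[OF subgroup_relations] relations_carrier by fastforce

lemma relations_diff: "\<lbrakk>r \<in> R; s \<in> R\<rbrakk> \<Longrightarrow> r - s \<in> R"
  using relations_add[of r "- s"] relations_minus by simp

lemma relations_left: "\<lbrakk>a \<in> carrier A; b \<in> carrier A; c \<in> carrier D\<rbrakk> \<Longrightarrow>
    frag_of (a \<otimes>\<^bsub>A\<^esub> b, c) - frag_of (a, c) - frag_of (b, c) \<in> R"
  unfolding tensor_relations_def by (rule generate.incl) blast

lemma relations_right: "\<lbrakk>a \<in> carrier A; c \<in> carrier D; d \<in> carrier D\<rbrakk> \<Longrightarrow>
    frag_of (a, c \<otimes>\<^bsub>D\<^esub> d) - frag_of (a, c) - frag_of (a, d) \<in> R"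
  unfolding tensor_relations_def by (rule generate.incl) blast

lemma relations_act: "\<lbrakk>g \<in> carrier \<Gamma>; a \<in> carrier A; c \<in> carrier D\<rbrakk> \<Longrightarrow>
    frag_of (act A g a, c) - frag_of (a, act D g c) \<in> R"
  unfolding tensor_relations_def by (rule generate.incl) blast

text \<open>Closure under differences covers inverses, as \<open>0 - h\<close>, and sums, as
  \<open>h1 - (0 - h2)\<close>.\<close>

lemma relations_induct [consumes 1, case_names zero diff left right act]:
  assumes r: "r \<in> R" and 0: "P 0" and diff: "\<And>r s. \<lbrakk>P r; P s\<rbrakk> \<Longrightarrow> P (r - s)"
    and left: "\<And>a b c. \<lbrakk>a \<in> carrier A; b \<in> carrier A; c \<in> carrier D\<rbrakk> \<Longrightarrow>
      P (frag_of (a \<otimes>\<^bsub>A\<^esub> b, c) - frag_of (a, c) - frag_of (b, c))"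
    and right: "\<And>a c d. \<lbrakk>a \<in> carrier A; c \<in> carrier D; d \<in> carrier D\<rbrakk> \<Longrightarrow>
      P (frag_of (a, c \<otimes>\<^bsub>D\<^esub> d) - frag_of (a, c) - frag_of (a, d))"
    and act: "\<And>g a c. \<lbrakk>g \<in> carrier \<Gamma>; a \<in> carrier A; c \<in> carrier D\<rbrakk> \<Longrightarrow>
      P (frag_of (act A g a, c) - frag_of (a, act D g c))"
  shows "P r"
  using r unfolding tensor_relations_def
proof (induction r rule: generate.induct)
  case one
  then show ?case using 0 by simp
next
  case (incl h)
  then show ?case using left right act by blast
next
  case (inv h)
  have "keys h \<subseteq> carrier A \<times> carrier D"
    using subsetD[OF relations_in_carrier inv] by (simp only: carrier_free_Abelian_group_iff)
  then have "inv\<^bsub>free_Abelian_group (carrier A \<times> carrier D)\<^esub> h = 0 - h" by simp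
  moreover have "P h" using inv left right act by blast
  ultimately show ?case using diff 0 by metis
next
  case (eng h1 h2)
  have "h1 + h2 = h1 - (0 - h2)" by simp
  then show ?case using eng diff 0 by (metis mult_free_Abelian_group)
qed

lemma class_eq: "cls u = cls v \<longleftrightarrow> u - v \<in> R"
proof
  assume "cls u = cls v"
  then show "u - v \<in> R" using tensor_class_mem[of u] relations_0 by (metis diff_self)
next
  assume uv: "u - v \<in> R"
  have "w - u \<in> R \<longleftrightarrow> w - v \<in> R" for w
    using relations_add[of "w - u" "u - v"] relations_diff[of "w - v" "u - v"] uv by auto
  then show "cls u = cls v" by (auto simp: tensor_class_mem)
qed

lemma class_self: "u \<in> cls u"
  by (simp add: tensor_class_mem)

lemma one_tensor: "\<one>\<^bsub>tensor \<Gamma> A D\<^esub> = cls 0"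
  by (auto simp: tensor_def tensor_class_mem)

lemma carrier_tensor: "\<xi> \<in> carrier (tensor \<Gamma> A D) \<longleftrightarrow> (\<exists>u. keys u \<subseteq> carrier A \<times> carrier D \<and> \<xi> = cls u)"
  unfolding tensor_def carrier_FactGroup tensor_class_def by (auto simp flip: carrier_free_Abelian_group_iff)

lemma mult_tensor: "cls u \<otimes>\<^bsub>tensor \<Gamma> A D\<^esub> cls v = cls (u + v)"
proof -
  have "w \<in> cls (u + v)" if w: "w \<in> cls u \<otimes>\<^bsub>tensor \<Gamma> A D\<^esub> cls v" for w
  proof -
    obtain x z where "x - u \<in> R" "z - v \<in> R" "w = x + z"
      using w by (auto simp: tensor_def set_mult_def tensor_class_mem)
    then show ?thesis
      using relations_add[of "x - u" "z - v"] by (simp add: tensor_class_mem algebra_simps)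
  qed
  moreover have "w \<in> cls u \<otimes>\<^bsub>tensor \<Gamma> A D\<^esub> cls v" if "w \<in> cls (u + v)" for w
  proof -
    have "w - v \<in> cls u" "v \<in> cls v" "w = (w - v) + v"
      using that by (auto simp: tensor_class_mem algebra_simps)
    then show ?thesis unfolding tensor_def mult_FactGroup set_mult_def mult_free_Abelian_group by blast
  qed
  ultimately show ?thesis by blast
qed

text \<open>Right additivity for the unit times itself has the form x - x - x, which is -x.\<close>

lemma relations_right_0:
  assumes "a \<in> carrier A"
  shows "frag_of (a, \<one>\<^bsub>D\<^esub>) \<in> R"
proof -
  have 1: "\<one>\<^bsub>D\<^esub> \<otimes>\<^bsub>D\<^esub> \<one>\<^bsub>D\<^esub> = \<one>\<^bsub>D\<^esub>"
    using is_gmoduleD(2)[OF D] by (simp add: group.is_monoid)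
  show ?thesis
    using relations_minus[OF relations_right[OF assms is_gmoduleD(4)[OF D] is_gmoduleD(4)[OF D]]]
    by (simp add: 1)
qed

lemma relations_left_0:
  assumes "c \<in> carrier D"
  shows "frag_of (\<one>\<^bsub>A\<^esub>, c) \<in> R"
proof -
  have 1: "\<one>\<^bsub>A\<^esub> \<otimes>\<^bsub>A\<^esub> \<one>\<^bsub>A\<^esub> = \<one>\<^bsub>A\<^esub>"
    using is_gmoduleD(2)[OF A] by (simp add: group.is_monoid)
  show ?thesis
    using relations_minus[OF relations_left[OF is_gmoduleD(4)[OF A] is_gmoduleD(4)[OF A] assms]]
    by (simp add: 1)
qed

text \<open>Each of the three kinds of generators is sent to a generator of the same kind.\<close>

lemma tensor_lift_relations:
  assumes A': "is_gmodule \<Gamma> A'" and D': "is_gmodule \<Gamma> D'"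
    and \<phi>: "\<phi> \<in> equivariant_hom \<Gamma> A' A" and \<psi>: "\<psi> \<in> equivariant_hom \<Gamma> D' D"
    and r: "r \<in> tensor_relations \<Gamma> A' D'"
  shows "tensor_lift \<phi> \<psi> r \<in> R"
proof -
  interpret P: gmodule_pair \<Gamma> A' D' by unfold_locales fact+
  note f = equivariant_homD[OF \<phi>] and g = equivariant_homD[OF \<psi>]
  show ?thesis
    using r
  proof (induction r rule: P.relations_induct)
    case (left a b c)
    then show ?case using relations_left[of "\<phi> a" "\<phi> b" "\<psi> c"] f g by (simp add: tensor_lift_diff)
  next
    case (right a c d)
    then show ?case using relations_right[of "\<phi> a" "\<psi> c" "\<psi> d"] f g by (simp add: tensor_lift_diff)
  next
    case (act h a c)
    then show ?case using relations_act[of h "\<phi> a" "\<psi> c"] f g by (simp add: tensor_lift_diff)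
  qed (auto simp: tensor_lift_diff relations_diff)
qed

text \<open>All representatives of the class have their images in one coset, so the union in
  \<open>tensor_map\<close> collapses to it.\<close>

lemma tensor_map_class:
  assumes A': "is_gmodule \<Gamma> A'" and D': "is_gmodule \<Gamma> D'"
    and \<phi>: "\<phi> \<in> equivariant_hom \<Gamma> A' A" and \<psi>: "\<psi> \<in> equivariant_hom \<Gamma> D' D"
  shows "tensor_map \<Gamma> A D \<phi> \<psi> (tensor_class \<Gamma> A' D' u) = cls (tensor_lift \<phi> \<psi> u)"
proof -
  interpret P: gmodule_pair \<Gamma> A' D' by unfold_locales fact+
  have eq: "tensor_map \<Gamma> A D \<phi> \<psi> \<xi> = (\<Union>v\<in>\<xi>. cls (tensor_lift \<phi> \<psi> v))" for \<xi>
    by (simp add: tensor_map_def tensor_lift_def)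
  have "cls (tensor_lift \<phi> \<psi> v) = cls (tensor_lift \<phi> \<psi> u)" if "v \<in> tensor_class \<Gamma> A' D' u" for v
    using tensor_lift_relations[OF assms, of "v - u"] that
    by (simp add: class_eq tensor_class_mem tensor_lift_diff)
  then show ?thesis
    unfolding eq using P.class_self[of u] by blast
qed

text \<open>On formal sums, \<open>tensor_lift\<close> is additive in \<open>\<psi>\<close> only up
  to relations. Homotopy formulas pass to tensor products in this form.\<close>

lemma tensor_lift_right_add:
  assumes u: "keys u \<subseteq> B \<times> E" and \<phi>: "\<phi> ` B \<subseteq> carrier A"
    and \<psi>: "\<psi>1 ` E \<subseteq> carrier D" "\<psi>2 ` E \<subseteq> carrier D" "\<And>c. c \<in> E \<Longrightarrow> \<psi> c = \<psi>1 c \<otimes>\<^bsub>D\<^esub> \<psi>2 c"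
  shows "tensor_lift \<phi> \<psi> u - tensor_lift \<phi> \<psi>1 u - tensor_lift \<phi> \<psi>2 u \<in> R"
  using u
proof (induction u rule: frag_induction)
  case (one x)
  then obtain b c where "x = (b, c)" "b \<in> B" "c \<in> E" by auto
  then show ?case using relations_right[of "\<phi> b" "\<psi>1 c" "\<psi>2 c"] \<phi> \<psi> by auto
next
  case (diff a b)
  have "tensor_lift \<phi> \<psi> (a - b) - tensor_lift \<phi> \<psi>1 (a - b) - tensor_lift \<phi> \<psi>2 (a - b) =
     (tensor_lift \<phi> \<psi> a - tensor_lift \<phi> \<psi>1 a - tensor_lift \<phi> \<psi>2 a) -
     (tensor_lift \<phi> \<psi> b - tensor_lift \<phi> \<psi>1 b - tensor_lift \<phi> \<psi>2 b)"
    by (simp add: tensor_lift_diff algebra_simps)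
  then show ?case using relations_diff[OF diff] by simp
qed simp

lemma tensor_lift_right_0:
  assumes u: "keys u \<subseteq> B \<times> E" and \<phi>: "\<phi> ` B \<subseteq> carrier A"
    and \<psi>: "\<And>c. c \<in> E \<Longrightarrow> \<psi> c = \<one>\<^bsub>D\<^esub>"
  shows "tensor_lift \<phi> \<psi> u \<in> R"
  using u
proof (induction u rule: frag_induction)
  case (one x)
  then obtain b c where "x = (b, c)" "b \<in> B" "c \<in> E" by auto
  then show ?case using relations_right_0[of "\<phi> b"] \<phi> \<psi> by auto
qed (auto simp: tensor_lift_diff relations_diff)

end

section \<open>The parametrised norm of a chain\<close>

text \<open>The additive extension of \<open>w\<close> to the free abelian group.\<close>

definition frag_eval :: "('i \<Rightarrow> real) \<Rightarrow> ('i \<Rightarrow>\<^sub>0 int) \<Rightarrow> real" where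
  "frag_eval w u = (\<Sum>i\<in>keys u. real_of_int (Poly_Mapping.lookup u i) * w i)"

lemma frag_eval_superset:
  assumes "finite T" "keys u \<subseteq> T"
  shows "frag_eval w u = (\<Sum>i\<in>T. real_of_int (Poly_Mapping.lookup u i) * w i)"
  unfolding frag_eval_def
  by (rule sum.mono_neutral_left) (use assms in \<open>auto simp: in_keys_iff\<close>)

lemma frag_eval_diff: "frag_eval w (u - v) = frag_eval w u - frag_eval w v"
proof -
  let ?T = "keys u \<union> keys v"
  have "finite ?T" "keys (u - v) \<subseteq> ?T" using keys_diff[of u v] by auto
  then show ?thesis
    by (simp add: frag_eval_superset[of ?T] lookup_minus algebra_simps sum_subtractf)
qed

lemma frag_eval_0 [simp]: "frag_eval w 0 = 0"
  by (simp add: frag_eval_def)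

lemma frag_eval_add: "frag_eval w (u + v) = frag_eval w u + frag_eval w v"
  using frag_eval_diff[of w "u + v" v] by simp

lemma frag_eval_of [simp]: "frag_eval w (frag_of i) = w i"
  by (simp add: frag_eval_def)

lemma frag_eval_sum: "finite I \<Longrightarrow> frag_eval w (\<Sum>i\<in>I. f i) = (\<Sum>i\<in>I. frag_eval w (f i))"
  by (induction I rule: finite_induct) (simp_all add: frag_eval_add)

lemma frag_eval_cong: "(\<And>i. i \<in> keys u \<Longrightarrow> w i = w' i) \<Longrightarrow> frag_eval w u = frag_eval w' u"
  by (simp add: frag_eval_def)

lemma frag_eval_extend: "frag_eval w (frag_extend (\<lambda>i. frag_of (f i)) u) = frag_eval (\<lambda>i. w (f i)) u"
  using subset_UNIV
  by (induction u rule: frag_induction) (auto simp: frag_eval_diff frag_extend_diff)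

lemma frag_eval_diff_fun: "frag_eval (\<lambda>i. w i - w' i) u = frag_eval w u - frag_eval w' u"
  by (simp add: frag_eval_def algebra_simps sum_subtractf)

lemma frag_eval_add_fun: "frag_eval (\<lambda>i. w i + w' i) u = frag_eval w u + frag_eval w' u"
  by (simp add: frag_eval_def algebra_simps sum.distrib)

lemma frag_eval_abs_le:
  "\<bar>frag_eval w u\<bar> \<le> (\<Sum>i\<in>keys u. real_of_int \<bar>Poly_Mapping.lookup u i\<bar> * \<bar>w i\<bar>)"
  unfolding frag_eval_def by (rule order_trans[OF sum_abs]) (simp add: abs_mult)

text \<open>Models the singular simplices of the covering space: \<open>gs\<close> is the deck
  action and \<open>pr\<close> the projection to the base, whose fibres are the orbits. That the
  unit acts trivially follows from \<open>gs_transitive\<close> and \<open>gs_free\<close>.\<close>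

locale free_gset =
  fixes \<Gamma> :: "'g monoid" and S :: "'s set" and gs :: "'g \<Rightarrow> 's \<Rightarrow> 's" and pr :: "'s \<Rightarrow> 't"
  assumes group_\<Gamma>: "group \<Gamma>"
    and gs_closed: "\<lbrakk>g \<in> carrier \<Gamma>; \<sigma> \<in> S\<rbrakk> \<Longrightarrow> gs g \<sigma> \<in> S"
    and gs_pr: "\<lbrakk>g \<in> carrier \<Gamma>; \<sigma> \<in> S\<rbrakk> \<Longrightarrow> pr (gs g \<sigma>) = pr \<sigma>"
    and gs_mult: "\<lbrakk>g \<in> carrier \<Gamma>; h \<in> carrier \<Gamma>; \<sigma> \<in> S\<rbrakk> \<Longrightarrow> gs (g \<otimes>\<^bsub>\<Gamma>\<^esub> h) \<sigma> = gs g (gs h \<sigma>)"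
    and gs_transitive: "\<lbrakk>\<sigma> \<in> S; \<tau> \<in> S; pr \<sigma> = pr \<tau>\<rbrakk> \<Longrightarrow> \<exists>g\<in>carrier \<Gamma>. gs g \<sigma> = \<tau>"
    and gs_free: "\<lbrakk>g \<in> carrier \<Gamma>; \<sigma> \<in> S; gs g \<sigma> = \<sigma>\<rbrakk> \<Longrightarrow> g = \<one>\<^bsub>\<Gamma>\<^esub>"
begin

text \<open>The simplex of each orbit to which all coefficients will be moved.\<close>

definition base :: "'t \<Rightarrow> 's" where
  "base s = (SOME \<sigma>. \<sigma> \<in> S \<and> pr \<sigma> = s)"

text \<open>By freeness, the only group element that carries the base simplex of the orbit to
  \<open>\<tau>\<close>.\<close>

definition shift :: "'s \<Rightarrow> 'g" where
  "shift \<tau> = (SOME g. g \<in> carrier \<Gamma> \<and> gs g (base (pr \<tau>)) = \<tau>)"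

definition chains :: "('s \<Rightarrow>\<^sub>0 int, 'g) gmodule" where
  "chains = with_act (free_Abelian_group S) (\<lambda>g. frag_extend (\<lambda>\<sigma>. frag_of (gs g \<sigma>)))"

lemma base: "s \<in> pr ` S \<Longrightarrow> base s \<in> S \<and> pr (base s) = s"
  unfolding base_def by (rule someI_ex) auto

lemma shift: assumes "\<tau> \<in> S" shows "shift \<tau> \<in> carrier \<Gamma>" "gs (shift \<tau>) (base (pr \<tau>)) = \<tau>"
proof -
  have "\<exists>g. g \<in> carrier \<Gamma> \<and> gs g (base (pr \<tau>)) = \<tau>"
    using gs_transitive[of "base (pr \<tau>)" \<tau>] base[of "pr \<tau>"] assms by auto
  from someI_ex[OF this] show "shift \<tau> \<in> carrier \<Gamma>" "gs (shift \<tau>) (base (pr \<tau>)) = \<tau>"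
    unfolding shift_def by auto
qed

lemma gs_cancel:
  assumes gh: "g \<in> carrier \<Gamma>" "h \<in> carrier \<Gamma>" and \<sigma>: "\<sigma> \<in> S" "gs g \<sigma> = gs h \<sigma>"
  shows "g = h"
proof -
  interpret group \<Gamma> by (rule group_\<Gamma>)
  have "gs (inv\<^bsub>\<Gamma>\<^esub> h \<otimes>\<^bsub>\<Gamma>\<^esub> h) \<sigma> = gs (inv\<^bsub>\<Gamma>\<^esub> h \<otimes>\<^bsub>\<Gamma>\<^esub> g) \<sigma>"
    using gs_mult[OF inv_closed[OF gh(2)] gh(2) \<sigma>(1)] gs_mult[OF inv_closed[OF gh(2)] gh(1) \<sigma>(1)] \<sigma>(2)
    by metis
  \<comment> \<open>Transitivity on the fibre of \<open>\<sigma>\<close> gives an element fixing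
    \<open>\<sigma>\<close>; by freeness this element is the unit.\<close>
  moreover have "gs \<one>\<^bsub>\<Gamma>\<^esub> \<sigma> = \<sigma>"
  proof -
    obtain e where e: "e \<in> carrier \<Gamma>" "gs e \<sigma> = \<sigma>" using gs_transitive[of \<sigma> \<sigma>] \<sigma> by auto
    then show ?thesis using gs_free[OF e(1) \<sigma>(1)] by simp
  qed
  ultimately have "inv\<^bsub>\<Gamma>\<^esub> h \<otimes>\<^bsub>\<Gamma>\<^esub> g = \<one>\<^bsub>\<Gamma>\<^esub>"
    using gs_free[of "inv\<^bsub>\<Gamma>\<^esub> h \<otimes>\<^bsub>\<Gamma>\<^esub> g" \<sigma>] gh \<sigma> by simp
  then show ?thesis
    using gh by (metis inv_closed inv_equality inv_inv)
qed

text \<open>Both elements carry the base simplex of the orbit to \<open>gs g \<tau>\<close>, and the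
  action is free.\<close>

lemma shift_gs:
  assumes "g \<in> carrier \<Gamma>" "\<tau> \<in> S"
  shows "shift (gs g \<tau>) = g \<otimes>\<^bsub>\<Gamma>\<^esub> shift \<tau>"
proof (rule gs_cancel)
  interpret group \<Gamma> by (rule group_\<Gamma>)
  have b: "base (pr \<tau>) \<in> S" using base[of "pr \<tau>"] assms by auto
  then show "base (pr \<tau>) \<in> S" .
  show "gs (shift (gs g \<tau>)) (base (pr \<tau>)) = gs (g \<otimes>\<^bsub>\<Gamma>\<^esub> shift \<tau>) (base (pr \<tau>))"
    using shift[of "gs g \<tau>"] shift[of \<tau>] assms b gs_closed gs_pr gs_mult by simp
  show "shift (gs g \<tau>) \<in> carrier \<Gamma>" "g \<otimes>\<^bsub>\<Gamma>\<^esub> shift \<tau> \<in> carrier \<Gamma>"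
    using shift gs_closed assms by auto
qed

lemma carrier_chains [simp]: "c \<in> carrier chains \<longleftrightarrow> keys c \<subseteq> S"
  and mult_chains [simp]: "c \<otimes>\<^bsub>chains\<^esub> d = c + d"
  and one_chains [simp]: "\<one>\<^bsub>chains\<^esub> = 0"
  and act_chains: "act chains g = frag_extend (\<lambda>\<sigma>. frag_of (gs g \<sigma>))"
  by (simp_all add: chains_def with_act_def free_Abelian_group_def)

lemma keys_act_chains:
  assumes "g \<in> carrier \<Gamma>" "keys c \<subseteq> S"
  shows "keys (act chains g c) \<subseteq> S"
proof -
  have "(\<Union>x\<in>keys c. keys (frag_of (gs g x))) \<subseteq> S"
    using assms gs_closed by auto
  then show ?thesis
    unfolding act_chains by (rule subset_trans[OF keys_frag_extend])
qed

lemma is_gmodule_chains: "is_gmodule \<Gamma> chains"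
  unfolding is_gmodule_def
proof (intro conjI ballI)
  show "comm_group chains"
    using abelian_free_Abelian_group[of S]
    by (simp add: chains_def with_act_def comm_group_def comm_monoid_def comm_monoid_axioms_def
        monoid_def group_def group_axioms_def Units_def)
  show "act chains g \<in> hom chains chains" if "g \<in> carrier \<Gamma>" for g
    using keys_act_chains[OF that] by (auto simp: hom_def) (simp add: act_chains frag_extend_add)
qed

end

section \<open>Coefficient functions over the simplices of the base, and their L1-norms\<close>

locale gset_measure = free_gset \<Gamma> S gs pr for \<Gamma> :: "'g monoid" and S :: "'s set" and gs and pr :: "'s \<Rightarrow> 't" +
  fixes \<nu> :: "'x measure" and \<alpha> :: "'g \<Rightarrow> 'x \<Rightarrow> 'x"
  assumes measurable_\<alpha>: "g \<in> carrier \<Gamma> \<Longrightarrow> \<alpha> g \<in> measurable \<nu> \<nu>"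
    and distr_\<alpha>: "g \<in> carrier \<Gamma> \<Longrightarrow> distr \<nu> \<nu> (\<alpha> g) = \<nu>"
    and \<alpha>_mult: "\<lbrakk>g \<in> carrier \<Gamma>; h \<in> carrier \<Gamma>; x \<in> space \<nu>\<rbrakk> \<Longrightarrow> \<alpha> (g \<otimes>\<^bsub>\<Gamma>\<^esub> h) x = \<alpha> g (\<alpha> h x)"
begin

lemma AE_\<alpha>:
  assumes "AE x in \<nu>. P x" "g \<in> carrier \<Gamma>"
  shows "AE x in \<nu>. P (\<alpha> g x)"
  using AE_distrD[OF measurable_\<alpha>[OF assms(2)], of P] assms(1) unfolding distr_\<alpha>[OF assms(2)] .

lemma integrable_\<alpha>:
  fixes w :: "'x \<Rightarrow> real"
  assumes "integrable \<nu> w" "g \<in> carrier \<Gamma>"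
  shows "integrable \<nu> (\<lambda>x. w (\<alpha> g x))"
  using integrable_distr[OF measurable_\<alpha>[OF assms(2)], of w] assms distr_\<alpha>[of g] by simp

lemma integral_\<alpha>:
  fixes w :: "'x \<Rightarrow> real"
  assumes "integrable \<nu> w" "g \<in> carrier \<Gamma>"
  shows "(\<integral>x. \<bar>w (\<alpha> g x)\<bar> \<partial>\<nu>) = (\<integral>x. \<bar>w x\<bar> \<partial>\<nu>)"
  using integral_distr[OF measurable_\<alpha>[OF assms(2)], of "\<lambda>x. \<bar>w x\<bar>"] assms distr_\<alpha>[of g] by simp

text \<open>Since w \<otimes> \<tau> equals (w . g) \<otimes> (base simplex) for g =
  \<open>shift \<tau>\<close>, this is the value at \<open>x\<close> of the coefficient that w
  \<otimes> c contributes to the base simplex over \<open>s\<close>.\<close>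

definition orb :: "('x \<Rightarrow> real) \<Rightarrow> 't \<Rightarrow> 'x \<Rightarrow> ('s \<Rightarrow>\<^sub>0 int) \<Rightarrow> real" where
  "orb w s x = frag_eval (\<lambda>\<tau>. if pr \<tau> = s then w (\<alpha> (shift \<tau>) x) else 0)"

text \<open>The total coefficient over \<open>s\<close> of a formal sum once every term has been
  moved to a base simplex.\<close>

definition fibre :: "('a \<Rightarrow> 'x \<Rightarrow> real) \<Rightarrow> ('a \<times> ('s \<Rightarrow>\<^sub>0 int) \<Rightarrow>\<^sub>0 int) \<Rightarrow> 't \<Rightarrow> 'x \<Rightarrow> real" where
  "fibre rep u s x = frag_eval (\<lambda>(a, c). orb (rep a) s x c) u"

definition fibres :: "('a \<times> ('s \<Rightarrow>\<^sub>0 int) \<Rightarrow>\<^sub>0 int) \<Rightarrow> 't set" where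
  "fibres u = (\<Union>(a, c)\<in>keys u. pr ` keys c)"

definition fnorm :: "('a \<Rightarrow> 'x \<Rightarrow> real) \<Rightarrow> ('a \<times> ('s \<Rightarrow>\<^sub>0 int) \<Rightarrow>\<^sub>0 int) \<Rightarrow> real" where
  "fnorm rep u = (\<Sum>s\<in>fibres u. \<integral>x. \<bar>fibre rep u s x\<bar> \<partial>\<nu>)"

text \<open>\<open>rep\<close> turns coefficients into real functions. The rules hold almost
  everywhere, because for classes of functions \<open>rep\<close> picks a representative.\<close>

definition represents :: "('a, 'g) gmodule \<Rightarrow> ('a \<Rightarrow> 'x \<Rightarrow> real) \<Rightarrow> bool" where
  "represents A rep \<longleftrightarrow> is_gmodule \<Gamma> A \<and> (\<forall>a\<in>carrier A. integrable \<nu> (rep a)) \<and>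
     (\<forall>a\<in>carrier A. \<forall>b\<in>carrier A. AE x in \<nu>. rep (a \<otimes>\<^bsub>A\<^esub> b) x = rep a x + rep b x) \<and>
     (\<forall>g\<in>carrier \<Gamma>. \<forall>a\<in>carrier A. AE x in \<nu>. rep (act A g a) x = rep a (\<alpha> g x))"

lemma representsD:
  assumes "represents A rep"
  shows "is_gmodule \<Gamma> A" "\<And>a. a \<in> carrier A \<Longrightarrow> integrable \<nu> (rep a)"
    "\<And>a b. \<lbrakk>a \<in> carrier A; b \<in> carrier A\<rbrakk> \<Longrightarrow> AE x in \<nu>. rep (a \<otimes>\<^bsub>A\<^esub> b) x = rep a x + rep b x"
    "\<And>g a. \<lbrakk>g \<in> carrier \<Gamma>; a \<in> carrier A\<rbrakk> \<Longrightarrow> AE x in \<nu>. rep (act A g a) x = rep a (\<alpha> g x)"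
  using assms unfolding represents_def by blast+

lemma finite_fibres [simp]: "finite (fibres u)"
  by (auto simp: fibres_def)

lemma orb_outside: "s \<notin> pr ` keys c \<Longrightarrow> orb w s x c = 0"
  unfolding orb_def frag_eval_def by (rule sum.neutral) auto

lemma fibre_outside: "s \<notin> fibres u \<Longrightarrow> fibre rep u s x = 0"
  unfolding fibre_def frag_eval_def
  by (rule sum.neutral) (auto simp: fibres_def intro!: orb_outside)

text \<open>\<open>fibres\<close> may contain simplices whose coefficients have cancelled, so the
  index set is made flexible: any finite set outside which the fibres vanish will do.\<close>

lemma fnorm_eq_sum:
  assumes "finite T" "\<And>s x. s \<notin> T \<Longrightarrow> fibre rep u s x = 0"
  shows "fnorm rep u = (\<Sum>s\<in>T. \<integral>x. \<bar>fibre rep u s x\<bar> \<partial>\<nu>)"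
proof -
  have "fnorm rep u = (\<Sum>s\<in>T \<union> fibres u. \<integral>x. \<bar>fibre rep u s x\<bar> \<partial>\<nu>)"
    unfolding fnorm_def by (rule sum.mono_neutral_left) (use assms(1) in \<open>auto simp: fibre_outside\<close>)
  also have "\<dots> = (\<Sum>s\<in>T. \<integral>x. \<bar>fibre rep u s x\<bar> \<partial>\<nu>)"
    by (rule sum.mono_neutral_right) (use assms in auto)
  finally show ?thesis .
qed

lemma fnorm_superset:
  "\<lbrakk>finite T; fibres u \<subseteq> T\<rbrakk> \<Longrightarrow> fnorm rep u = (\<Sum>s\<in>T. \<integral>x. \<bar>fibre rep u s x\<bar> \<partial>\<nu>)"
  by (rule fnorm_eq_sum) (auto intro: fibre_outside)

lemma fnorm_nonneg: "fnorm rep u \<ge> 0"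
  unfolding fnorm_def by (intro sum_nonneg) simp

lemma fibre_diff: "fibre rep (u - v) s x = fibre rep u s x - fibre rep v s x"
  and fibre_add: "fibre rep (u + v) s x = fibre rep u s x + fibre rep v s x"
  and fibre_0 [simp]: "fibre rep 0 s x = 0"
  and fibre_of [simp]: "fibre rep (frag_of (a, c)) s x = orb (rep a) s x c"
  by (simp_all add: fibre_def frag_eval_diff frag_eval_add)

lemma orb_add: "orb w s x (c + d) = orb w s x c + orb w s x d"
  by (simp_all add: orb_def frag_eval_add)

lemma orb_diff_fun: "orb (\<lambda>x. w x - w' x) s x c = orb w s x c - orb w' s x c"
  unfolding orb_def frag_eval_diff_fun[symmetric] by (rule frag_eval_cong) auto

lemma orb_add_fun: "orb (\<lambda>x. w x + w' x) s x c = orb w s x c + orb w' s x c"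
  unfolding orb_def frag_eval_add_fun[symmetric] by (rule frag_eval_cong) auto

lemma integrable_orb:
  assumes "integrable \<nu> w" "keys c \<subseteq> S"
  shows "integrable \<nu> (\<lambda>x. orb w s x c)"
proof -
  have "integrable \<nu> (\<lambda>x. if pr \<tau> = s then w (\<alpha> (shift \<tau>) x) else 0)" if "\<tau> \<in> keys c" for \<tau>
    using integrable_\<alpha>[OF assms(1) shift(1), of \<tau>] that assms(2) by (cases "pr \<tau> = s") auto
  then show ?thesis
    unfolding orb_def frag_eval_def
    by (intro Bochner_Integration.integrable_sum Bochner_Integration.integrable_mult_right)
qed

lemma orb_AE_cong:
  assumes "AE x in \<nu>. w x = w' x" "keys c \<subseteq> S"
  shows "AE x in \<nu>. orb w s x c = orb w' s x c"
proof -
  have "AE x in \<nu>. \<forall>\<tau>\<in>keys c. w (\<alpha> (shift \<tau>) x) = w' (\<alpha> (shift \<tau>) x)"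
    by (rule AE_finite_allI) (use AE_\<alpha>[OF assms(1)] shift(1) assms(2) in auto)
  then show ?thesis
    by eventually_elim (auto simp: orb_def intro!: frag_eval_cong)
qed

text \<open>By \<open>shift_gs\<close> the translated simplex has \<open>g\<close> times the old
  shift; by \<open>\<alpha>_mult\<close> this amounts to applying \<open>\<alpha> g\<close> before
  \<open>w\<close>.\<close>

lemma orb_act:
  assumes "g \<in> carrier \<Gamma>" "keys c \<subseteq> S" "x \<in> space \<nu>"
  shows "orb w s x (act chains g c) = orb (\<lambda>x. w (\<alpha> g x)) s x c"
  unfolding orb_def act_chains frag_eval_extend
  by (rule frag_eval_cong) (use assms shift gs_pr shift_gs \<alpha>_mult in \<open>auto simp: subset_iff\<close>)

text \<open>This makes \<open>fnorm\<close> a function on the tensor product: left relations vanish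
  by additivity of \<open>rep\<close>, right ones by additivity of \<open>orb\<close>, those of the
  action by \<open>orb_act\<close>, each up to a null set.\<close>

lemma fibre_relations:
  assumes rA: "represents A rep" and r: "r \<in> tensor_relations \<Gamma> A chains"
  shows "AE x in \<nu>. fibre rep r s x = 0"
proof -
  interpret gmodule_pair \<Gamma> A chains
    by unfold_locales (use rA is_gmodule_chains in \<open>auto simp: represents_def\<close>)
  show ?thesis
    using r
  proof (induction r rule: relations_induct)
    case zero
    then show ?case by simp
  next
    case (diff r t)
    then show ?case by eventually_elim (simp add: fibre_diff)
  next
    case (left a b c)
    then have "AE x in \<nu>. rep (a \<otimes>\<^bsub>A\<^esub> b) x = rep a x + rep b x" using representsD(3)[OF rA] by blast
    then have "AE x in \<nu>. orb (rep (a \<otimes>\<^bsub>A\<^esub> b)) s x c = orb (\<lambda>x. rep a x + rep b x) s x c"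
      by (rule orb_AE_cong) (use left in simp)
    then show ?case by eventually_elim (simp add: fibre_diff orb_add_fun)
  next
    case (right a c d)
    then show ?case by (simp add: fibre_diff orb_add)
  next
    case (act g a c)
    then have "AE x in \<nu>. rep (act A g a) x = rep a (\<alpha> g x)" using representsD(4)[OF rA] by blast
    then have "AE x in \<nu>. orb (rep (act A g a)) s x c = orb (\<lambda>x. rep a (\<alpha> g x)) s x c"
      by (rule orb_AE_cong) (use act in simp)
    then show ?case using AE_space
      by eventually_elim (use act in \<open>simp add: fibre_diff orb_act\<close>)
  qed
qed

lemma integrable_fibre:
  assumes A: "represents A rep" and u: "keys u \<subseteq> carrier A \<times> carrier chains"
  shows "integrable \<nu> (fibre rep u s)"
  using u
proof (induction u rule: frag_induction)
  case (one x)
  then show ?case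
    using representsD(2)[OF A] by (cases x) (auto intro!: integrable_orb)
qed (simp_all add: fibre_diff[abs_def] fibre_0[abs_def])

text \<open>Two coefficient modules are allowed, for the comparison of a strict chain with its image
  over the essentially bounded classes.\<close>

lemma fnorm_AE_cong:
  assumes "\<And>s. integrable \<nu> (fibre rep u s)" "\<And>s. integrable \<nu> (fibre rep' v s)"
    and "\<And>s. AE x in \<nu>. fibre rep u s x = fibre rep' v s x"
  shows "fnorm rep u = fnorm rep' v"
proof -
  let ?T = "fibres u \<union> fibres v"
  have "(\<integral>x. \<bar>fibre rep u s x\<bar> \<partial>\<nu>) = (\<integral>x. \<bar>fibre rep' v s x\<bar> \<partial>\<nu>)" for s
  proof (rule integral_cong_AE)
    show "(\<lambda>x. \<bar>fibre rep u s x\<bar>) \<in> borel_measurable \<nu>" "(\<lambda>x. \<bar>fibre rep' v s x\<bar>) \<in> borel_measurable \<nu>"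
      using assms(1,2)[of s] by (auto intro: borel_measurable_integrable integrable_abs)
    show "AE x in \<nu>. \<bar>fibre rep u s x\<bar> = \<bar>fibre rep' v s x\<bar>"
      using assms(3)[of s] by eventually_elim simp
  qed
  then show ?thesis
    by (simp add: fnorm_superset[of ?T])
qed

lemma fnorm_cong:
  assumes A: "represents A rep" and r: "u - v \<in> tensor_relations \<Gamma> A chains"
    and u: "keys u \<subseteq> carrier A \<times> carrier chains"
    and v: "keys v \<subseteq> carrier A \<times> carrier chains"
  shows "fnorm rep u = fnorm rep v"
proof (rule fnorm_AE_cong)
  show "AE x in \<nu>. fibre rep u s x = fibre rep v s x" for s
    using fibre_relations[OF A r, of s] by eventually_elim (simp add: fibre_diff)
qed (use integrable_fibre[OF A] u v in auto)

lemma fnorm_diff_le: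
  assumes A: "represents A rep"
    and u: "keys u \<subseteq> carrier A \<times> carrier chains"
    and v: "keys v \<subseteq> carrier A \<times> carrier chains"
  shows "fnorm rep (u - v) \<le> fnorm rep u + fnorm rep v"
proof -
  let ?T = "fibres u \<union> fibres v"
  have "fnorm rep (u - v) = (\<Sum>s\<in>?T. \<integral>x. \<bar>fibre rep (u - v) s x\<bar> \<partial>\<nu>)"
    by (rule fnorm_eq_sum) (auto simp: fibre_diff fibre_outside)
  also have "\<dots> \<le> (\<Sum>s\<in>?T. (\<integral>x. \<bar>fibre rep u s x\<bar> \<partial>\<nu>) + (\<integral>x. \<bar>fibre rep v s x\<bar> \<partial>\<nu>))"
  proof (rule sum_mono)
    fix s
    note i = integrable_fibre[OF A u, of s] integrable_fibre[OF A v, of s]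
    have "(\<integral>x. \<bar>fibre rep (u - v) s x\<bar> \<partial>\<nu>) \<le> (\<integral>x. \<bar>fibre rep u s x\<bar> + \<bar>fibre rep v s x\<bar> \<partial>\<nu>)"
      by (rule integral_mono) (use i in \<open>auto simp: fibre_diff\<close>)
    also have "\<dots> = (\<integral>x. \<bar>fibre rep u s x\<bar> \<partial>\<nu>) + (\<integral>x. \<bar>fibre rep v s x\<bar> \<partial>\<nu>)"
      by (rule Bochner_Integration.integral_add) (use i in auto)
    finally show "(\<integral>x. \<bar>fibre rep (u - v) s x\<bar> \<partial>\<nu>) \<le> (\<integral>x. \<bar>fibre rep u s x\<bar> \<partial>\<nu>) + (\<integral>x. \<bar>fibre rep v s x\<bar> \<partial>\<nu>)" .
  qed
  also have "\<dots> = fnorm rep u + fnorm rep v"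
    by (simp add: sum.distrib fnorm_superset[of ?T])
  finally show ?thesis .
qed

lemma fnorm_0 [simp]: "fnorm rep 0 = 0"
  by (simp add: fnorm_def)

lemma fnorm_minus: "fnorm rep (- u) = fnorm rep u"
proof -
  have "fibre rep (- u) s x = - fibre rep u s x" for s x
    using fibre_diff[of rep 0 u s x] by simp
  then show ?thesis
    using fnorm_eq_sum[of "fibres u" rep "- u"] by (simp add: fnorm_def fibre_outside)
qed

lemma fnorm_add_le:
  assumes "represents A rep" "keys u \<subseteq> carrier A \<times> carrier chains"
    "keys v \<subseteq> carrier A \<times> carrier chains"
  shows "fnorm rep (u + v) \<le> fnorm rep u + fnorm rep v"
  using fnorm_diff_le[of A rep u "- v"] assms by (simp add: fnorm_minus)

text \<open>Each simplex of \<open>c\<close> contributes at most its absolute multiplicity times the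
  L1-norm of \<open>w\<close>, because \<open>\<nu>\<close> is invariant under the shifts. The
  condition \<open>eq\<close> admits a single tensor as well as a difference of two tensors with the
  same chain.\<close>

lemma fnorm_orb_le:
  assumes w: "integrable \<nu> w" and c: "keys c \<subseteq> S" and eq: "\<And>s x. fibre rep u s x = orb w s x c"
  shows "fnorm rep u \<le> real_of_int (\<Sum>\<tau>\<in>keys c. \<bar>Poly_Mapping.lookup c \<tau>\<bar>) * (\<integral>x. \<bar>w x\<bar> \<partial>\<nu>)"
proof -
  let ?K = "keys c" and ?T = "pr ` keys c"
  let ?L = "\<lambda>\<tau>. real_of_int \<bar>Poly_Mapping.lookup c \<tau>\<bar>"
  have i: "integrable \<nu> (\<lambda>x. ?L \<tau> * \<bar>w (\<alpha> (shift \<tau>) x)\<bar>)" if "\<tau> \<in> ?K" for \<tau>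
    using integrable_\<alpha>[OF w shift(1), of \<tau>] that c
    by (intro Bochner_Integration.integrable_mult_right Bochner_Integration.integrable_abs) auto
  have "fnorm rep u = (\<Sum>s\<in>?T. \<integral>x. \<bar>orb w s x c\<bar> \<partial>\<nu>)"
    using fnorm_eq_sum[of ?T rep u] by (simp add: eq orb_outside)
  also have "\<dots> \<le> (\<Sum>s\<in>?T. \<Sum>\<tau>\<in>{\<tau>\<in>?K. pr \<tau> = s}. ?L \<tau> * (\<integral>x. \<bar>w x\<bar> \<partial>\<nu>))"
  proof (rule sum_mono)
    fix s
    have "(\<integral>x. \<bar>orb w s x c\<bar> \<partial>\<nu>) \<le> (\<integral>x. (\<Sum>\<tau>\<in>{\<tau>\<in>?K. pr \<tau> = s}. ?L \<tau> * \<bar>w (\<alpha> (shift \<tau>) x)\<bar>) \<partial>\<nu>)"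
    proof (rule integral_mono)
      show "integrable \<nu> (\<lambda>x. \<bar>orb w s x c\<bar>)" using integrable_orb[OF w c] by auto
      show "integrable \<nu> (\<lambda>x. \<Sum>\<tau>\<in>{\<tau>\<in>?K. pr \<tau> = s}. ?L \<tau> * \<bar>w (\<alpha> (shift \<tau>) x)\<bar>)"
        using i by (intro Bochner_Integration.integrable_sum) auto
      fix x
      have "\<bar>orb w s x c\<bar> \<le> (\<Sum>\<tau>\<in>?K. ?L \<tau> * \<bar>if pr \<tau> = s then w (\<alpha> (shift \<tau>) x) else 0\<bar>)"
        unfolding orb_def by (rule frag_eval_abs_le)
      also have "\<dots> = (\<Sum>\<tau>\<in>{\<tau>\<in>?K. pr \<tau> = s}. ?L \<tau> * \<bar>w (\<alpha> (shift \<tau>) x)\<bar>)"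
        by (rule sum.mono_neutral_cong_right) auto
      finally show "\<bar>orb w s x c\<bar> \<le> (\<Sum>\<tau>\<in>{\<tau>\<in>?K. pr \<tau> = s}. ?L \<tau> * \<bar>w (\<alpha> (shift \<tau>) x)\<bar>)" .
    qed
    also have "\<dots> = (\<Sum>\<tau>\<in>{\<tau>\<in>?K. pr \<tau> = s}. \<integral>x. ?L \<tau> * \<bar>w (\<alpha> (shift \<tau>) x)\<bar> \<partial>\<nu>)"
      by (rule Bochner_Integration.integral_sum) (use i in auto)
    also have "\<dots> = (\<Sum>\<tau>\<in>{\<tau>\<in>?K. pr \<tau> = s}. ?L \<tau> * (\<integral>x. \<bar>w x\<bar> \<partial>\<nu>))"
      by (rule sum.cong) (use integral_\<alpha>[OF w shift(1)] c in auto)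
    finally show "(\<integral>x. \<bar>orb w s x c\<bar> \<partial>\<nu>) \<le> (\<Sum>\<tau>\<in>{\<tau>\<in>?K. pr \<tau> = s}. ?L \<tau> * (\<integral>x. \<bar>w x\<bar> \<partial>\<nu>))" .
  qed
  \<comment> \<open>Every simplex of \<open>c\<close> lies over exactly one \<open>s\<close>, so the
    double sum meets it once.\<close>
  also have "\<dots> = (\<Sum>\<tau>\<in>?K. ?L \<tau> * (\<integral>x. \<bar>w x\<bar> \<partial>\<nu>))"
    by (rule sum.group) auto
  finally show ?thesis by (simp add: sum_distrib_right)
qed

lemma fnorm_of_le:
  assumes "represents A rep" "a \<in> carrier A" "keys c \<subseteq> S"
  shows "fnorm rep (frag_of (a, c)) \<le>
    real_of_int (\<Sum>\<tau>\<in>keys c. \<bar>Poly_Mapping.lookup c \<tau>\<bar>) * (\<integral>x. \<bar>rep a x\<bar> \<partial>\<nu>)"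
  by (rule fnorm_orb_le) (use assms representsD(2)[OF assms(1)] in auto)

lemma fnorm_of_diff_le:
  assumes "represents A rep" "a \<in> carrier A" "b \<in> carrier A" "keys c \<subseteq> S"
  shows "fnorm rep (frag_of (a, c) - frag_of (b, c)) \<le>
    real_of_int (\<Sum>\<tau>\<in>keys c. \<bar>Poly_Mapping.lookup c \<tau>\<bar>) * (\<integral>x. \<bar>rep a x - rep b x\<bar> \<partial>\<nu>)"
  by (rule fnorm_orb_le) (use assms representsD(2)[OF assms(1)] in \<open>auto simp: fibre_diff orb_diff_fun\<close>)

lemma keys_sum_frag_of:
  assumes "\<And>j. j \<in> J \<Longrightarrow> x j \<in> K"
  shows "keys (\<Sum>j\<in>J. frag_of (x j)) \<subseteq> K"
  using sum_closed_free_Abelian_group[of J "\<lambda>j. frag_of (x j)" K] assms by simp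

lemma fnorm_sum_le:
  assumes A: "represents A rep" and J: "finite J"
    and f: "\<And>j. j \<in> J \<Longrightarrow> f j \<in> carrier A" "\<And>j. j \<in> J \<Longrightarrow> keys (c j) \<subseteq> S"
  shows "fnorm rep (\<Sum>j\<in>J. frag_of (f j, c j)) \<le>
    (\<Sum>j\<in>J. real_of_int (\<Sum>\<tau>\<in>keys (c j). \<bar>Poly_Mapping.lookup (c j) \<tau>\<bar>) * (\<integral>x. \<bar>rep (f j) x\<bar> \<partial>\<nu>))"
  using J f
proof (induction J rule: finite_induct)
  case (insert j J)
  have "fnorm rep (frag_of (f j, c j) + (\<Sum>j\<in>J. frag_of (f j, c j))) \<le>
      fnorm rep (frag_of (f j, c j)) + fnorm rep (\<Sum>j\<in>J. frag_of (f j, c j))"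
    by (rule fnorm_add_le[OF A]; (rule keys_sum_frag_of)?) (use insert.prems in auto)
  then show ?case
    using insert fnorm_of_le[OF A, of "f j" "c j"] by simp
qed simp

text \<open>With distinct projections each fibre has a single summand, so nothing cancels, and
  invariance of \<open>\<nu>\<close> removes the shift.\<close>

lemma fnorm_reduced:
  assumes A: "represents A rep" and J: "finite J" "inj_on (\<lambda>j. pr (\<sigma> j)) J"
    and f: "\<And>j. j \<in> J \<Longrightarrow> f j \<in> carrier A" "\<And>j. j \<in> J \<Longrightarrow> \<sigma> j \<in> S"
  shows "fnorm rep (\<Sum>j\<in>J. frag_of (f j, frag_of (\<sigma> j))) = (\<Sum>j\<in>J. \<integral>x. \<bar>rep (f j) x\<bar> \<partial>\<nu>)"
proof -
  let ?u = "\<Sum>j\<in>J. frag_of (f j, frag_of (\<sigma> j))"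
  have fib: "fibre rep ?u s x = (\<Sum>j\<in>J. if pr (\<sigma> j) = s then rep (f j) (\<alpha> (shift (\<sigma> j)) x) else 0)" for s x
    unfolding fibre_def by (simp add: frag_eval_sum[OF J(1)] orb_def)
  have fibj: "fibre rep ?u (pr (\<sigma> j)) x = rep (f j) (\<alpha> (shift (\<sigma> j)) x)" if j: "j \<in> J" for j x
  proof -
    have "fibre rep ?u (pr (\<sigma> j)) x = (\<Sum>i\<in>J. if i = j then rep (f i) (\<alpha> (shift (\<sigma> i)) x) else 0)"
      unfolding fib by (rule sum.cong) (use J(2) j in \<open>auto dest: inj_onD\<close>)
    then show ?thesis using j J(1) by simp
  qed
  have "fnorm rep ?u = (\<Sum>s\<in>(\<lambda>j. pr (\<sigma> j)) ` J. \<integral>x. \<bar>fibre rep ?u s x\<bar> \<partial>\<nu>)"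
    by (rule fnorm_eq_sum) (use J in \<open>auto simp: fib intro!: sum.neutral\<close>)
  also have "\<dots> = (\<Sum>j\<in>J. \<integral>x. \<bar>fibre rep ?u (pr (\<sigma> j)) x\<bar> \<partial>\<nu>)"
    by (simp add: sum.reindex[OF J(2)])
  also have "\<dots> = (\<Sum>j\<in>J. \<integral>x. \<bar>rep (f j) x\<bar> \<partial>\<nu>)"
    by (rule sum.cong) (use integral_\<alpha>[OF representsD(2)[OF A] shift(1)] f in \<open>auto simp: fibj\<close>)
  finally show ?thesis .
qed

end

section \<open>Existence of reduced forms\<close>

lemma (in gmodule_pair) relations_sum: "(\<And>i. i \<in> I \<Longrightarrow> f i \<in> R) \<Longrightarrow> (\<Sum>i\<in>I. f i) \<in> R"
  by (induction I rule: infinite_finite_induct) (auto intro: relations_add)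

text \<open>Being congruent to a sum over distinct base simplices passes to congruent formal sums
  and to differences, so it suffices to treat a coefficient with one simplex, which is moved to the
  base simplex of its orbit.\<close>

lemma (in free_gset) reduced_representative:
  assumes A: "is_gmodule \<Gamma> A" and u: "keys u \<subseteq> carrier A \<times> carrier chains"
  obtains T a where "finite T" "T \<subseteq> pr ` S" "\<And>s. s \<in> T \<Longrightarrow> a s \<in> carrier A"
    "u - (\<Sum>s\<in>T. frag_of (a s, frag_of (base s))) \<in> tensor_relations \<Gamma> A chains"
proof -
  interpret gmodule_pair \<Gamma> A chains by unfold_locales (use A is_gmodule_chains in auto)
  interpret A: comm_group A using A by (simp add: is_gmodule_def)
  define red where "red = (\<lambda>u. \<exists>T a. finite T \<and> T \<subseteq> pr ` S \<and> (\<forall>s\<in>T. a s \<in> carrier A) \<and>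
    u - (\<Sum>s\<in>T. frag_of (a s, frag_of (base s))) \<in> R)"
  have red_cong: "red u" if "u - v \<in> R" "red v" for u v
  proof -
    obtain T a where T: "finite T" "T \<subseteq> pr ` S" "\<forall>s\<in>T. a s \<in> carrier A"
      "v - (\<Sum>s\<in>T. frag_of (a s, frag_of (base s))) \<in> R" using \<open>red v\<close> unfolding red_def by blast
    have "u - (\<Sum>s\<in>T. frag_of (a s, frag_of (base s))) \<in> R"
      using relations_add[OF \<open>u - v \<in> R\<close> T(4)] by simp
    then show ?thesis using T unfolding red_def by blast
  qed
  have red_diff: "red (u - v)" if uv: "red u" "red v" for u v
  proof -
    obtain T a where T: "finite T" "T \<subseteq> pr ` S" "\<forall>s\<in>T. a s \<in> carrier A"
      "u - (\<Sum>s\<in>T. frag_of (a s, frag_of (base s))) \<in> R" using uv(1) unfolding red_def by blast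
    obtain T' b where T': "finite T'" "T' \<subseteq> pr ` S" "\<forall>s\<in>T'. b s \<in> carrier A"
      "v - (\<Sum>s\<in>T'. frag_of (b s, frag_of (base s))) \<in> R" using uv(2) unfolding red_def by blast
    \<comment> \<open>Pads an expression with unit coefficients up to the common index set.\<close>
    have ext: "w - (\<Sum>s\<in>T \<union> T'. frag_of (if s \<in> Q then d s else \<one>\<^bsub>A\<^esub>, frag_of (base s))) \<in> R"
      if "Q \<subseteq> T \<union> T'" "w - (\<Sum>s\<in>Q. frag_of (d s, frag_of (base s))) \<in> R" for w Q d
    proof -
      let ?e = "\<lambda>s. frag_of (if s \<in> Q then d s else \<one>\<^bsub>A\<^esub>, frag_of (base s))"
      have e1: "sum ?e (T \<union> T') = sum ?e (T \<union> T' - Q) + sum ?e Q"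
        by (rule sum.subset_diff[OF that(1)]) (use T T' in simp)
      have e2: "sum ?e Q = (\<Sum>s\<in>Q. frag_of (d s, frag_of (base s)))"
        by (rule sum.cong) auto
      have e3: "w - (X + Y) = w - Y - X" for X Y :: "'a \<times> ('s \<Rightarrow>\<^sub>0 int) \<Rightarrow>\<^sub>0 int"
        by (simp add: algebra_simps)
      have "sum ?e (T \<union> T' - Q) \<in> R"
        by (rule relations_sum) (use T(2) T'(2) base in \<open>auto intro!: relations_left_0\<close>)
      from relations_diff[OF that(2) this] show ?thesis
        by (simp only: e1 e2 e3)
    qed
    define a' where "a' = (\<lambda>s. if s \<in> T then a s else \<one>\<^bsub>A\<^esub>)"
    define b' where "b' = (\<lambda>s. if s \<in> T' then b s else \<one>\<^bsub>A\<^esub>)"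
    have ab: "a' s \<in> carrier A" "b' s \<in> carrier A" for s using T(3) T'(3) by (auto simp: a'_def b'_def)
    have 1: "u - (\<Sum>s\<in>T \<union> T'. frag_of (a' s, frag_of (base s))) \<in> R"
      "v - (\<Sum>s\<in>T \<union> T'. frag_of (b' s, frag_of (base s))) \<in> R"
      unfolding a'_def b'_def by (rule ext; use T(4) T'(4) in simp)+
    have "frag_of (a' s, frag_of (base s)) - frag_of (a' s \<otimes>\<^bsub>A\<^esub> inv\<^bsub>A\<^esub> b' s, frag_of (base s))
        - frag_of (b' s, frag_of (base s)) \<in> R" if "s \<in> T \<union> T'" for s
    proof -
      have "base s \<in> S" using base that T(2) T'(2) by blast
      then show ?thesis
        using relations_left[of "a' s \<otimes>\<^bsub>A\<^esub> inv\<^bsub>A\<^esub> b' s" "b' s" "frag_of (base s)"] ab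
        by (simp add: A.m_assoc)
    qed
    then have ab3: "(\<Sum>s\<in>T \<union> T'. frag_of (a' s, frag_of (base s)) - frag_of (a' s \<otimes>\<^bsub>A\<^esub> inv\<^bsub>A\<^esub> b' s, frag_of (base s))
        - frag_of (b' s, frag_of (base s))) \<in> R"
      by (rule relations_sum)
    \<comment> \<open>Splits the difference into the two given reductions and the summed left
      relations that decompose each \<open>a' s\<close> into the quotient by \<open>b' s\<close> and
      \<open>b' s\<close> itself.\<close>
    have ab4: "(u - v) - Z = ((u - X) - (v - Y)) + (X - Z - Y)" for X Y Z by simp
    have "(u - v) - (\<Sum>s\<in>T \<union> T'. frag_of (a' s \<otimes>\<^bsub>A\<^esub> inv\<^bsub>A\<^esub> b' s, frag_of (base s))) \<in> R"
      unfolding ab4[of _ "\<Sum>s\<in>T \<union> T'. frag_of (a' s, frag_of (base s))" "\<Sum>s\<in>T \<union> T'. frag_of (b' s, frag_of (base s))"]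
      by (rule relations_add[OF relations_diff[OF 1] ab3[unfolded sum_subtractf]])
    then show ?thesis
      unfolding red_def using T(1,2) T'(1,2) ab
      by (intro exI[of _ "T \<union> T'"] exI[of _ "\<lambda>s. a' s \<otimes>\<^bsub>A\<^esub> inv\<^bsub>A\<^esub> b' s"]) auto
  qed
  have red_0: "red 0"
    unfolding red_def by (rule exI[of _ "{}"]) auto
  have red_of: "red (frag_of (a, c))" if a: "a \<in> carrier A" and c: "keys c \<subseteq> S" for a c
    using c
  proof (induction c rule: free_Abelian_group_induct[consumes 1, case_names zero diff one])
    case zero
    then show ?case using red_cong[OF _ red_0] relations_right_0[OF a] by simp
  next
    case (one \<tau>)
    have b: "base (pr \<tau>) \<in> S" using base[of "pr \<tau>"] one by auto
    \<comment> \<open>The action relation brings \<open>\<tau>\<close> to the base simplex at the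
      price of acting on \<open>a\<close>.\<close>
    have "frag_of (act A (shift \<tau>) a, frag_of (base (pr \<tau>))) - frag_of (a, act chains (shift \<tau>) (frag_of (base (pr \<tau>)))) \<in> R"
      by (rule relations_act) (use shift(1)[OF one] a b in auto)
    then have "frag_of (a, frag_of \<tau>) - frag_of (act A (shift \<tau>) a, frag_of (base (pr \<tau>))) \<in> R"
      using relations_minus shift(2)[OF one] by (fastforce simp: act_chains)
    then show ?case
      unfolding red_def using one is_gmoduleD(5)[OF A shift(1)[OF one] a]
      by (intro exI[of _ "{pr \<tau>}"] exI[of _ "\<lambda>_. act A (shift \<tau>) a"]) auto
  next
    case (diff c d)
    \<comment> \<open>The induction on chains runs over differences, so right additivity is used for
      \<open>c = (c - d) + d\<close>.\<close>
    have "frag_of (a, (c - d) + d) - frag_of (a, c - d) - frag_of (a, d) \<in> R"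
      using relations_right[of a "c - d" d] a diff(1,2) keys_diff_subset[OF diff(1,2)] by simp
    then have "- (frag_of (a, c) - frag_of (a, c - d) - frag_of (a, d)) \<in> R"
      using relations_minus by fastforce
    then have "frag_of (a, c - d) - (frag_of (a, c) - frag_of (a, d)) \<in> R" by (simp add: algebra_simps)
    then show ?case using red_cong red_diff[OF diff(3,4)] by blast
  qed
  have "red u"
    using u
  proof (induction u rule: frag_induction)
    case (one x)
    then show ?case using red_of by (cases x) auto
  qed (auto intro: red_0 red_diff)
  then show ?thesis using that unfolding red_def by blast
qed

section \<open>Coefficient modules\<close>

lemma with_act_simps [simp]:
  "carrier (with_act A r) = carrier A" "monoid.mult (with_act A r) = monoid.mult A"
  "one (with_act A r) = one A" "act (with_act A r) = r"
  by (simp_all add: with_act_def)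

text \<open>The group axioms see only carrier, multiplication and unit, so they pass between records
  with and without an \<open>act\<close> field.\<close>

lemma comm_group_same_structure:
  assumes "comm_group A" "carrier B = carrier A" "monoid.mult B = monoid.mult A" "one B = one A"
  shows "comm_group B"
  using assms(1)
  unfolding comm_group_def comm_monoid_def comm_monoid_axioms_def
    monoid_def group_def group_axioms_def Units_def assms(2-4) .

section \<open>Function modules over a space with an invariant probability measure\<close>

locale measure_action =
  fixes \<Gamma> :: "'g monoid" and \<alpha> :: "'g \<Rightarrow> 'x \<Rightarrow> 'x" and \<nu> :: "'x measure"
  assumes action: "group_action \<Gamma> (space \<nu>) \<alpha>"
    and measurable: "g \<in> carrier \<Gamma> \<Longrightarrow> \<alpha> g \<in> measurable \<nu> \<nu>"
    and distr: "g \<in> carrier \<Gamma> \<Longrightarrow> distr \<nu> \<nu> (\<alpha> g) = \<nu>"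
    and prob: "prob_space \<nu>"
begin

sublocale prob_space \<nu> by (rule prob)

abbreviation "B \<equiv> bounded_module \<nu> \<alpha>"
abbreviation "E \<equiv> ess_bounded_module \<nu> \<alpha>"
abbreviation "N \<equiv> null_functions \<nu>"
abbreviation "L \<equiv> Linf_module \<nu> \<alpha>"

lemma function_module_simps [simp]:
  "carrier (function_module \<nu> \<alpha> F) = F"
  "f \<otimes>\<^bsub>function_module \<nu> \<alpha> F\<^esub> h = (\<lambda>x. f x + h x)"
  "one (function_module \<nu> \<alpha> F) = (\<lambda>x. 0)"
  "act (function_module \<nu> \<alpha> F) g f = (\<lambda>x. if x \<in> space \<nu> then f (\<alpha> g x) else 0)"
  by (simp_all add: function_module_def)

lemma space_\<alpha>: "\<lbrakk>g \<in> carrier \<Gamma>; x \<in> space \<nu>\<rbrakk> \<Longrightarrow> \<alpha> g x \<in> space \<nu>"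
  using measurable by (auto simp: measurable_def)

lemma is_gmodule_function_module:
  assumes "(\<lambda>x. 0) \<in> F" "\<And>f h. \<lbrakk>f \<in> F; h \<in> F\<rbrakk> \<Longrightarrow> (\<lambda>x. f x + h x) \<in> F" "\<And>f. f \<in> F \<Longrightarrow> (\<lambda>x. - f x) \<in> F"
    "\<And>g f. \<lbrakk>g \<in> carrier \<Gamma>; f \<in> F\<rbrakk> \<Longrightarrow> (\<lambda>x. if x \<in> space \<nu> then f (\<alpha> g x) else 0) \<in> F"
  shows "is_gmodule \<Gamma> (function_module \<nu> \<alpha> F)"
  unfolding is_gmodule_def
proof (intro conjI ballI)
  show "comm_group (function_module \<nu> \<alpha> F)"
  proof (rule comm_groupI)
    show "\<exists>h\<in>carrier (function_module \<nu> \<alpha> F). h \<otimes>\<^bsub>function_module \<nu> \<alpha> F\<^esub> f = \<one>\<^bsub>function_module \<nu> \<alpha> F\<^esub>"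
      if "f \<in> carrier (function_module \<nu> \<alpha> F)" for f
      by (rule bexI[of _ "\<lambda>x. - f x"]) (use assms that in simp_all)
  qed (use assms in \<open>simp_all add: ac_simps\<close>)
  show "act (function_module \<nu> \<alpha> F) g \<in> hom (function_module \<nu> \<alpha> F) (function_module \<nu> \<alpha> F)"
    if "g \<in> carrier \<Gamma>" for g
    using assms(4)[OF that] by (auto simp: hom_def)
qed

lemma inv_function_module:
  assumes "group (function_module \<nu> \<alpha> F)" "f \<in> F" "(\<lambda>x. - f x) \<in> F"
  shows "inv\<^bsub>function_module \<nu> \<alpha> F\<^esub> f = (\<lambda>x. - f x)"
  by (rule group.inv_equality[OF assms(1)]) (use assms in auto)

lemma B_iff: "f \<in> carrier B \<longleftrightarrow> f \<in> measurable \<nu> (count_space UNIV) \<and>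
    (\<forall>x. x \<notin> space \<nu> \<longrightarrow> f x = 0) \<and> (\<exists>b. \<forall>x\<in>space \<nu>. \<bar>f x\<bar> \<le> b)"
  by (simp add: bounded_module_def)

lemma E_iff: "f \<in> carrier E \<longleftrightarrow> f \<in> measurable \<nu> (count_space UNIV) \<and>
    (\<forall>x. x \<notin> space \<nu> \<longrightarrow> f x = 0) \<and> (\<exists>b. AE x in \<nu>. \<bar>f x\<bar> \<le> b)"
  by (simp add: ess_bounded_module_def)

lemma N_iff: "f \<in> N \<longleftrightarrow> f \<in> measurable \<nu> (count_space UNIV) \<and>
    (\<forall>x. x \<notin> space \<nu> \<longrightarrow> f x = 0) \<and> (AE x in \<nu>. f x = 0)"
  by (simp add: null_functions_def)

lemma measurable_precompose:
  assumes "f \<in> measurable \<nu> (count_space UNIV)" "g \<in> carrier \<Gamma>"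
  shows "(\<lambda>x. if x \<in> space \<nu> then f (\<alpha> g x) else 0) \<in> measurable \<nu> (count_space UNIV)"
  using measurable_compose[OF measurable[OF assms(2)] assms(1)]
  by (subst measurable_cong[where g = "\<lambda>x. f (\<alpha> g x)"]) auto

lemma AE_precompose:
  assumes "AE x in \<nu>. P x" "g \<in> carrier \<Gamma>"
  shows "AE x in \<nu>. P (\<alpha> g x)"
  using AE_distrD[OF measurable[OF assms(2)], of P] assms(1) unfolding distr[OF assms(2)] .

lemma is_gmodule_B: "is_gmodule \<Gamma> B"
  unfolding bounded_module_def
proof (rule is_gmodule_function_module, goal_cases)
  case (2 f h)
  then obtain b c where "\<forall>x\<in>space \<nu>. \<bar>f x\<bar> \<le> b" "\<forall>x\<in>space \<nu>. \<bar>h x\<bar> \<le> c" by auto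
  then have "\<forall>x\<in>space \<nu>. \<bar>f x + h x\<bar> \<le> b + c" by (meson abs_triangle_ineq add_mono order_trans)
  then show ?case using 2 by auto
next
  case (4 g f)
  then obtain b where "\<forall>x\<in>space \<nu>. \<bar>f x\<bar> \<le> b" by auto
  then have "\<forall>x\<in>space \<nu>. \<bar>f (\<alpha> g x)\<bar> \<le> b" using space_\<alpha>[OF 4(1)] by blast
  then show ?case using 4 measurable_precompose[of f g] by auto
qed auto

lemma is_gmodule_E: "is_gmodule \<Gamma> E"
  unfolding ess_bounded_module_def
proof (rule is_gmodule_function_module, goal_cases)
  case (2 f h)
  then obtain b c where "AE x in \<nu>. \<bar>f x\<bar> \<le> b" "AE x in \<nu>. \<bar>h x\<bar> \<le> c" by auto
  then have "AE x in \<nu>. \<bar>f x + h x\<bar> \<le> b + c" by eventually_elim linarith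
  then show ?case using 2 by auto
next
  case (4 g f)
  then obtain b where "AE x in \<nu>. \<bar>f x\<bar> \<le> b" by auto
  then have "AE x in \<nu>. \<bar>f (\<alpha> g x)\<bar> \<le> b" using 4 by (intro AE_precompose)
  then have "AE x in \<nu>. \<bar>if x \<in> space \<nu> then f (\<alpha> g x) else 0\<bar> \<le> b"
    using AE_space by eventually_elim simp
  then show ?case using 4 measurable_precompose[of f g] by auto
qed (auto intro: exI[of _ 0])

lemma N_closed:
  shows "(\<lambda>x. 0) \<in> N" "\<And>f h. \<lbrakk>f \<in> N; h \<in> N\<rbrakk> \<Longrightarrow> (\<lambda>x. f x + h x) \<in> N" "\<And>f. f \<in> N \<Longrightarrow> (\<lambda>x. - f x) \<in> N"
    "\<And>f h. \<lbrakk>f \<in> N; h \<in> N\<rbrakk> \<Longrightarrow> (\<lambda>x. f x - h x) \<in> N"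
    "\<And>g f. \<lbrakk>g \<in> carrier \<Gamma>; f \<in> N\<rbrakk> \<Longrightarrow> (\<lambda>x. if x \<in> space \<nu> then f (\<alpha> g x) else 0) \<in> N"
proof -
  show "(\<lambda>x. f x + h x) \<in> N" "(\<lambda>x. f x - h x) \<in> N" if "f \<in> N" "h \<in> N" for f h
  proof -
    have "AE x in \<nu>. f x = 0" "AE x in \<nu>. h x = 0" using that by (auto simp: N_iff)
    then have "AE x in \<nu>. f x + h x = 0" "AE x in \<nu>. f x - h x = 0" by (eventually_elim; simp)+
    then show "(\<lambda>x. f x + h x) \<in> N" "(\<lambda>x. f x - h x) \<in> N" using that by (auto simp: N_iff)
  qed
  show "(\<lambda>x. if x \<in> space \<nu> then f (\<alpha> g x) else 0) \<in> N" if "g \<in> carrier \<Gamma>" "f \<in> N" for g f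
  proof -
    have "AE x in \<nu>. f (\<alpha> g x) = 0" using that by (intro AE_precompose) (auto simp: N_iff)
    then have "AE x in \<nu>. (if x \<in> space \<nu> then f (\<alpha> g x) else 0) = 0" by eventually_elim simp
    then show ?thesis using that measurable_precompose[of f g] by (simp add: N_iff)
  qed
qed (auto simp: N_iff)

lemma N_subset_E: "N \<subseteq> carrier E"
  by (auto simp: N_iff E_iff intro!: exI[of _ 0])

lemma B_subset_E: "carrier B \<subseteq> carrier E"
  by (force simp: B_iff E_iff intro: AE_I2)

lemma E_simps [simp]: "f \<otimes>\<^bsub>E\<^esub> h = (\<lambda>x. f x + h x)" "\<one>\<^bsub>E\<^esub> = (\<lambda>x. 0)"
  "act E g f = (\<lambda>x. if x \<in> space \<nu> then f (\<alpha> g x) else 0)"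
  by (simp_all add: ess_bounded_module_def)

lemma B_simps [simp]: "f \<otimes>\<^bsub>B\<^esub> h = (\<lambda>x. f x + h x)" "\<one>\<^bsub>B\<^esub> = (\<lambda>x. 0)"
  "act B g f = (\<lambda>x. if x \<in> space \<nu> then f (\<alpha> g x) else 0)"
  by (simp_all add: bounded_module_def)

lemma comm_group_E: "comm_group E"
  using is_gmodule_E by (simp add: is_gmodule_def)

lemma group_E: "group E"
  using comm_group_E by (simp add: comm_group_def)

lemma E_minus: "f \<in> carrier E \<Longrightarrow> (\<lambda>x. - f x) \<in> carrier E"
  by (auto simp: E_iff)

lemma inv_E: "f \<in> carrier E \<Longrightarrow> inv\<^bsub>E\<^esub> f = (\<lambda>x. - f x)"
  using inv_function_module[of "carrier E" f] group_E E_minus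
  by (simp add: ess_bounded_module_def)

lemma normal_N: "N \<lhd> E"
proof -
  have "subgroup N E"
    by (rule group.subgroupI[OF group_E])
      (use N_subset_E N_closed inv_E in \<open>auto simp: subset_iff\<close>)
  then show ?thesis using comm_group.normal_iff_subgroup[OF comm_group_E] by blast
qed

definition q :: "('x \<Rightarrow> int) \<Rightarrow> ('x \<Rightarrow> int) set" where
  "q f = N #>\<^bsub>E\<^esub> f"

lemma q_mem: "h \<in> q f \<longleftrightarrow> (\<lambda>x. h x - f x) \<in> N"
proof
  assume "(\<lambda>x. h x - f x) \<in> N"
  then show "h \<in> q f"
    unfolding q_def r_coset_def by (auto intro!: bexI[of _ "\<lambda>x. h x - f x"])
qed (auto simp: q_def r_coset_def)

lemma carrier_L: "carrier L = q ` carrier E"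
  by (simp add: Linf_module_def carrier_FactGroup q_def[abs_def])

lemma mult_L: "\<lbrakk>f \<in> carrier E; h \<in> carrier E\<rbrakk> \<Longrightarrow> q f \<otimes>\<^bsub>L\<^esub> q h = q (\<lambda>x. f x + h x)"
  using normal.rcos_sum[OF normal_N, of f h] by (simp add: Linf_module_def q_def)

text \<open>The action on classes is by images of cosets. That such an image is a whole coset, and
  not just part of one, uses translation by the inverse.\<close>

lemma act_L:
  assumes g: "g \<in> carrier \<Gamma>" and f: "f \<in> carrier E"
  shows "act L g (q f) = q (act E g f)"
proof -
  have "act L g (q f) = act E g ` q f" by (simp add: Linf_module_def)
  also have "\<dots> = q (act E g f)"
  proof (intro equalityI subsetI)
    fix h assume "h \<in> act E g ` q f"
    then obtain k where k: "(\<lambda>x. k x - f x) \<in> N" "h = act E g k" by (auto simp: q_mem)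
    have "(\<lambda>x. h x - act E g f x) = (\<lambda>x. if x \<in> space \<nu> then k (\<alpha> g x) - f (\<alpha> g x) else 0)"
      using k(2) by auto
    then show "h \<in> q (act E g f)" using N_closed(5)[OF g k(1)] by (simp add: q_mem)
  next
    fix h assume "h \<in> q (act E g f)"
    then have n: "(\<lambda>x. h x - act E g f x) \<in> N" by (simp add: q_mem)
    have ig: "inv\<^bsub>\<Gamma>\<^esub> g \<in> carrier \<Gamma>"
      using action g by (simp add: group_action_def group_hom_def)
    \<comment> \<open>The deviation of \<open>h\<close> from the translate of \<open>f\<close>,
      translated back and added to \<open>f\<close>.\<close>
    define k where "k = (\<lambda>x. (if x \<in> space \<nu> then (\<lambda>x. h x - act E g f x) (\<alpha> (inv\<^bsub>\<Gamma>\<^esub> g) x) else 0) + f x)"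
    have "k \<in> q f"
      using N_closed(5)[OF ig n] unfolding q_mem k_def by simp
    moreover have "act E g k = h"
    proof
      fix x
      show "act E g k x = h x"
      proof (cases "x \<in> space \<nu>")
        case True
        then have "\<alpha> (inv\<^bsub>\<Gamma>\<^esub> g) (\<alpha> g x) = x"
          using group_action.orbit_sym_aux[OF action g True refl] by simp
        then show ?thesis using True space_\<alpha>[OF g True] by (simp add: k_def)
      next
        case False
        then show ?thesis using n f by (auto simp: N_iff)
      qed
    qed
    ultimately show "h \<in> act E g ` q f" by blast
  qed
  finally show ?thesis .
qed

lemma is_gmodule_L: "is_gmodule \<Gamma> L"
  unfolding is_gmodule_def
proof (intro conjI ballI)
  have "comm_group (E Mod N)"
    using comm_group.abelian_FactGroup[OF comm_group_E] normal_imp_subgroup[OF normal_N] by blast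
  then show "comm_group L"
    by (rule comm_group_same_structure) (simp_all add: Linf_module_def)
  fix g assume g: "g \<in> carrier \<Gamma>"
  note c = is_gmoduleD(5)[OF is_gmodule_E g]
  show "act L g \<in> hom L L"
  proof (rule homI)
    show "act L g F \<in> carrier L" if "F \<in> carrier L" for F
      using that act_L[OF g] c unfolding carrier_L by blast
    fix F G assume "F \<in> carrier L" "G \<in> carrier L"
    then obtain f h where fh: "F = q f" "G = q h" "f \<in> carrier E" "h \<in> carrier E" by (auto simp: carrier_L)
    have "act L g (F \<otimes>\<^bsub>L\<^esub> G) = q (act E g (f \<otimes>\<^bsub>E\<^esub> h))"
      using fh act_L[OF g is_gmoduleD(3)[OF is_gmodule_E fh(3,4)]] by (simp add: mult_L)
    also have "act E g (f \<otimes>\<^bsub>E\<^esub> h) = act E g f \<otimes>\<^bsub>E\<^esub> act E g h"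
      by (rule is_gmoduleD(6)[OF is_gmodule_E g fh(3,4)])
    also have "q \<dots> = act L g F \<otimes>\<^bsub>L\<^esub> act L g G"
      using mult_L[OF c[OF fh(3)] c[OF fh(4)]] by (simp only: fh act_L[OF g] E_simps(1))
    finally show "act L g (F \<otimes>\<^bsub>L\<^esub> G) = act L g F \<otimes>\<^bsub>L\<^esub> act L g G" .
  qed
qed

definition repB :: "('x \<Rightarrow> int) \<Rightarrow> 'x \<Rightarrow> real" where
  "repB f x = real_of_int (f x)"

text \<open>The same choice of representative as in \<open>Linf_abs_integral\<close>, so that the
  integrals agree by unfolding.\<close>

definition repL :: "('x \<Rightarrow> int) set \<Rightarrow> 'x \<Rightarrow> real" where
  "repL F x = real_of_int ((SOME f. f \<in> F) x)"

lemma some_q: assumes "f \<in> carrier E" shows "(SOME h. h \<in> q f) \<in> carrier E" "AE x in \<nu>. (SOME h. h \<in> q f) x = f x"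
proof -
  have "f \<in> q f" by (simp add: q_mem N_closed)
  then have "(SOME h. h \<in> q f) \<in> q f" using someI[of "\<lambda>h. h \<in> q f"] by blast
  then obtain n where n: "n \<in> N" "(SOME h. h \<in> q f) = (\<lambda>x. n x + f x)"
    by (metis (no_types, lifting) E_simps(1) q_def r_coset_def UN_E singletonD)
  show "(SOME h. h \<in> q f) \<in> carrier E"
    unfolding n(2) using is_gmoduleD(3)[OF is_gmodule_E _ assms, of n] N_subset_E n(1) by auto
  have "AE x in \<nu>. n x = 0" using n by (simp add: N_iff)
  then show "AE x in \<nu>. (SOME h. h \<in> q f) x = f x" unfolding n(2) by eventually_elim simp
qed

lemma repL_q: "f \<in> carrier E \<Longrightarrow> AE x in \<nu>. repL (q f) x = repB f x"
  using some_q(2)[of f] unfolding repL_def repB_def by simp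

lemma integrable_repB:
  assumes "f \<in> carrier E"
  shows "integrable \<nu> (repB f)"
proof -
  obtain b where b: "AE x in \<nu>. \<bar>f x\<bar> \<le> b" using assms by (auto simp: E_iff)
  have "AE x in \<nu>. norm (repB f x) \<le> real_of_int b"
    using b by eventually_elim (simp add: repB_def flip: of_int_abs)
  moreover have "repB f \<in> borel_measurable \<nu>"
    unfolding repB_def[abs_def] using assms
    by (auto simp: E_iff intro: measurable_compose[where N = "count_space UNIV"])
  ultimately show ?thesis
    by (intro integrable_const_bound) auto
qed

lemma integrable_repL: "F \<in> carrier L \<Longrightarrow> integrable \<nu> (repL F)"
  using integrable_repB[OF some_q(1)] unfolding carrier_L repL_def[abs_def] repB_def[abs_def] by blast

lemma abs_integral_repB: "abs_integral \<nu> f = (\<integral>x. \<bar>repB f x\<bar> \<partial>\<nu>)"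
  by (simp add: abs_integral_def repB_def)

lemma abs_integral_repL: "Linf_abs_integral \<nu> F = (\<integral>x. \<bar>repL F x\<bar> \<partial>\<nu>)"
  by (simp add: Linf_abs_integral_def abs_integral_def repL_def)

lemma repL_mult:
  assumes "F \<in> carrier L" "G \<in> carrier L"
  shows "AE x in \<nu>. repL (F \<otimes>\<^bsub>L\<^esub> G) x = repL F x + repL G x"
proof -
  obtain f h where fh: "F = q f" "G = q h" "f \<in> carrier E" "h \<in> carrier E"
    using assms by (auto simp: carrier_L)
  have "(\<lambda>x. f x + h x) \<in> carrier E" using is_gmoduleD(3)[OF is_gmodule_E fh(3,4)] by simp
  from repL_q[OF fh(3)] repL_q[OF fh(4)] repL_q[OF this] show ?thesis
    unfolding fh(1,2) mult_L[OF fh(3,4)] by eventually_elim (simp add: repB_def)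
qed

lemma repL_act:
  assumes g: "g \<in> carrier \<Gamma>" and F: "F \<in> carrier L"
  shows "AE x in \<nu>. repL (act L g F) x = repL F (\<alpha> g x)"
proof -
  obtain f where f: "F = q f" "f \<in> carrier E" using F by (auto simp: carrier_L)
  from repL_q[OF is_gmoduleD(5)[OF is_gmodule_E g f(2)]] AE_precompose[OF repL_q[OF f(2)] g] AE_space
  show ?thesis
    unfolding f(1) act_L[OF g f(2)] by eventually_elim (simp add: repB_def)
qed

lemma q_equivariant: "q \<in> equivariant_hom \<Gamma> B L"
  unfolding equivariant_hom_def hom_def
  using B_subset_E carrier_L mult_L act_L by (auto simp: subset_iff)

lemma const_equivariant: "const_function \<nu> \<in> equivariant_hom \<Gamma> trivial_module B"
  unfolding equivariant_hom_def hom_def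
  by (auto simp: trivial_module_def integer_group_def const_function_def B_iff fun_eq_iff space_\<alpha>
      intro!: measurable_If exI[of _ "\<bar>z\<bar>" for z])

lemma Linf_constant_eq: "Linf_constant \<nu> \<alpha> = q \<circ> const_function \<nu>"
  by (simp add: Linf_constant_def q_def fun_eq_iff)

lemma is_gmodule_trivial: "is_gmodule \<Gamma> trivial_module"
proof -
  have "comm_group (trivial_module :: (int, 'g) gmodule)"
    by (rule comm_group_same_structure[OF abelian_integer_group]) (simp_all add: trivial_module_def)
  then show ?thesis by (auto simp: is_gmodule_def trivial_module_def hom_def)
qed

end

section \<open>The span of indicators of a dense invariant algebra\<close>

locale dense_algebra_action = measure_action \<Gamma> \<alpha> \<nu>
  for \<Gamma> :: "'g monoid" and \<alpha> :: "'g \<Rightarrow> 'x \<Rightarrow> 'x" and \<nu> :: "'x measure" +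
  fixes \<A> :: "'x set set"
  assumes algebra: "algebra (space \<nu>) \<A>" and \<A>_sets: "\<A> \<subseteq> sets \<nu>"
    and \<A>_invariant: "\<lbrakk>g \<in> carrier \<Gamma>; A \<in> \<A>\<rbrakk> \<Longrightarrow> \<alpha> g ` A \<in> \<A>"
    and dense: "dense_subalgebra \<A> \<nu>"
begin

abbreviation "Sp \<equiv> span_module \<nu> \<alpha> \<A>"

lemma group_B: "group B"
  using is_gmoduleD(2)[OF is_gmodule_B] .

lemma indicators_B: "{indicator A | A. A \<in> \<A>} \<subseteq> carrier B"
proof clarify
  fix A assume A: "A \<in> \<A>"
  then have As: "A \<in> sets \<nu>" "A \<subseteq> space \<nu>" using \<A>_sets sets.sets_into_space by blast+
  then have "A \<inter> space \<nu> \<in> sets \<nu>" by (simp add: Int_absorb2)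
  then have "(\<lambda>x. if x \<in> A then 1 else 0 :: int) \<in> measurable \<nu> (count_space UNIV)"
    by (intro measurable_If_set) auto
  moreover have "indicator A = (\<lambda>x. if x \<in> A then 1 else 0 :: int)"
    by (auto simp: indicator_def)
  ultimately have "(indicator A :: 'x \<Rightarrow> int) \<in> measurable \<nu> (count_space UNIV)" by simp
  then show "indicator A \<in> carrier B"
    using As(2) by (auto simp: B_iff indicator_def intro!: exI[of _ 1])
qed

lemma carrier_Sp: "carrier Sp = generate B {indicator A | A. A \<in> \<A>}"
  by (simp add: span_module_def)

lemma subgroup_Sp: "subgroup (carrier Sp) B"
  unfolding carrier_Sp by (rule group.generate_is_subgroup[OF group_B indicators_B])

lemma Sp_subset_B: "carrier Sp \<subseteq> carrier B"
  using subgroup.subset[OF subgroup_Sp] .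

lemma Sp_simps [simp]: "f \<otimes>\<^bsub>Sp\<^esub> h = (\<lambda>x. f x + h x)" "\<one>\<^bsub>Sp\<^esub> = (\<lambda>x. 0)"
  "act Sp g f = (\<lambda>x. if x \<in> space \<nu> then f (\<alpha> g x) else 0)"
  using B_simps by (simp_all add: span_module_def)

lemma Sp_add: "\<lbrakk>f \<in> carrier Sp; h \<in> carrier Sp\<rbrakk> \<Longrightarrow> (\<lambda>x. f x + h x) \<in> carrier Sp"
  using subgroup.m_closed[OF subgroup_Sp] by simp

lemma inv_B: "f \<in> carrier B \<Longrightarrow> inv\<^bsub>B\<^esub> f = (\<lambda>x. - f x)"
  using inv_function_module[of "carrier B" f] group_B
  by (auto simp: bounded_module_def)

lemma Sp_minus: "f \<in> carrier Sp \<Longrightarrow> (\<lambda>x. - f x) \<in> carrier Sp"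
  using subgroup.m_inv_closed[OF subgroup_Sp] inv_B Sp_subset_B by fastforce

lemma Sp_0: "(\<lambda>x. 0) \<in> carrier Sp"
  using subgroup.one_closed[OF subgroup_Sp] by simp

lemma Sp_indicator: "A \<in> \<A> \<Longrightarrow> indicator A \<in> carrier Sp"
  unfolding carrier_Sp by (rule generate.incl) blast

lemma Sp_scale:
  assumes "f \<in> carrier Sp"
  shows "(\<lambda>x. k * f x) \<in> carrier Sp"
proof (induction k rule: int_induct[where k = 0])
  case base
  then show ?case using Sp_0 by simp
next
  case (step1 i)
  then show ?case using Sp_add[OF step1(2) assms] by (simp add: distrib_right)
next
  case (step2 i)
  then show ?case using Sp_add[OF step2(2) Sp_minus[OF assms]] by (simp add: left_diff_distrib)
qed

lemma Sp_sum: "(\<And>i. i \<in> I \<Longrightarrow> f i \<in> carrier Sp) \<Longrightarrow> (\<lambda>x. \<Sum>i\<in>I. f i x) \<in> carrier Sp"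
  by (induction I rule: infinite_finite_induct) (auto simp: Sp_0 Sp_add)

text \<open>Pulling back along \<open>\<alpha> g\<close> replaces a set by its image under the
  inverse; this is how invariance of \<open>\<A>\<close> turns the span into a module.\<close>

lemma act_indicator:
  assumes g: "g \<in> carrier \<Gamma>" and A: "A \<in> \<A>"
  shows "(\<lambda>x. if x \<in> space \<nu> then indicator A (\<alpha> g x) else 0) = indicator (\<alpha> (inv\<^bsub>\<Gamma>\<^esub> g) ` A)"
proof
  fix x
  have As: "A \<subseteq> space \<nu>" using A \<A>_sets sets.sets_into_space by blast
  have ig: "inv\<^bsub>\<Gamma>\<^esub> g \<in> carrier \<Gamma>" "inv\<^bsub>\<Gamma>\<^esub> (inv\<^bsub>\<Gamma>\<^esub> g) = g"
    using action g by (simp_all add: group_action_def group_hom_def)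
  have "x \<in> \<alpha> (inv\<^bsub>\<Gamma>\<^esub> g) ` A \<longleftrightarrow> x \<in> space \<nu> \<and> \<alpha> g x \<in> A"
  proof
    assume "x \<in> \<alpha> (inv\<^bsub>\<Gamma>\<^esub> g) ` A"
    then obtain a where a: "a \<in> A" "\<alpha> (inv\<^bsub>\<Gamma>\<^esub> g) a = x" by blast
    then have as: "a \<in> space \<nu>" using As by blast
    show "x \<in> space \<nu> \<and> \<alpha> g x \<in> A"
      using group_action.orbit_sym_aux[OF action ig(1) as a(2)] space_\<alpha>[OF ig(1) as] a ig(2) by simp
  next
    assume x: "x \<in> space \<nu> \<and> \<alpha> g x \<in> A"
    then have "\<alpha> (inv\<^bsub>\<Gamma>\<^esub> g) (\<alpha> g x) = x"
      using group_action.orbit_sym_aux[OF action g _ refl] by blast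
    then show "x \<in> \<alpha> (inv\<^bsub>\<Gamma>\<^esub> g) ` A" using x by (metis imageI)
  qed
  then show "(if x \<in> space \<nu> then indicator A (\<alpha> g x) else 0) = indicator (\<alpha> (inv\<^bsub>\<Gamma>\<^esub> g) ` A) x"
    by (simp add: indicator_def)
qed

lemma Sp_act:
  assumes g: "g \<in> carrier \<Gamma>" and f: "f \<in> carrier Sp"
  shows "act Sp g f \<in> carrier Sp"
  using f unfolding carrier_Sp
proof (induction f rule: generate.induct)
  case one
  then show ?case using Sp_0 by (simp add: carrier_Sp)
next
  case (incl h)
  then obtain A where A: "h = indicator A" "A \<in> \<A>" by blast
  have ig: "inv\<^bsub>\<Gamma>\<^esub> g \<in> carrier \<Gamma>"
    using action g by (simp add: group_action_def group_hom_def)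
  show ?case
    unfolding carrier_Sp[symmetric] A(1) Sp_simps act_indicator[OF g A(2)]
    by (rule Sp_indicator[OF \<A>_invariant[OF ig A(2)]])
next
  case (inv h)
  then obtain A where A: "h = indicator A" "A \<in> \<A>" by blast
  have ig: "inv\<^bsub>\<Gamma>\<^esub> g \<in> carrier \<Gamma>"
    using action g by (simp add: group_action_def group_hom_def)
  have "h \<in> carrier B" using inv indicators_B by blast
  moreover have "act Sp g (\<lambda>x. - h x) = (\<lambda>x. - (indicator (\<alpha> (inv\<^bsub>\<Gamma>\<^esub> g) ` A) x))"
    unfolding A(1) Sp_simps act_indicator[OF g A(2), symmetric] by auto
  ultimately show ?case
    using Sp_minus[OF Sp_indicator[OF \<A>_invariant[OF ig A(2)]]] by (simp only: inv_B carrier_Sp)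
next
  case (eng h1 h2)
  have "act Sp g (h1 \<otimes>\<^bsub>B\<^esub> h2) = (\<lambda>x. act Sp g h1 x + act Sp g h2 x)" by auto
  then show ?case using Sp_add[of "act Sp g h1" "act Sp g h2"] eng by (simp only: carrier_Sp)
qed

lemma is_gmodule_Sp: "is_gmodule \<Gamma> Sp"
  unfolding is_gmodule_def
proof (intro conjI ballI)
  show "comm_group Sp"
  proof (rule comm_groupI)
    show "\<exists>h\<in>carrier Sp. h \<otimes>\<^bsub>Sp\<^esub> f = \<one>\<^bsub>Sp\<^esub>" if "f \<in> carrier Sp" for f
      by (rule bexI[of _ "\<lambda>x. - f x"]) (use that Sp_minus in simp_all)
  qed (use Sp_add Sp_0 in \<open>simp_all add: ac_simps\<close>)
  fix g assume g: "g \<in> carrier \<Gamma>"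
  show "act Sp g \<in> hom Sp Sp"
  proof (rule homI)
    show "act Sp g (f \<otimes>\<^bsub>Sp\<^esub> h) = act Sp g f \<otimes>\<^bsub>Sp\<^esub> act Sp g h" for f h
      unfolding Sp_simps by auto
  qed (rule Sp_act[OF g])
qed

text \<open>The whole space belongs to the algebra. Integral chains therefore have coefficients in
  the span already and survive the approximation unchanged.\<close>

lemma Sp_const: "const_function \<nu> z \<in> carrier Sp"
proof -
  have "space \<nu> \<in> \<A>" using algebra by (simp add: algebra.top)
  then have "(\<lambda>x. z * indicator (space \<nu>) x) \<in> carrier Sp" by (intro Sp_scale Sp_indicator)
  moreover have "(\<lambda>x. z * indicator (space \<nu>) x) = const_function \<nu> z"
    by (auto simp: const_function_def indicator_def)
  ultimately show ?thesis by simp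
qed

text \<open>An essentially bounded integer function has finitely many values off a null set; each
  level set is replaced by a nearby member of the algebra.\<close>

lemma Sp_approx:
  assumes a: "a \<in> carrier E" and \<delta>: "\<delta> > 0"
  obtains b where "b \<in> carrier Sp" "(\<integral>x. \<bar>repB a x - repB b x\<bar> \<partial>\<nu>) < \<delta>"
proof -
  obtain K where K: "AE x in \<nu>. \<bar>a x\<bar> \<le> K" using a by (auto simp: E_iff)
  define I where "I = {-K..K}"
  define P where "P = (\<lambda>k. {x \<in> space \<nu>. a x = k})"
  have P: "P k \<in> sets \<nu>" for k
  proof -
    have "P k = a -` {k} \<inter> space \<nu>" by (auto simp: P_def)
    then show ?thesis using a measurable_sets[of a \<nu> "count_space UNIV" "{k}"] by (simp add: E_iff)
  qed
  \<comment> \<open>The errors of the level sets are weighted by the absolute values,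
    \<open>c\<close> in total; dividing by \<open>c + 1\<close> is safe even if
    \<open>c = 0\<close>.\<close>
  define c where "c = (\<Sum>k\<in>I. real_of_int \<bar>k\<bar>)"
  have c: "c \<ge> 0" unfolding c_def by (intro sum_nonneg) auto
  have "\<exists>A\<in>\<A>. measure \<nu> (sym_diff (P k) A) < \<delta> / (c + 1)" for k
    using dense P[of k] \<delta> c unfolding dense_subalgebra_def by (metis add_nonneg_pos divide_pos_pos zero_less_one)
  then obtain A where A: "A k \<in> \<A>" "measure \<nu> (sym_diff (P k) (A k)) < \<delta> / (c + 1)" for k
    by metis
  have As: "sym_diff (P k) (A k) \<in> sets \<nu>" for k using A(1) \<A>_sets P by blast
  define b :: "'x \<Rightarrow> int" where "b = (\<lambda>x. \<Sum>k\<in>I. k * indicator (A k) x)"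
  have b: "b \<in> carrier Sp"
    unfolding b_def by (intro Sp_sum Sp_scale Sp_indicator A)
  have bE: "b \<in> carrier E" using b Sp_subset_B B_subset_E by blast
  have "AE x in \<nu>. \<bar>repB a x - repB b x\<bar> \<le> (\<Sum>k\<in>I. real_of_int \<bar>k\<bar> * indicator (sym_diff (P k) (A k)) x)"
    using K AE_space
  proof eventually_elim
    case (elim x)
    \<comment> \<open>Where the bound \<open>K\<close> holds, \<open>a\<close> is the sum of its
      values times the indicators of its level sets.\<close>
    have "(\<Sum>k\<in>I. k * indicator (P k) x) = (\<Sum>k\<in>I. if k = a x then k else 0)"
      by (rule sum.cong) (use elim in \<open>auto simp: P_def indicator_def\<close>)
    also have "\<dots> = a x" using elim by (auto simp: I_def)
    finally have "repB a x - repB b x = (\<Sum>k\<in>I. real_of_int (k * (indicator (P k) x - indicator (A k) x)))"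
      unfolding repB_def b_def of_int_diff[symmetric] of_int_sum[symmetric]
      by (simp add: sum_subtractf right_diff_distrib)
    also have "\<bar>\<dots>\<bar> \<le> (\<Sum>k\<in>I. \<bar>real_of_int (k * (indicator (P k) x - indicator (A k) x))\<bar>)"
      by (rule sum_abs)
    also have "\<dots> = (\<Sum>k\<in>I. real_of_int \<bar>k\<bar> * indicator (sym_diff (P k) (A k)) x)"
      by (rule sum.cong) (auto simp: indicator_def)
    finally show ?case .
  qed
  then have "(\<integral>x. \<bar>repB a x - repB b x\<bar> \<partial>\<nu>) \<le>
      (\<integral>x. (\<Sum>k\<in>I. real_of_int \<bar>k\<bar> * indicator (sym_diff (P k) (A k)) x) \<partial>\<nu>)"
    by (intro integral_mono_AE Bochner_Integration.integrable_sum Bochner_Integration.integrable_mult_right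
        Bochner_Integration.integrable_abs Bochner_Integration.integrable_diff integrable_repB a bE)
      (use As in \<open>auto simp: emeasure_eq_measure\<close>)
  also have "\<dots> = (\<Sum>k\<in>I. real_of_int \<bar>k\<bar> * measure \<nu> (sym_diff (P k) (A k)))"
  proof (subst Bochner_Integration.integral_sum)
    show "integrable \<nu> (\<lambda>x. real_of_int \<bar>k\<bar> * indicator (sym_diff (P k) (A k)) x)" for k
      using As[of k] by (intro Bochner_Integration.integrable_mult_right integrable_real_indicator)
        (auto simp: emeasure_eq_measure)
    show "(\<Sum>k\<in>I. \<integral>x. real_of_int \<bar>k\<bar> * indicator (sym_diff (P k) (A k)) x \<partial>\<nu>) =
        (\<Sum>k\<in>I. real_of_int \<bar>k\<bar> * measure \<nu> (sym_diff (P k) (A k)))"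
      by (rule sum.cong[OF refl])
        (simp only: integral_mult_right_zero Bochner_Integration.integral_indicator
          Int_absorb2[OF sets.sets_into_space[OF As]])
  qed
  also have "\<dots> \<le> (\<Sum>k\<in>I. real_of_int \<bar>k\<bar> * (\<delta> / (c + 1)))"
    using A(2) by (intro sum_mono mult_left_mono) (auto intro: less_imp_le)
  also have "\<dots> = c * (\<delta> / (c + 1))"
    by (simp only: c_def sum_distrib_right)
  also have "\<dots> < \<delta>"
    using c \<delta> by (simp add: field_simps)
  finally show ?thesis using that b by blast
qed

end

section \<open>Cycles with twisted coefficients\<close>

locale twisted_complex =
  fixes \<Gamma> :: "'g monoid" and D :: "nat \<Rightarrow> ('b chain, 'g) gmodule"
  assumes is_gmodule_D: "is_gmodule \<Gamma> (D k)"
    and mult_D: "c \<otimes>\<^bsub>D k\<^esub> d = c + d" and one_D: "\<one>\<^bsub>D k\<^esub> = 0"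
    and boundary_equivariant: "chain_boundary k \<in> equivariant_hom \<Gamma> (D k) (D (k - 1))"
    and boundary_boundary: "c \<in> carrier (D (Suc k)) \<Longrightarrow> chain_boundary k (chain_boundary (Suc k) c) = 0"
begin

lemma boundary_equivariant_Suc: "chain_boundary (Suc k) \<in> equivariant_hom \<Gamma> (D (Suc k)) (D k)"
  using boundary_equivariant[of "Suc k"] by simp

lemma twisted_boundary_class:
  assumes "is_gmodule \<Gamma> A"
  shows "twisted_boundary \<Gamma> A D k (tensor_class \<Gamma> A (D k) u) =
    tensor_class \<Gamma> A (D (k - 1)) (tensor_lift id (chain_boundary k) u)"
proof -
  interpret gmodule_pair \<Gamma> A "D (k - 1)" by unfold_locales (use assms is_gmodule_D in auto)
  show ?thesis
    unfolding twisted_boundary_def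
    by (rule tensor_map_class[OF assms is_gmodule_D equivariant_hom_id boundary_equivariant])
qed

lemma twisted_cycles_iff:
  assumes A: "is_gmodule \<Gamma> A" and u: "keys u \<subseteq> carrier A \<times> carrier (D k)"
  shows "tensor_class \<Gamma> A (D k) u \<in> twisted_cycles \<Gamma> A D k \<longleftrightarrow>
    tensor_lift id (chain_boundary k) u \<in> tensor_relations \<Gamma> A (D (k - 1))"
proof -
  interpret P: gmodule_pair \<Gamma> A "D k" by unfold_locales (use A is_gmodule_D in auto)
  interpret Q: gmodule_pair \<Gamma> A "D (k - 1)" by unfold_locales (use A is_gmodule_D in auto)
  have "tensor_class \<Gamma> A (D k) u \<in> carrier (tensor \<Gamma> A (D k))"
    using u by (auto simp: P.carrier_tensor)
  then show ?thesis
    unfolding twisted_cycles_def mem_Collect_eq twisted_boundary_class[OF A] Q.one_tensor Q.class_eq by simp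
qed

lemma cycles_representing_carrier:
  assumes A: "is_gmodule \<Gamma> A" and \<xi>: "\<xi> \<in> cycles_representing \<Gamma> D p n m A \<iota>"
  obtains u where "keys u \<subseteq> carrier A \<times> carrier (D n)" "\<xi> = tensor_class \<Gamma> A (D n) u"
proof -
  interpret P: gmodule_pair \<Gamma> A "D n" by unfold_locales (use A is_gmodule_D in auto)
  show ?thesis
    using \<xi> that by (auto simp: cycles_representing_def twisted_cycles_def P.carrier_tensor)
qed

text \<open>The working form of the definition: modulo relations, \<open>u\<close> is an integral
  cycle \<open>w\<close> plus the boundary of \<open>d\<close>. That \<open>u\<close> is itself a
  cycle follows from such an equation.\<close>

lemma cycles_representing_iff:
  assumes A: "is_gmodule \<Gamma> A" and Z: "is_gmodule \<Gamma> (trivial_module :: (int, 'g) gmodule)"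
    and \<iota>: "\<iota> \<in> equivariant_hom \<Gamma> trivial_module A"
    and u: "keys u \<subseteq> carrier A \<times> carrier (D n)"
  shows "tensor_class \<Gamma> A (D n) u \<in> cycles_representing \<Gamma> D p n m A \<iota> \<longleftrightarrow>
    (\<exists>w. keys w \<subseteq> UNIV \<times> carrier (D n) \<and>
       tensor_lift id (chain_boundary n) w \<in> tensor_relations \<Gamma> trivial_module (D (n - 1)) \<and>
       push_down p n (tensor_class \<Gamma> trivial_module (D n) w) \<in> m \<and>
       (\<exists>d. keys d \<subseteq> carrier A \<times> carrier (D (Suc n)) \<and>
          u - tensor_lift \<iota> id w - tensor_lift id (chain_boundary (Suc n)) d \<in> tensor_relations \<Gamma> A (D n)))"
    (is "?L \<longleftrightarrow> ?Q")
proof -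
  interpret An: gmodule_pair \<Gamma> A "D n" by unfold_locales (use A is_gmodule_D in auto)
  interpret Am: gmodule_pair \<Gamma> A "D (n - 1)" by unfold_locales (use A is_gmodule_D in auto)
  interpret As: gmodule_pair \<Gamma> A "D (Suc n)" by unfold_locales (use A is_gmodule_D in auto)
  interpret Zn: gmodule_pair \<Gamma> "trivial_module :: (int, 'g) gmodule" "D n"
    by unfold_locales (use Z is_gmodule_D in auto)
  have cZ: "carrier (trivial_module :: (int, 'g) gmodule) = UNIV" by (simp add: trivial_module_def)
  have \<iota>c: "tensor_map \<Gamma> A (D n) \<iota> id (tensor_class \<Gamma> trivial_module (D n) w) =
      tensor_class \<Gamma> A (D n) (tensor_lift \<iota> id w)" for w
    by (rule An.tensor_map_class[OF Z is_gmodule_D \<iota> equivariant_hom_id])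
  have bd: "twisted_boundaries \<Gamma> A D n =
      (\<lambda>d. tensor_class \<Gamma> A (D n) (tensor_lift id (chain_boundary (Suc n)) d)) `
        {d. keys d \<subseteq> carrier A \<times> carrier (D (Suc n))}" (is "_ = ?f ` ?K")
  proof -
    have "carrier (tensor \<Gamma> A (D (Suc n))) = tensor_class \<Gamma> A (D (Suc n)) ` ?K"
      using As.carrier_tensor by auto
    then show ?thesis
      unfolding twisted_boundaries_def by (simp add: image_image twisted_boundary_class[OF A])
  qed
  have coset: "tensor_class \<Gamma> A (D n) u \<in> twisted_boundaries \<Gamma> A D n #>\<^bsub>tensor \<Gamma> A (D n)\<^esub>
      tensor_class \<Gamma> A (D n) v \<longleftrightarrow>
      (\<exists>d. keys d \<subseteq> carrier A \<times> carrier (D (Suc n)) \<and>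
          u - v - tensor_lift id (chain_boundary (Suc n)) d \<in> tensor_relations \<Gamma> A (D n))" for v
    unfolding bd r_coset_def
    by (auto simp: An.mult_tensor An.class_eq algebra_simps)
  \<comment> \<open>Apply the boundary to the equation: the integral part gives a relation because
    \<open>w\<close> is a cycle, and the part from \<open>d\<close> because the boundary of a
    boundary is zero.\<close>
  have cyc: "tensor_class \<Gamma> A (D n) u \<in> twisted_cycles \<Gamma> A D n"
    if w: "keys w \<subseteq> UNIV \<times> carrier (D n)"
      "tensor_lift id (chain_boundary n) w \<in> tensor_relations \<Gamma> trivial_module (D (n - 1))"
      and d: "keys d \<subseteq> carrier A \<times> carrier (D (Suc n))"
        "u - tensor_lift \<iota> id w - tensor_lift id (chain_boundary (Suc n)) d \<in> tensor_relations \<Gamma> A (D n)" for w d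
  proof -
    have 1: "tensor_lift id (chain_boundary n) (u - tensor_lift \<iota> id w - tensor_lift id (chain_boundary (Suc n)) d)
        \<in> tensor_relations \<Gamma> A (D (n - 1))"
      by (rule Am.tensor_lift_relations[OF A is_gmodule_D equivariant_hom_id boundary_equivariant d(2)])
    have 2: "tensor_lift \<iota> id (tensor_lift id (chain_boundary n) w) \<in> tensor_relations \<Gamma> A (D (n - 1))"
      by (rule Am.tensor_lift_relations[OF Z is_gmodule_D \<iota> equivariant_hom_id w(2)])
    have 3: "tensor_lift id (chain_boundary n \<circ> chain_boundary (Suc n)) d \<in> tensor_relations \<Gamma> A (D (n - 1))"
      by (rule Am.tensor_lift_right_0[OF d(1)]) (auto simp: one_D boundary_boundary)
    have "tensor_lift id (chain_boundary n) u =
      tensor_lift id (chain_boundary n) (u - tensor_lift \<iota> id w - tensor_lift id (chain_boundary (Suc n)) d) +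
      tensor_lift \<iota> id (tensor_lift id (chain_boundary n) w) + tensor_lift id (chain_boundary n \<circ> chain_boundary (Suc n)) d"
      by (simp add: tensor_lift_diff tensor_lift_compose)
    then have "tensor_lift id (chain_boundary n) u \<in> tensor_relations \<Gamma> A (D (n - 1))"
      using Am.relations_add[OF Am.relations_add[OF 1 2] 3] by simp
    then show ?thesis by (simp add: twisted_cycles_iff[OF A u])
  qed
  show ?thesis
  proof
    assume ?L
    then obtain \<zeta> where \<zeta>: "\<zeta> \<in> twisted_cycles \<Gamma> trivial_module D n" "push_down p n \<zeta> \<in> m"
      "tensor_class \<Gamma> A (D n) u \<in> twisted_boundaries \<Gamma> A D n #>\<^bsub>tensor \<Gamma> A (D n)\<^esub> tensor_map \<Gamma> A (D n) \<iota> id \<zeta>"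
      unfolding cycles_representing_def by blast
    then obtain w where w: "keys w \<subseteq> UNIV \<times> carrier (D n)" "\<zeta> = tensor_class \<Gamma> trivial_module (D n) w"
      by (auto simp: twisted_cycles_def Zn.carrier_tensor cZ)
    then show ?Q
      using \<zeta> twisted_cycles_iff[OF Z, of w n] by (auto simp: cZ \<iota>c coset)
  next
    assume ?Q
    then obtain w d where w: "keys w \<subseteq> UNIV \<times> carrier (D n)"
      "tensor_lift id (chain_boundary n) w \<in> tensor_relations \<Gamma> trivial_module (D (n - 1))"
      "push_down p n (tensor_class \<Gamma> trivial_module (D n) w) \<in> m"
      and d: "keys d \<subseteq> carrier A \<times> carrier (D (Suc n))"
        "u - tensor_lift \<iota> id w - tensor_lift id (chain_boundary (Suc n)) d \<in> tensor_relations \<Gamma> A (D n)"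
      by blast
    have "tensor_class \<Gamma> trivial_module (D n) w \<in> twisted_cycles \<Gamma> trivial_module D n"
      using twisted_cycles_iff[OF Z, of w n] w by (simp add: cZ)
    then show ?L
      unfolding cycles_representing_def
      using cyc[OF w(1,2) d] w(3) d coset[of "tensor_lift \<iota> id w"]
      by (intro CollectI conjI bexI[of _ "tensor_class \<Gamma> trivial_module (D n) w"]) (auto simp: \<iota>c)
  qed
qed

end

section \<open>Comparison of strict and parametrised cycles\<close>

text \<open>The covering enters only through \<open>simplices\<close> and the form of
  \<open>D\<close>; \<open>dk\<close> stands for the deck action, \<open>f\<close> for the homotopy
  inverse.\<close>

locale equivariant_subcomplex = dense_algebra_action \<Gamma> \<alpha> \<nu> \<A>
  for \<Gamma> :: "'g monoid" and \<alpha> :: "'g \<Rightarrow> 'x \<Rightarrow> 'x" and \<nu> :: "'x measure" and \<A> :: "'x set set" +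
  fixes Mt :: "'b::topological_space set" and p :: "'b \<Rightarrow> 'a::topological_space" and dk :: "'g \<Rightarrow> 'b \<Rightarrow> 'b"
    and D :: "nat \<Rightarrow> ('b chain, 'g) gmodule" and C :: "nat \<Rightarrow> 'b chain set" and f :: "nat \<Rightarrow> 'b chain \<Rightarrow> 'b chain"
    and n :: nat
  assumes simplices: "\<And>k. free_gset \<Gamma> (singular_simplex_set k (top_of_set Mt)) (\<lambda>g. simplex_map k (dk g)) (simplex_map k p)"
    and D_eq: "\<And>k. D k = with_act (chain_group k (top_of_set Mt)) (\<lambda>g. chain_map k (dk g))"
    and C: "gsubcomplex \<Gamma> D C"
    and f: "gchain_homotopy_inverse \<Gamma> (restrict_complex D C) D (\<lambda>k. id) f"
    and f_norm: "norm_at_most_1 D f"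
begin

lemma chains_eq: "free_gset.chains (singular_simplex_set k (top_of_set Mt)) (\<lambda>g. simplex_map k (dk g)) = D k"
  unfolding free_gset.chains_def[OF simplices] D_eq chain_group_def
  by (simp add: chain_map_def[abs_def] o_def)

text \<open>Norms are taken only in the degree \<open>n\<close> of the fundamental class, hence a
  single instance in that degree.\<close>

sublocale G: gset_measure \<Gamma> "singular_simplex_set n (top_of_set Mt)" "\<lambda>g. simplex_map n (dk g)" "simplex_map n p" \<nu> \<alpha>
proof -
  interpret G: free_gset \<Gamma> "singular_simplex_set n (top_of_set Mt)" "\<lambda>g. simplex_map n (dk g)" "simplex_map n p"
    by (rule simplices)
  show "gset_measure \<Gamma> (singular_simplex_set n (top_of_set Mt)) (\<lambda>g. simplex_map n (dk g)) (simplex_map n p) \<nu> \<alpha>"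
    by unfold_locales (use measurable distr group_action.composition_rule[OF action] in auto)
qed

lemma G_chains: "G.chains = D n"
  by (rule chains_eq)

lemma carrier_D: "c \<in> carrier (D k) \<longleftrightarrow> keys c \<subseteq> singular_simplex_set k (top_of_set Mt)"
  by (simp add: D_eq singular_chain_def)

lemma D_simps: "c \<otimes>\<^bsub>D k\<^esub> d = c + d" "\<one>\<^bsub>D k\<^esub> = 0" "act (D k) g = chain_map k (dk g)"
  by (simp_all add: D_eq)

sublocale twisted_complex \<Gamma> D
proof
  show "is_gmodule \<Gamma> (D k)" for k
    using free_gset.is_gmodule_chains[OF simplices] by (simp only: chains_eq)
  show "chain_boundary k \<in> equivariant_hom \<Gamma> (D k) (D (k - 1))" for k
    using singular_chain_boundary[of k "top_of_set Mt"] chain_boundary_chain_map[of k "top_of_set Mt"]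
    by (auto simp: equivariant_hom_def hom_def carrier_D D_simps chain_boundary_add singular_chain_def)
  show "chain_boundary k (chain_boundary (Suc k) c) = 0" if "c \<in> carrier (D (Suc k))" for k c
    using chain_boundary_boundary_alt[of k "top_of_set Mt" c] that by (simp add: carrier_D singular_chain_def)
qed (simp_all add: D_simps)

abbreviation "RC \<equiv> restrict_complex D C"

lemma RC_simps [simp]: "carrier (RC k) = C k" "c \<otimes>\<^bsub>RC k\<^esub> d = c + d" "\<one>\<^bsub>RC k\<^esub> = 0"
  "act (RC k) g = act (D k) g"
  by (simp_all add: restrict_complex_def D_simps)

lemma subgroup_C: "subgroup (C k) (D k)"
  using C by (simp add: gsubcomplex_def)

lemma C_subset: "C k \<subseteq> carrier (D k)"
  using subgroup.subset[OF subgroup_C] .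

lemma C_minus: "c \<in> C k \<Longrightarrow> - c \<in> C k"
proof -
  assume c: "c \<in> C k"
  have "inv\<^bsub>D k\<^esub> c = - c"
    by (rule group.inv_equality[OF is_gmoduleD(2)[OF is_gmodule_D]])
      (use subsetD[OF C_subset c] in \<open>auto simp: D_simps carrier_D keys_minus\<close>)
  then show ?thesis using subgroup.m_inv_closed[OF subgroup_C c] by simp
qed

lemma is_gmodule_RC: "is_gmodule \<Gamma> (RC k)"
  unfolding is_gmodule_def
proof (intro conjI ballI)
  show "comm_group (RC k)"
  proof (rule comm_groupI)
    show "\<exists>d\<in>carrier (RC k). d \<otimes>\<^bsub>RC k\<^esub> c = \<one>\<^bsub>RC k\<^esub>" if "c \<in> carrier (RC k)" for c
      by (rule bexI[of _ "- c"]) (use that C_minus in simp_all)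
  qed (use subgroup.m_closed[OF subgroup_C] subgroup.one_closed[OF subgroup_C] in \<open>simp_all add: D_simps ac_simps\<close>)
  fix g assume g: "g \<in> carrier \<Gamma>"
  show "act (RC k) g \<in> hom (RC k) (RC k)"
  proof (rule homI)
    show "act (RC k) g c \<in> carrier (RC k)" if "c \<in> carrier (RC k)" for c
      using C g that by (simp add: gsubcomplex_def)
    show "act (RC k) g (c \<otimes>\<^bsub>RC k\<^esub> d) = act (RC k) g c \<otimes>\<^bsub>RC k\<^esub> act (RC k) g d" for c d
      by (simp add: D_simps chain_map_add)
  qed
qed

lemma f_equivariant: "f k \<in> equivariant_hom \<Gamma> (D k) (RC k)"
  and f_boundary: "c \<in> carrier (D k) \<Longrightarrow> chain_boundary k (f k c) = f (k - 1) (chain_boundary k c)"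
  using f by (auto simp: gchain_homotopy_inverse_def gchain_map_def)

lemma f_equivariant_D: "f k \<in> equivariant_hom \<Gamma> (D k) (D k)"
  using f_equivariant[of k] C_subset[of k] by (auto simp: equivariant_hom_def hom_def D_simps)

lemma f_C: "c \<in> carrier (D k) \<Longrightarrow> f k c \<in> C k"
  using equivariant_homD(1)[OF f_equivariant] by simp

text \<open>Of the two homotopies, the one on the full complex: \<open>f\<close> followed by the
  inclusion is homotopic to the identity.\<close>

lemma homotopy:
  obtains h where "\<And>k. h k \<in> equivariant_hom \<Gamma> (D k) (D (Suc k))"
    "\<And>k c. c \<in> carrier (D k) \<Longrightarrow>
      f k c = c + (chain_boundary (Suc k) (h k c) + (if k = 0 then 0 else h (k - 1) (chain_boundary k c)))"
proof -
  obtain h where h: "\<forall>k. h k \<in> equivariant_hom \<Gamma> (D k) (D (Suc k)) \<and>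
        (\<forall>c\<in>carrier (D k). (id \<circ> f k) c - id c =
           chain_boundary (Suc k) (h k c) + (if k = 0 then 0 else h (k - 1) (chain_boundary k c)))"
    using f unfolding gchain_homotopy_inverse_def gchain_homotopic_def by blast
  show ?thesis
  proof (rule that)
    show "h k \<in> equivariant_hom \<Gamma> (D k) (D (Suc k))" for k using h by blast
    fix k c assume "c \<in> carrier (D k)"
    then have "f k c - c = chain_boundary (Suc k) (h k c) + (if k = 0 then 0 else h (k - 1) (chain_boundary k c))"
      using h by simp
    then show "f k c = c + (chain_boundary (Suc k) (h k c) + (if k = 0 then 0 else h (k - 1) (chain_boundary k c)))"
      by (metis add.commute diff_add_cancel)
  qed
qed

lemma represents_B: "G.represents B repB"
  unfolding G.represents_def
proof (intro conjI ballI)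
  show "integrable \<nu> (repB a)" if "a \<in> carrier B" for a
    using that B_subset_E integrable_repB by blast
qed (auto simp: is_gmodule_B repB_def)

lemma represents_L: "G.represents L repL"
  unfolding G.represents_def
  using is_gmodule_L integrable_repL repL_mult repL_act by blast

text \<open>Resolves the definite description: every reduced form has the value
  \<open>fnorm\<close>, as that is constant on classes, and \<open>reduced_representative\<close>
  supplies a reduced form.\<close>

lemma reduced_norm_eq:
  assumes A: "G.represents A rep" and I: "\<And>a. a \<in> carrier A \<Longrightarrow> I a = (\<integral>x. \<bar>rep a x\<bar> \<partial>\<nu>)"
    and u: "keys u \<subseteq> carrier A \<times> carrier (D n)"
  shows "reduced_norm \<Gamma> Mt p n A (D n) I (tensor_class \<Gamma> A (D n) u) = G.fnorm rep u"
  unfolding reduced_norm_def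
proof (rule the_equality)
  note gA = G.representsD(1)[OF A]
  interpret P: gmodule_pair \<Gamma> A "D n" by unfold_locales (use gA is_gmodule_D in auto)
  have red: "G.fnorm rep u = (\<Sum>j<m. I (a j))"
    if "reduced_form \<Gamma> Mt p n A (D n) m a \<sigma> (tensor_class \<Gamma> A (D n) u)" for m a \<sigma>
  proof -
    have a: "\<And>j. j < m \<Longrightarrow> a j \<in> carrier A" "\<And>j. j < m \<Longrightarrow> \<sigma> j \<in> singular_simplex_set n (top_of_set Mt)"
      "inj_on (\<lambda>j. simplex_map n p (\<sigma> j)) {..<m}"
      "u - (\<Sum>j<m. frag_of (a j, frag_of (\<sigma> j))) \<in> tensor_relations \<Gamma> A (D n)"
      using that by (auto simp: reduced_form_def P.class_eq)
    have "keys (\<Sum>j<m. frag_of (a j, frag_of (\<sigma> j))) \<subseteq> carrier A \<times> carrier (D n)"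
      by (rule G.keys_sum_frag_of) (use a in \<open>auto simp: carrier_D\<close>)
    then have "G.fnorm rep u = G.fnorm rep (\<Sum>j<m. frag_of (a j, frag_of (\<sigma> j)))"
      by (intro G.fnorm_cong[OF A]) (use a(4) u in \<open>simp_all add: G_chains\<close>)
    also have "\<dots> = (\<Sum>j<m. \<integral>x. \<bar>rep (a j) x\<bar> \<partial>\<nu>)"
      by (rule G.fnorm_reduced[OF A]) (use a in auto)
    finally show ?thesis using a I by simp
  qed
  show "r = G.fnorm rep u" if "\<exists>m a \<sigma>. reduced_form \<Gamma> Mt p n A (D n) m a \<sigma> (tensor_class \<Gamma> A (D n) u) \<and>
      r = (\<Sum>j<m. I (a j))" for r
    using that red by auto
  obtain T a where T: "finite T" "T \<subseteq> simplex_map n p ` singular_simplex_set n (top_of_set Mt)"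
    "\<And>s. s \<in> T \<Longrightarrow> a s \<in> carrier A"
    "u - (\<Sum>s\<in>T. frag_of (a s, frag_of (G.base s))) \<in> tensor_relations \<Gamma> A (D n)"
    by (rule G.reduced_representative[OF gA, unfolded G_chains, OF u]) (rule that)
  \<comment> \<open>Reduced forms are indexed by an initial segment of the naturals, so
    \<open>T\<close> is enumerated.\<close>
  obtain e where e: "bij_betw e {..<card T} T"
    using ex_bij_betw_nat_finite[OF T(1)] by (auto simp: atLeast0LessThan)
  have eT: "e j \<in> T" if "j < card T" for j using e that by (auto simp: bij_betw_def)
  have base: "G.base s \<in> singular_simplex_set n (top_of_set Mt)" "simplex_map n p (G.base s) = s" if "s \<in> T" for s
    using G.base[of s] T(2) that by auto
  have "reduced_form \<Gamma> Mt p n A (D n) (card T) (a \<circ> e) (G.base \<circ> e) (tensor_class \<Gamma> A (D n) u)"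
    unfolding reduced_form_def
  proof (intro conjI allI impI)
    show "(a \<circ> e) j \<in> carrier A" "singular_simplex n (top_of_set Mt) ((G.base \<circ> e) j)" if "j < card T" for j
      using T(3) base(1) eT[OF that] by auto
    show "inj_on (\<lambda>j. simplex_map n p ((G.base \<circ> e) j)) {..<card T}"
    proof (rule inj_onI)
      fix i j assume "i \<in> {..<card T}" "j \<in> {..<card T}"
        "simplex_map n p ((G.base \<circ> e) i) = simplex_map n p ((G.base \<circ> e) j)"
      then show "i = j" using base(2) eT e by (auto simp: bij_betw_def inj_on_def)
    qed
    have "(\<Sum>j<card T. frag_of ((a \<circ> e) j, frag_of ((G.base \<circ> e) j))) = (\<Sum>s\<in>T. frag_of (a s, frag_of (G.base s)))"
      using sum.reindex_bij_betw[OF e, of "\<lambda>s. frag_of (a s, frag_of (G.base s))"] by simp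
    then show "tensor_class \<Gamma> A (D n) u =
        tensor_class \<Gamma> A (D n) (\<Sum>j<card T. frag_of ((a \<circ> e) j, frag_of ((G.base \<circ> e) j)))"
      using T(4) by (simp add: P.class_eq)
  qed
  then show "\<exists>m a \<sigma>. reduced_form \<Gamma> Mt p n A (D n) m a \<sigma> (tensor_class \<Gamma> A (D n) u) \<and>
      G.fnorm rep u = (\<Sum>j<m. I (a j))"
    using red by blast
qed

lemma q_E: "a \<in> carrier E \<Longrightarrow> q a \<in> carrier L"
  by (simp add: carrier_L)

text \<open>The fibres agree almost everywhere, since the chosen representative of
  \<open>q b\<close> equals \<open>b\<close> off a null set.\<close>

lemma fnorm_lift_q:
  assumes v: "keys v \<subseteq> carrier B \<times> carrier (D n)"
  shows "G.fnorm repL (tensor_lift q id v) = G.fnorm repB v"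
proof (rule G.fnorm_AE_cong)
  show "integrable \<nu> (G.fibre repB v s)" for s
    using G.integrable_fibre[OF represents_B] v by (simp add: G_chains)
  have "keys (tensor_lift q id v) \<subseteq> carrier L \<times> carrier (D n)"
    by (rule keys_tensor_lift[OF v equivariant_homD(2)[OF q_equivariant]]) simp
  then show "integrable \<nu> (G.fibre repL (tensor_lift q id v) s)" for s
    using G.integrable_fibre[OF represents_L] by (simp add: G_chains)
  show "AE x in \<nu>. G.fibre repL (tensor_lift q id v) s x = G.fibre repB v s x" for s
    using v
  proof (induction v rule: frag_induction)
    case (one bc)
    then obtain b c where bc: "bc = (b, c)" "b \<in> carrier E" "c \<in> carrier (D n)" using B_subset_E by blast
    then show ?case
      using G.orb_AE_cong[OF repL_q[OF bc(2)], of c s] by (simp add: carrier_D)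
  next
    case (diff u v)
    then show ?case by eventually_elim (simp add: tensor_lift_diff G.fibre_diff)
  qed simp
qed

text \<open>Smallness is asked of the boundary of the error only. For one tensor with chain
  \<open>c\<close> that boundary is (q a - q b) \<otimes> (boundary of c), so \<open>c\<close> is
  kept and \<open>a\<close> is approximated. All \<open>\<epsilon>\<close> are treated at once to
  permit halving in the step for differences.\<close>

lemma approximate_chain:
  assumes e: "keys e \<subseteq> carrier L \<times> C (Suc n)"
  shows "\<forall>\<epsilon>>0. \<exists>e'. keys e' \<subseteq> carrier Sp \<times> C (Suc n) \<and>
    G.fnorm repL (tensor_lift id (chain_boundary (Suc n)) (e - tensor_lift q id e')) < \<epsilon>"
  using e
proof (induction e rule: free_Abelian_group_induct[consumes 1, case_names zero diff one])
  case zero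
  show ?case by (intro allI impI exI[of _ 0]) simp
next
  case (one Fc)
  then obtain a c where Fc: "Fc = (q a, c)" "a \<in> carrier E" "c \<in> C (Suc n)" by (auto simp: carrier_L)
  let ?b = "chain_boundary (Suc n) c"
  let ?l = "real_of_int (\<Sum>\<tau>\<in>keys ?b. \<bar>Poly_Mapping.lookup ?b \<tau>\<bar>)"
  have bS: "keys ?b \<subseteq> singular_simplex_set n (top_of_set Mt)"
    using equivariant_homD(1)[OF boundary_equivariant_Suc subsetD[OF C_subset Fc(3)]] by (simp add: carrier_D)
  define l where "l = ?l"
  have l: "l \<ge> 0" by (simp add: l_def sum_nonneg)
  show ?case
  proof (intro allI impI)
    fix \<epsilon> :: real assume \<epsilon>: "\<epsilon> > 0"
    \<comment> \<open>\<open>l\<close> is the l1-norm of the boundary of \<open>c\<close>; it may be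
      0, hence \<open>l + 1\<close>.\<close>
    then have "\<epsilon> / (l + 1) > 0" using l by simp
    then obtain b where b: "b \<in> carrier Sp" "(\<integral>x. \<bar>repB a x - repB b x\<bar> \<partial>\<nu>) < \<epsilon> / (l + 1)"
      using Sp_approx[OF Fc(2)] by metis
    have bE: "b \<in> carrier E" using b(1) Sp_subset_B B_subset_E by blast
    have eq: "(\<integral>x. \<bar>repL (q a) x - repL (q b) x\<bar> \<partial>\<nu>) = (\<integral>x. \<bar>repB a x - repB b x\<bar> \<partial>\<nu>)"
    proof (rule integral_cong_AE)
      show "(\<lambda>x. \<bar>repL (q a) x - repL (q b) x\<bar>) \<in> borel_measurable \<nu>"
        using integrable_repL[OF q_E[OF Fc(2)]] integrable_repL[OF q_E[OF bE]]
        by (intro borel_measurable_integrable Bochner_Integration.integrable_abs Bochner_Integration.integrable_diff)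
      show "(\<lambda>x. \<bar>repB a x - repB b x\<bar>) \<in> borel_measurable \<nu>"
        using integrable_repB[OF Fc(2)] integrable_repB[OF bE]
        by (intro borel_measurable_integrable Bochner_Integration.integrable_abs Bochner_Integration.integrable_diff)
      show "AE x in \<nu>. \<bar>repL (q a) x - repL (q b) x\<bar> = \<bar>repB a x - repB b x\<bar>"
        using repL_q[OF Fc(2)] repL_q[OF bE] by eventually_elim simp
    qed
    have "G.fnorm repL (frag_of (q a, ?b) - frag_of (q b, ?b)) \<le> l * (\<integral>x. \<bar>repL (q a) x - repL (q b) x\<bar> \<partial>\<nu>)"
      unfolding l_def by (rule G.fnorm_of_diff_le[OF represents_L q_E[OF Fc(2)] q_E[OF bE] bS])
    also have "\<dots> \<le> l * (\<epsilon> / (l + 1))"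
      unfolding eq using b(2) l by (intro mult_left_mono) auto
    also have "\<dots> < \<epsilon>"
      using \<epsilon> l by (simp add: field_simps)
    finally have "G.fnorm repL (frag_of (q a, ?b) - frag_of (q b, ?b)) < \<epsilon>" .
    then show "\<exists>e'. keys e' \<subseteq> carrier Sp \<times> C (Suc n) \<and>
      G.fnorm repL (tensor_lift id (chain_boundary (Suc n)) (frag_of Fc - tensor_lift q id e')) < \<epsilon>"
      by (intro exI[of _ "frag_of (b, c)"]) (use b Fc in \<open>simp add: tensor_lift_diff\<close>)
  qed
next
  case (diff u v)
  show ?case
  proof (intro allI impI)
    fix \<epsilon> :: real assume \<epsilon>: "\<epsilon> > 0"
    obtain u' where u': "keys u' \<subseteq> carrier Sp \<times> C (Suc n)"
      "G.fnorm repL (tensor_lift id (chain_boundary (Suc n)) (u - tensor_lift q id u')) < \<epsilon> / 2"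
      using diff(3) \<epsilon> by (meson half_gt_zero)
    obtain v' where v': "keys v' \<subseteq> carrier Sp \<times> C (Suc n)"
      "G.fnorm repL (tensor_lift id (chain_boundary (Suc n)) (v - tensor_lift q id v')) < \<epsilon> / 2"
      using diff(4) \<epsilon> by (meson half_gt_zero)
    have K: "keys (tensor_lift id (chain_boundary (Suc n)) (w - tensor_lift q id w')) \<subseteq> carrier L \<times> carrier (D n)"
      if w: "keys w \<subseteq> carrier L \<times> C (Suc n)" "keys w' \<subseteq> carrier Sp \<times> C (Suc n)" for w w'
    proof (rule keys_tensor_lift)
      have "q ` carrier Sp \<subseteq> carrier L" using q_E Sp_subset_B B_subset_E by blast
      then show "keys (w - tensor_lift q id w') \<subseteq> carrier L \<times> C (Suc n)"
        by (intro keys_diff_subset w(1) keys_tensor_lift[OF w(2)]) auto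
      show "chain_boundary (Suc n) ` C (Suc n) \<subseteq> carrier (D n)"
        using equivariant_homD(1)[OF boundary_equivariant_Suc] C_subset by blast
    qed simp
    have "(u - v) - tensor_lift q id (u' - v') = (u - tensor_lift q id u') - (v - tensor_lift q id v')"
      by (simp add: tensor_lift_diff)
    then have "G.fnorm repL (tensor_lift id (chain_boundary (Suc n)) ((u - v) - tensor_lift q id (u' - v'))) \<le>
      G.fnorm repL (tensor_lift id (chain_boundary (Suc n)) (u - tensor_lift q id u')) +
      G.fnorm repL (tensor_lift id (chain_boundary (Suc n)) (v - tensor_lift q id v'))"
      using G.fnorm_diff_le[OF represents_L, unfolded G_chains, OF K[OF diff(1) u'(1)] K[OF diff(2) v'(1)]]
      by (simp only: tensor_lift_diff)
    also have "\<dots> < \<epsilon>" using u'(2) v'(2) by simp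
    finally show "\<exists>e'. keys e' \<subseteq> carrier Sp \<times> C (Suc n) \<and>
      G.fnorm repL (tensor_lift id (chain_boundary (Suc n)) (u - v - tensor_lift q id e')) < \<epsilon>"
      using keys_diff_subset[OF u'(1) v'(1)] by blast
  qed
qed

end

text \<open>Empty sets are covered too: if \<open>P\<close> is empty then so is \<open>Q\<close>,
  and both infima are that of the empty set.\<close>

lemma cInf_eq_approx:
  fixes P Q :: "real set"
  assumes PQ: "\<And>r. r \<in> Q \<Longrightarrow> \<exists>l\<in>P. l \<le> r"
    and QP: "\<And>l \<epsilon>. \<lbrakk>l \<in> P; \<epsilon> > 0\<rbrakk> \<Longrightarrow> \<exists>r\<in>Q. r \<le> l + \<epsilon>"
    and bdd: "bdd_below P" "bdd_below Q"
  shows "Inf P = Inf Q"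
proof (cases "P = {}")
  case True
  then have "Q = {}" using PQ by blast
  then show ?thesis using True by simp
next
  case False
  then have Q: "Q \<noteq> {}" using QP[of _ 1] by fastforce
  show ?thesis
  proof (rule antisym)
    show "Inf P \<le> Inf Q" by (rule cInf_mono[OF Q bdd(1) PQ])
    show "Inf Q \<le> Inf P"
    proof (rule cInf_greatest[OF False])
      fix l assume l: "l \<in> P"
      show "Inf Q \<le> l"
      proof (rule field_le_epsilon)
        fix \<epsilon> :: real assume "\<epsilon> > 0"
        then obtain r where r: "r \<in> Q" "r \<le> l + \<epsilon>" using QP[OF l] by blast
        then show "Inf Q \<le> l + \<epsilon>" using cInf_lower2[OF r bdd(2)] by simp
      qed
    qed
  qed
qed

section \<open>The two inequalities\<close>

context equivariant_subcomplex
begin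

lemma Z_const: "q \<circ> const_function \<nu> \<in> equivariant_hom \<Gamma> trivial_module L"
  by (rule equivariant_hom_compose[OF const_equivariant q_equivariant])

lemma carrier_Z: "carrier (trivial_module :: (int, 'g) gmodule) = UNIV"
  by (simp add: trivial_module_def)

text \<open>Both maps are inclusions, so the same formal sum represents the class before and after;
  only the relations divided out grow.\<close>

lemma Sigma_to_strict_class:
  assumes u: "keys u \<subseteq> carrier Sp \<times> C n"
  shows "tensor_map \<Gamma> B (D n) id id (tensor_class \<Gamma> Sp (RC n) u) = tensor_class \<Gamma> B (D n) u"
proof -
  interpret P: gmodule_pair \<Gamma> B "D n" by unfold_locales (use is_gmodule_B is_gmodule_D in auto)
  have 1: "id \<in> equivariant_hom \<Gamma> Sp B"
    using Sp_subset_B by (auto simp: equivariant_hom_def hom_def)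
  have 2: "id \<in> equivariant_hom \<Gamma> (RC n) (D n)"
    using C_subset[of n] by (auto simp: equivariant_hom_def hom_def D_simps)
  show ?thesis
    using P.tensor_map_class[OF is_gmodule_Sp is_gmodule_RC 1 2, of u] by (simp add: tensor_lift_id[OF u])
qed

text \<open>Apply \<open>q\<close> to the coefficients in the equation between \<open>u\<close>,
  \<open>w\<close> and \<open>d\<close>; the integral part keeps the same \<open>w\<close>.\<close>

lemma parametrised_cycle_of_strict:
  assumes u: "keys u \<subseteq> carrier B \<times> carrier (D n)"
    and cyc: "tensor_class \<Gamma> B (D n) u \<in> cycles_representing \<Gamma> D p n m B (const_function \<nu>)"
  shows "tensor_class \<Gamma> L (D n) (tensor_lift q id u) \<in> cycles_representing \<Gamma> D p n m L (q \<circ> const_function \<nu>)"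
proof -
  interpret P: gmodule_pair \<Gamma> L "D n" by unfold_locales (use is_gmodule_L is_gmodule_D in auto)
  note qB = equivariant_homD(2)[OF q_equivariant]
  obtain w d where w: "keys w \<subseteq> UNIV \<times> carrier (D n)"
    "tensor_lift id (chain_boundary n) w \<in> tensor_relations \<Gamma> trivial_module (D (n - 1))"
    "push_down p n (tensor_class \<Gamma> trivial_module (D n) w) \<in> m"
    and d: "keys d \<subseteq> carrier B \<times> carrier (D (Suc n))"
    "u - tensor_lift (const_function \<nu>) id w - tensor_lift id (chain_boundary (Suc n)) d \<in> tensor_relations \<Gamma> B (D n)"
    using cyc unfolding cycles_representing_iff[OF is_gmodule_B is_gmodule_trivial const_equivariant u] by blast
  have ku: "keys (tensor_lift q id u) \<subseteq> carrier L \<times> carrier (D n)"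
    by (rule keys_tensor_lift[OF u qB]) simp
  have kd: "keys (tensor_lift q id d) \<subseteq> carrier L \<times> carrier (D (Suc n))"
    by (rule keys_tensor_lift[OF d(1) qB]) simp
  have "tensor_lift q id (u - tensor_lift (const_function \<nu>) id w - tensor_lift id (chain_boundary (Suc n)) d)
      \<in> tensor_relations \<Gamma> L (D n)"
    by (rule P.tensor_lift_relations[OF is_gmodule_B is_gmodule_D q_equivariant equivariant_hom_id d(2)])
  then have "tensor_lift q id u - tensor_lift (q \<circ> const_function \<nu>) id w -
      tensor_lift id (chain_boundary (Suc n)) (tensor_lift q id d) \<in> tensor_relations \<Gamma> L (D n)"
    by (simp add: tensor_lift_diff tensor_lift_compose)
  then show ?thesis
    unfolding cycles_representing_iff[OF is_gmodule_L is_gmodule_trivial Z_const ku]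
    using w kd by blast
qed

lemma strict_cycle_near_parametrised:
  assumes u: "keys u \<subseteq> carrier L \<times> carrier (D n)"
    and cyc: "tensor_class \<Gamma> L (D n) u \<in> cycles_representing \<Gamma> D p n m L (q \<circ> const_function \<nu>)"
    and \<epsilon>: "\<epsilon> > 0"
  obtains u' where "keys u' \<subseteq> carrier Sp \<times> C n"
    "tensor_class \<Gamma> B (D n) u' \<in> cycles_representing \<Gamma> D p n m B (const_function \<nu>)"
    "G.fnorm repB u' \<le> G.fnorm repL u + \<epsilon>"
proof -
  let ?bd = "tensor_lift id (chain_boundary (Suc n))"
  interpret PL: gmodule_pair \<Gamma> L "D n" by unfold_locales (use is_gmodule_L is_gmodule_D in auto)
  interpret PB: gmodule_pair \<Gamma> B "D n" by unfold_locales (use is_gmodule_B is_gmodule_D in auto)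
  interpret PZ: gmodule_pair \<Gamma> "trivial_module :: (int, 'g) gmodule" "D n"
    by unfold_locales (use is_gmodule_trivial is_gmodule_D in auto)
  obtain h where h: "\<And>k. h k \<in> equivariant_hom \<Gamma> (D k) (D (Suc k))"
    "\<And>k c. c \<in> carrier (D k) \<Longrightarrow>
      f k c = c + (chain_boundary (Suc k) (h k c) + (if k = 0 then 0 else h (k - 1) (chain_boundary k c)))"
    by (rule homotopy) (rule that)
  obtain w d where w: "keys w \<subseteq> UNIV \<times> carrier (D n)"
    "tensor_lift id (chain_boundary n) w \<in> tensor_relations \<Gamma> trivial_module (D (n - 1))"
    "push_down p n (tensor_class \<Gamma> trivial_module (D n) w) \<in> m"
    and d: "keys d \<subseteq> carrier L \<times> carrier (D (Suc n))"
    "u - tensor_lift (q \<circ> const_function \<nu>) id w - ?bd d \<in> tensor_relations \<Gamma> L (D n)"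
    using cyc unfolding cycles_representing_iff[OF is_gmodule_L is_gmodule_trivial Z_const u] by blast
  \<comment> \<open>On a reduced form the norm is an exact sum over simplices. On an arbitrary
    formal sum a bound term by term would lose the cancellations.\<close>
  obtain T a where T: "finite T" "T \<subseteq> simplex_map n p ` singular_simplex_set n (top_of_set Mt)"
    "\<And>s. s \<in> T \<Longrightarrow> a s \<in> carrier L"
    "u - (\<Sum>s\<in>T. frag_of (a s, frag_of (G.base s))) \<in> tensor_relations \<Gamma> L (D n)"
    by (rule G.reduced_representative[OF is_gmodule_L, unfolded G_chains, OF u]) (rule that)
  define u0 where "u0 = (\<Sum>s\<in>T. frag_of (a s, frag_of (G.base s)))"
  define u1 where "u1 = tensor_lift id (f n) u0"
  define w' where "w' = tensor_lift id (f n) w"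
  define e where "e = tensor_lift id (f (Suc n)) d"
  have bS: "G.base s \<in> singular_simplex_set n (top_of_set Mt)" "simplex_map n p (G.base s) = s" if "s \<in> T" for s
    using G.base[of s] T(2) that by auto
  have ku0: "keys u0 \<subseteq> carrier L \<times> carrier (D n)"
    unfolding u0_def by (rule G.keys_sum_frag_of) (use T bS in \<open>auto simp: carrier_D\<close>)
  have fD: "f k ` carrier (D k) \<subseteq> C k" "f k ` carrier (D k) \<subseteq> carrier (D k)" for k
    using f_C C_subset by blast+
  have ku1: "keys u1 \<subseteq> carrier L \<times> carrier (D n)"
    unfolding u1_def by (rule keys_tensor_lift[OF ku0 _ fD(2)]) simp
  have ke: "keys e \<subseteq> carrier L \<times> C (Suc n)"
    unfolding e_def by (rule keys_tensor_lift[OF d(1) _ fD(1)]) simp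
  have kw': "keys w' \<subseteq> UNIV \<times> C n"
    unfolding w'_def by (rule keys_tensor_lift[OF w(1) _ fD(1)]) simp
  have fn0: "G.fnorm repL u0 = G.fnorm repL u"
    by (rule G.fnorm_cong[OF represents_L, symmetric]) (use T(4) u ku0 in \<open>simp_all add: G_chains u0_def\<close>)
  have fn1: "G.fnorm repL u1 \<le> G.fnorm repL u0"
  proof -
    have u1_eq: "u1 = (\<Sum>s\<in>T. frag_of (a s, f n (frag_of (G.base s))))"
      unfolding u1_def u0_def tensor_lift_def by (simp add: frag_extend_sum[OF T(1)])
    \<comment> \<open>A single simplex has l1-norm 1, so its image under \<open>f\<close> has
      l1-norm at most 1.\<close>
    have l1: "real_of_int (\<Sum>\<tau>\<in>keys (f n (frag_of (G.base s))).
        \<bar>Poly_Mapping.lookup (f n (frag_of (G.base s))) \<tau>\<bar>) \<le> 1" if "s \<in> T" for s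
    proof -
      have "l1_norm (f n (frag_of (G.base s))) \<le> l1_norm (frag_of (G.base s))"
        using f_norm bS[OF that] unfolding norm_at_most_1_def by (simp add: carrier_D)
      then have "(\<Sum>\<tau>\<in>keys (f n (frag_of (G.base s))).
          \<bar>Poly_Mapping.lookup (f n (frag_of (G.base s))) \<tau>\<bar>) \<le> 1" by (simp add: l1_norm_def)
      then show ?thesis by (simp only: of_int_le_1_iff)
    qed
    have "G.fnorm repL u1 \<le> (\<Sum>s\<in>T. real_of_int (\<Sum>\<tau>\<in>keys (f n (frag_of (G.base s))).
        \<bar>Poly_Mapping.lookup (f n (frag_of (G.base s))) \<tau>\<bar>) * (\<integral>x. \<bar>repL (a s) x\<bar> \<partial>\<nu>))"
      unfolding u1_eq
    proof (rule G.fnorm_sum_le[OF represents_L T(1) T(3)])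
      fix s assume "s \<in> T"
      then have "frag_of (G.base s) \<in> carrier (D n)" using bS by (simp add: carrier_D)
      then show "keys (f n (frag_of (G.base s))) \<subseteq> singular_simplex_set n (top_of_set Mt)"
        using fD(2)[of n] unfolding carrier_D[symmetric] by blast
    qed
    also have "\<dots> \<le> (\<Sum>s\<in>T. 1 * (\<integral>x. \<bar>repL (a s) x\<bar> \<partial>\<nu>))"
      by (intro sum_mono mult_right_mono l1) auto
    also have "\<dots> = G.fnorm repL u0"
      unfolding u0_def
      by (subst G.fnorm_reduced[OF represents_L T(1)]) (use T bS in \<open>auto simp: inj_on_def\<close>)
    finally show ?thesis .
  qed
  \<comment> \<open>Apply \<open>f\<close> to the equation for \<open>u\<close>, with
    \<open>u0\<close> in place of \<open>u\<close>; \<open>f\<close> commutes with the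
    boundary.\<close>
  have rel1: "u1 - tensor_lift (q \<circ> const_function \<nu>) id w' - ?bd e \<in> tensor_relations \<Gamma> L (D n)"
  proof -
    have "u0 - tensor_lift (q \<circ> const_function \<nu>) id w - ?bd d \<in> tensor_relations \<Gamma> L (D n)"
      using PL.relations_diff[OF d(2) T(4)] unfolding u0_def by (simp add: algebra_simps)
    then have "tensor_lift id (f n) (u0 - tensor_lift (q \<circ> const_function \<nu>) id w - ?bd d) \<in> tensor_relations \<Gamma> L (D n)"
      by (rule PL.tensor_lift_relations[OF is_gmodule_L is_gmodule_D equivariant_hom_id f_equivariant_D])
    moreover have "tensor_lift id (f n) (?bd d) = ?bd e"
      unfolding e_def tensor_lift_compose
      by (rule tensor_lift_cong[OF d(1)]) (use f_boundary[of _ "Suc n"] in auto)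
    ultimately show ?thesis
      by (simp add: tensor_lift_diff tensor_lift_compose u1_def w'_def)
  qed
  obtain e' where e': "keys e' \<subseteq> carrier Sp \<times> C (Suc n)"
    "G.fnorm repL (?bd (e - tensor_lift q id e')) < \<epsilon>"
    using approximate_chain[OF ke] \<epsilon> by blast
  have ke'B: "keys e' \<subseteq> carrier B \<times> carrier (D (Suc n))"
    using e'(1) Sp_subset_B C_subset[of "Suc n"] by blast
  have ke'L: "keys (tensor_lift q id e') \<subseteq> carrier L \<times> carrier (D (Suc n))"
    by (rule keys_tensor_lift[OF ke'B equivariant_homD(2)[OF q_equivariant]]) simp
  \<comment> \<open>The constant part already has coefficients in the span; only the boundary part
    is exchanged, which cannot change the homology class.\<close>
  define u' where "u' = tensor_lift (const_function \<nu>) id w' + ?bd e'"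
  have bdC: "chain_boundary (Suc n) ` C (Suc n) \<subseteq> C n"
    using C unfolding gsubcomplex_def by force
  have ku': "keys u' \<subseteq> carrier Sp \<times> C n"
    unfolding u'_def
    by (intro keys_add_subset keys_tensor_lift[OF kw'] keys_tensor_lift[OF e'(1)] bdC) (auto simp: Sp_const)
  have ku'B: "keys u' \<subseteq> carrier B \<times> carrier (D n)"
    using ku' Sp_subset_B C_subset[of n] by blast
  \<comment> \<open>The homotopy formula for \<open>w\<close>. Its last term, \<open>h\<close> of
    the boundary of \<open>w\<close>, is a relation and not literally 0, because \<open>w\<close> is
    a cycle only modulo relations.\<close>
  have relZ: "w' - w - ?bd (tensor_lift id (h n) w) \<in> tensor_relations \<Gamma> trivial_module (D n)"
  proof -
    \<comment> \<open>In degree 0 the homotopy formula lacks its second summand.\<close>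
    define g where "g = (\<lambda>c. if n = 0 then 0 else h (n - 1) (chain_boundary n c))"
    have gD: "g ` carrier (D n) \<subseteq> carrier (D n)"
    proof (cases n)
      case 0
      then show ?thesis by (auto simp: g_def carrier_D)
    next
      case (Suc j)
      then show ?thesis
        using equivariant_homD(1)[OF h(1)[of j]] equivariant_homD(1)[OF boundary_equivariant_Suc[of j]]
        by (auto simp: g_def)
    qed
    have hD: "(chain_boundary (Suc n) \<circ> h n) ` carrier (D n) \<subseteq> carrier (D n)"
      using equivariant_homD(1)[OF h(1)[of n]] equivariant_homD(1)[OF boundary_equivariant_Suc[of n]] by auto
    have sD: "(\<lambda>c. (chain_boundary (Suc n) \<circ> h n) c + g c) ` carrier (D n) \<subseteq> carrier (D n)"
    proof -
      have "c + c' \<in> carrier (D n)" if "c \<in> carrier (D n)" "c' \<in> carrier (D n)" for c c'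
        using is_gmoduleD(3)[OF is_gmodule_D that] by (simp add: mult_D)
      then show ?thesis using gD hD by blast
    qed
    have 1: "tensor_lift id (f n) w - tensor_lift id id w -
        tensor_lift id (\<lambda>c. (chain_boundary (Suc n) \<circ> h n) c + g c) w \<in> tensor_relations \<Gamma> trivial_module (D n)"
      by (rule PZ.tensor_lift_right_add[OF w(1) _ _ sD]) (auto simp: carrier_Z mult_D h(2) g_def)
    have 2: "tensor_lift id (\<lambda>c. (chain_boundary (Suc n) \<circ> h n) c + g c) w -
        tensor_lift id (chain_boundary (Suc n) \<circ> h n) w - tensor_lift id g w \<in> tensor_relations \<Gamma> trivial_module (D n)"
      by (rule PZ.tensor_lift_right_add[OF w(1) _ hD gD]) (auto simp: carrier_Z mult_D)
    have 3: "tensor_lift id g w \<in> tensor_relations \<Gamma> trivial_module (D n)"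
    proof (cases n)
      case 0
      show ?thesis
        by (rule PZ.tensor_lift_right_0[OF w(1)]) (auto simp: carrier_Z g_def 0 one_D)
    next
      case (Suc j)
      have hj: "h j \<in> equivariant_hom \<Gamma> (D j) (D n)" using h(1)[of j] by (simp add: Suc)
      have "tensor_lift id (h j) (tensor_lift id (chain_boundary n) w) \<in> tensor_relations \<Gamma> trivial_module (D n)"
        by (rule PZ.tensor_lift_relations[OF is_gmodule_trivial is_gmodule_D equivariant_hom_id hj])
          (use w(2) Suc in simp)
      moreover have "g = h j \<circ> chain_boundary n" by (simp add: g_def Suc fun_eq_iff)
      ultimately show ?thesis by (simp add: tensor_lift_compose)
    qed
    have "w' - w - ?bd (tensor_lift id (h n) w) =
      (tensor_lift id (f n) w - tensor_lift id id w - tensor_lift id (\<lambda>c. (chain_boundary (Suc n) \<circ> h n) c + g c) w) +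
      (tensor_lift id (\<lambda>c. (chain_boundary (Suc n) \<circ> h n) c + g c) w -
        tensor_lift id (chain_boundary (Suc n) \<circ> h n) w - tensor_lift id g w) + tensor_lift id g w"
      unfolding w'_def tensor_lift_compose tensor_lift_id[OF w(1)] by simp
    then show ?thesis using PZ.relations_add[OF PZ.relations_add[OF 1 2] 3] by simp
  qed
  show ?thesis
  proof (rule that[OF ku'])
    \<comment> \<open>\<open>u'\<close> is the integral cycle \<open>w\<close> plus the boundary of
      \<open>d'\<close>: the homotopy applied to \<open>w\<close> accounts for passing from
      \<open>w\<close> to \<open>w'\<close>, and \<open>e'\<close> for the approximated part. So
      \<open>u'\<close> represents the same class as \<open>u\<close>.\<close>
    define d' where "d' = tensor_lift (const_function \<nu>) id (tensor_lift id (h n) w) + e'"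
    have kd': "keys d' \<subseteq> carrier B \<times> carrier (D (Suc n))"
      unfolding d'_def
    proof (intro keys_add_subset ke'B)
      have "keys (tensor_lift id (h n) w) \<subseteq> UNIV \<times> carrier (D (Suc n))"
        by (rule keys_tensor_lift[OF w(1) _ equivariant_homD(2)[OF h(1)]]) simp
      then show "keys (tensor_lift (const_function \<nu>) id (tensor_lift id (h n) w)) \<subseteq> carrier B \<times> carrier (D (Suc n))"
        by (rule keys_tensor_lift) (use Sp_const Sp_subset_B in auto)
    qed
    have "tensor_lift (const_function \<nu>) id (w' - w - ?bd (tensor_lift id (h n) w)) \<in> tensor_relations \<Gamma> B (D n)"
      by (rule PB.tensor_lift_relations[OF is_gmodule_trivial is_gmodule_D const_equivariant equivariant_hom_id relZ])
    then have "u' - tensor_lift (const_function \<nu>) id w - ?bd d' \<in> tensor_relations \<Gamma> B (D n)"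
      by (simp add: u'_def d'_def tensor_lift_diff tensor_lift_add tensor_lift_compose algebra_simps)
    then show "tensor_class \<Gamma> B (D n) u' \<in> cycles_representing \<Gamma> D p n m B (const_function \<nu>)"
      unfolding cycles_representing_iff[OF is_gmodule_B is_gmodule_trivial const_equivariant ku'B]
      using w kd' by blast
    have bdD: "chain_boundary (Suc n) ` carrier (D (Suc n)) \<subseteq> carrier (D n)"
      by (rule equivariant_homD(2)[OF boundary_equivariant_Suc])
    have keD: "keys e \<subseteq> carrier L \<times> carrier (D (Suc n))"
      using ke C_subset[of "Suc n"] by blast
    have kbd: "keys (?bd (e - tensor_lift q id e')) \<subseteq> carrier L \<times> carrier (D n)"
      by (rule keys_tensor_lift[OF keys_diff_subset[OF keD ke'L] _ bdD]) simp
    have kq: "keys (tensor_lift q id u') \<subseteq> carrier L \<times> carrier (D n)"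
      by (rule keys_tensor_lift[OF ku'B equivariant_homD(2)[OF q_equivariant]]) simp
    \<comment> \<open>Over the essentially bounded classes, \<open>u'\<close> differs from
      \<open>u1\<close> only by the boundary of the approximation error, up to relations.\<close>
    have "tensor_lift q id u' - (u1 - ?bd (e - tensor_lift q id e')) =
        - (u1 - tensor_lift (q \<circ> const_function \<nu>) id w' - ?bd e)"
      by (simp add: u'_def tensor_lift_add tensor_lift_diff tensor_lift_compose algebra_simps)
    then have relq: "tensor_lift q id u' - (u1 - ?bd (e - tensor_lift q id e')) \<in> tensor_relations \<Gamma> L (D n)"
      using PL.relations_minus[OF rel1] by (simp only:)
    have "G.fnorm repB u' = G.fnorm repL (tensor_lift q id u')"
      using fnorm_lift_q[OF ku'B] by simp
    also have "\<dots> = G.fnorm repL (u1 - ?bd (e - tensor_lift q id e'))"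
      by (rule G.fnorm_cong[OF represents_L, unfolded G_chains, OF relq kq keys_diff_subset[OF ku1 kbd]])
    also have "\<dots> \<le> G.fnorm repL u1 + G.fnorm repL (?bd (e - tensor_lift q id e'))"
      by (rule G.fnorm_diff_le[OF represents_L, unfolded G_chains, OF ku1 kbd])
    also have "\<dots> \<le> G.fnorm repL u + \<epsilon>"
      using fn0 fn1 e'(2) by simp
    finally show "G.fnorm repB u' \<le> G.fnorm repL u + \<epsilon>" .
  qed
qed

lemma Linf_norm_class:
  "keys u \<subseteq> carrier L \<times> carrier (D n) \<Longrightarrow>
    reduced_norm \<Gamma> Mt p n L (D n) (Linf_abs_integral \<nu>) (tensor_class \<Gamma> L (D n) u) = G.fnorm repL u"
  by (rule reduced_norm_eq[OF represents_L abs_integral_repL])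

lemma strict_norm_class:
  "keys u \<subseteq> carrier B \<times> carrier (D n) \<Longrightarrow>
    reduced_norm \<Gamma> Mt p n B (D n) (abs_integral \<nu>) (tensor_class \<Gamma> B (D n) u) = G.fnorm repB u"
  by (rule reduced_norm_eq[OF represents_B abs_integral_repB])

lemma parametrised_simplicial_volume_eq:
  "parametrised_simplicial_volume \<Gamma> Mt D p n m \<alpha> \<nu> =
    (INF c \<in> {c \<in> carrier (tensor \<Gamma> Sp (RC n)).
        tensor_map \<Gamma> B (D n) id id c \<in> cycles_representing \<Gamma> D p n m B (const_function \<nu>)}.
      reduced_norm \<Gamma> Mt p n B (D n) (abs_integral \<nu>) (tensor_map \<Gamma> B (D n) id id c))"
  unfolding parametrised_simplicial_volume_def Linf_constant_eq
proof (rule cInf_eq_approx)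
  interpret PS: gmodule_pair \<Gamma> Sp "RC n" by unfold_locales (use is_gmodule_Sp is_gmodule_RC in auto)
  let ?P = "cycles_representing \<Gamma> D p n m L (q \<circ> const_function \<nu>)"
  let ?S = "{c \<in> carrier (tensor \<Gamma> Sp (RC n)).
        tensor_map \<Gamma> B (D n) id id c \<in> cycles_representing \<Gamma> D p n m B (const_function \<nu>)}"
  let ?NL = "reduced_norm \<Gamma> Mt p n L (D n) (Linf_abs_integral \<nu>)"
  let ?NB = "\<lambda>c. reduced_norm \<Gamma> Mt p n B (D n) (abs_integral \<nu>) (tensor_map \<Gamma> B (D n) id id c)"
  have S: "\<exists>u. keys u \<subseteq> carrier Sp \<times> C n \<and> c = tensor_class \<Gamma> Sp (RC n) u" if "c \<in> ?S" for c
    using that by (auto simp: PS.carrier_tensor)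
  have k: "keys u \<subseteq> carrier B \<times> carrier (D n)" if "keys u \<subseteq> carrier Sp \<times> C n" for u
    using that Sp_subset_B C_subset[of n] by blast
  have kL: "keys (tensor_lift q id u) \<subseteq> carrier L \<times> carrier (D n)"
    if "keys u \<subseteq> carrier Sp \<times> C n" for u
    by (rule keys_tensor_lift[OF k[OF that] equivariant_homD(2)[OF q_equivariant]]) simp
  show "\<exists>l\<in>?NL ` ?P. l \<le> r" if r: "r \<in> ?NB ` ?S" for r
  proof -
    obtain c where c: "c \<in> ?S" "r = ?NB c" using r by blast
    then obtain u where u: "keys u \<subseteq> carrier Sp \<times> C n" "c = tensor_class \<Gamma> Sp (RC n) u"
      using S by blast
    have "r = ?NL (tensor_class \<Gamma> L (D n) (tensor_lift q id u))"
      unfolding c(2) u(2) Sigma_to_strict_class[OF u(1)] strict_norm_class[OF k[OF u(1)]]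
        Linf_norm_class[OF kL[OF u(1)]] fnorm_lift_q[OF k[OF u(1)]] ..
    moreover have "tensor_class \<Gamma> L (D n) (tensor_lift q id u) \<in> ?P"
      using c(1) unfolding u(2) mem_Collect_eq Sigma_to_strict_class[OF u(1)]
      by (intro parametrised_cycle_of_strict[OF k[OF u(1)]]) blast
    ultimately show ?thesis by blast
  qed
  show "\<exists>r\<in>?NB ` ?S. r \<le> l + \<epsilon>" if l: "l \<in> ?NL ` ?P" and \<epsilon>: "\<epsilon> > 0" for l \<epsilon>
  proof -
    obtain \<xi> where \<xi>: "\<xi> \<in> ?P" "l = ?NL \<xi>" using l by blast
    obtain u where u: "keys u \<subseteq> carrier L \<times> carrier (D n)" "\<xi> = tensor_class \<Gamma> L (D n) u"
      by (rule cycles_representing_carrier[OF is_gmodule_L \<xi>(1)])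
    obtain u' where u': "keys u' \<subseteq> carrier Sp \<times> C n"
      "tensor_class \<Gamma> B (D n) u' \<in> cycles_representing \<Gamma> D p n m B (const_function \<nu>)"
      "G.fnorm repB u' \<le> G.fnorm repL u + \<epsilon>"
      by (rule strict_cycle_near_parametrised[OF u(1) \<xi>(1)[unfolded u(2)] \<epsilon>])
    have "tensor_class \<Gamma> Sp (RC n) u' \<in> ?S"
      unfolding mem_Collect_eq Sigma_to_strict_class[OF u'(1)] PS.carrier_tensor using u'(1,2) by auto
    moreover have "?NB (tensor_class \<Gamma> Sp (RC n) u') \<le> l + \<epsilon>"
      unfolding \<xi>(2) u(2) Sigma_to_strict_class[OF u'(1)] strict_norm_class[OF k[OF u'(1)]] Linf_norm_class[OF u(1)]
      by (rule u'(3))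
    ultimately show ?thesis by blast
  qed
  show "bdd_below (?NL ` ?P)"
  proof (rule bdd_belowI2)
    fix \<xi> assume \<xi>: "\<xi> \<in> ?P"
    obtain u where u: "keys u \<subseteq> carrier L \<times> carrier (D n)" "\<xi> = tensor_class \<Gamma> L (D n) u"
      by (rule cycles_representing_carrier[OF is_gmodule_L \<xi>])
    show "0 \<le> ?NL \<xi>" unfolding u(2) Linf_norm_class[OF u(1)] by (rule G.fnorm_nonneg)
  qed
  show "bdd_below (?NB ` ?S)"
  proof (rule bdd_belowI2)
    fix c assume "c \<in> ?S"
    then obtain u where u: "keys u \<subseteq> carrier Sp \<times> C n" "c = tensor_class \<Gamma> Sp (RC n) u"
      using S by blast
    show "0 \<le> ?NB c"
      unfolding u(2) Sigma_to_strict_class[OF u(1)] strict_norm_class[OF k[OF u(1)]] by (rule G.fnorm_nonneg)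
  qed
qed

end

section \<open>Instantiation for the universal covering\<close>

lemma deck_free_gset:
  assumes "closed_manifold n M" "covering_space Mt p M" "simply_connected Mt" "y \<in> Mt"
    "\<Gamma> = fundamental_group M (p y)" "group \<Gamma>"
  shows "free_gset \<Gamma> (singular_simplex_set k (top_of_set Mt)) (\<lambda>g. simplex_map k (deck Mt p y g)) (simplex_map k p)"
proof (rule free_gset.intro)
  show "\<exists>g\<in>carrier \<Gamma>. simplex_map k (deck Mt p y g) \<sigma> = \<tau>"
    if "\<sigma> \<in> singular_simplex_set k (top_of_set Mt)" "\<tau> \<in> singular_simplex_set k (top_of_set Mt)"
      "simplex_map k p \<sigma> = simplex_map k p \<tau>" for \<sigma> \<tau>
    using simplex_deck_transitive[OF assms] that by (metis mem_Collect_eq)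
qed (use singular_simplex_deck[OF assms] simplex_map_deck_mult[OF assms] simplex_deck_free[OF assms] assms(6) in auto)

text \<open>These objects depend only on the underlying set and its sigma-algebra, so they can be
  formed over \<open>\<nu>\<close> in place of \<open>X\<close>.\<close>

lemma modules_cong:
  assumes "sets \<nu> = sets X"
  shows "bounded_module X \<alpha> = bounded_module \<nu> \<alpha>" "span_module X \<alpha> \<A> = span_module \<nu> \<alpha> \<A>"
    "const_function X = const_function \<nu>"
proof -
  have sp: "space X = space \<nu>" using assms by (metis sets_eq_imp_space_eq)
  have me: "measurable X (count_space UNIV) = measurable \<nu> (count_space UNIV)"
    using measurable_cong_sets[OF assms refl] by auto
  show "bounded_module X \<alpha> = bounded_module \<nu> \<alpha>"
    unfolding bounded_module_def function_module_def sp me by (rule refl)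
  then show "span_module X \<alpha> \<A> = span_module \<nu> \<alpha> \<A>" by (simp add: span_module_def)
  show "const_function X = const_function \<nu>" unfolding const_function_def sp by (rule refl)
qed

theorem proposition4p5:
  fixes n :: nat
    and M :: "'a::topological_space set" and ort :: "'a \<Rightarrow> 'a chain set"
    and Mt :: "'b::topological_space set" and p :: "'b \<Rightarrow> 'a" and y :: 'b
    and \<Gamma> :: "(real \<Rightarrow> 'a) set monoid"
    and D :: "nat \<Rightarrow> ('b chain, (real \<Rightarrow> 'a) set) gmodule"
    and C :: "nat \<Rightarrow> 'b chain set"
    and X :: "'x measure" and \<alpha> :: "(real \<Rightarrow> 'a) set \<Rightarrow> 'x \<Rightarrow> 'x" and \<A> :: "'x set set"
  assumes "closed_manifold n M" and "connected M" and "orientation n M ort"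
    and "covering_space Mt p M" and "simply_connected Mt" and "y \<in> Mt"
    and "\<Gamma> = fundamental_group M (p y)"
    and "D = singular_complex Mt p y"
    and "gsubcomplex \<Gamma> D C" and "\<forall>k. countable (C k)"
    and "\<exists>f. gchain_homotopy_inverse \<Gamma> (restrict_complex D C) D (\<lambda>k. id) f \<and> norm_at_most_1 D f"
    and "standard_action \<Gamma> X \<alpha>"
    and "algebra (space X) \<A>" and "\<A> \<subseteq> sets X" and "countable \<A>"
    and "\<forall>g\<in>carrier \<Gamma>. \<forall>A\<in>\<A>. \<alpha> g ` A \<in> \<A>"
    and "\<forall>\<mu>. prob_space \<mu> \<and> sets \<mu> = sets X \<longrightarrow> dense_subalgebra \<A> \<mu>"
  shows "\<forall>\<nu>. invariant_prob \<Gamma> X \<alpha> \<nu> \<longrightarrow>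
    parametrised_simplicial_volume \<Gamma> Mt D p n (fundamental_class n M ort) \<alpha> \<nu> =
    (INF c \<in> {c \<in> carrier (Sigma_chains \<Gamma> D C X \<alpha> \<A> n).
        Sigma_to_strict \<Gamma> D X \<alpha> n c
          \<in> strict_fundamental_cycles \<Gamma> D p n (fundamental_class n M ort) X \<alpha>}.
      strict_norm \<Gamma> Mt D p n X \<alpha> \<nu> (Sigma_to_strict \<Gamma> D X \<alpha> n c))"
proof (intro allI impI)
  fix \<nu> :: "'x measure" assume inv: "invariant_prob \<Gamma> X \<alpha> \<nu>"
  then have \<nu>: "prob_space \<nu>" "sets \<nu> = sets X" "\<And>g. g \<in> carrier \<Gamma> \<Longrightarrow> distr \<nu> \<nu> (\<alpha> g) = \<nu>"
    by (auto simp: invariant_prob_def)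
  have sp: "space X = space \<nu>" using \<nu>(2) by (metis sets_eq_imp_space_eq)
  have act: "group_action \<Gamma> (space \<nu>) \<alpha>" and meas: "\<And>g. g \<in> carrier \<Gamma> \<Longrightarrow> \<alpha> g \<in> measurable \<nu> \<nu>"
    using \<open>standard_action \<Gamma> X \<alpha>\<close> measurable_cong_sets[OF \<nu>(2) \<nu>(2)] by (auto simp: standard_action_def sp)
  \<comment> \<open>That the fundamental group satisfies the group axioms is read off from the given
    action, whose definition includes it.\<close>
  have "group \<Gamma>" using act by (simp add: group_action_def group_hom_def)
  note gset = deck_free_gset[OF \<open>closed_manifold n M\<close> \<open>covering_space Mt p M\<close> \<open>simply_connected Mt\<close>
      \<open>y \<in> Mt\<close> \<open>\<Gamma> = fundamental_group M (p y)\<close> this]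
  obtain f where f: "gchain_homotopy_inverse \<Gamma> (restrict_complex D C) D (\<lambda>k. id) f" "norm_at_most_1 D f"
    using assms(11) by blast
  interpret S: equivariant_subcomplex \<Gamma> \<alpha> \<nu> \<A> Mt p "deck Mt p y" D C f n
  proof (intro equivariant_subcomplex.intro dense_algebra_action.intro measure_action.intro
      dense_algebra_action_axioms.intro equivariant_subcomplex_axioms.intro)
    show "dense_subalgebra \<A> \<nu>" using assms(17) \<nu> by blast
    show "algebra (space \<nu>) \<A>" using assms(13) by (simp only: sp)
    show "\<A> \<subseteq> sets \<nu>" using assms(14) \<nu>(2) by simp
    show "\<alpha> g ` A \<in> \<A>" if "g \<in> carrier \<Gamma>" "A \<in> \<A>" for g A using assms(16) that by blast
    show "D k = with_act (chain_group k (top_of_set Mt)) (\<lambda>g. chain_map k (deck Mt p y g))" for k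
      by (simp add: assms(8) singular_complex_def)
  qed (fact act meas \<nu>(1,3) assms(9) f gset)+
  show "parametrised_simplicial_volume \<Gamma> Mt D p n (fundamental_class n M ort) \<alpha> \<nu> =
    (INF c \<in> {c \<in> carrier (Sigma_chains \<Gamma> D C X \<alpha> \<A> n).
        Sigma_to_strict \<Gamma> D X \<alpha> n c
          \<in> strict_fundamental_cycles \<Gamma> D p n (fundamental_class n M ort) X \<alpha>}.
      strict_norm \<Gamma> Mt D p n X \<alpha> \<nu> (Sigma_to_strict \<Gamma> D X \<alpha> n c))"
    unfolding Sigma_chains_def Sigma_to_strict_def strict_fundamental_cycles_def strict_norm_def modules_cong[OF \<nu>(2)]
    by (rule S.parametrised_simplicial_volume_eq)
qed

end
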